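(* (Second-order refinement of exact recovery.) For any constants $c_0,c_1\in(0,1)$ there exist constants $C_1,C_2>0$ (which, for the Censored Block Model, may depend on its constant $\epsilon$) such that the following holds for the $\mathbb{Z}_2$ Synchronization model, the Censored Block Model, and the binary symmetric Stochastic Block Model with $0<c_0p\le q<p\le1-c_1$. If $$\frac{\bar nI^*}{\log n}\ \ge\ 1+\frac{C_1}{\sqrt{\log n}}+\frac{C_2}{\log n},$$ then with probability at least $1-10\exp(-\sqrt{\log n})$, every $\widehat Y\in\mathcal{Y}(A)$ satisfies $\widehat Y=Y^*$ (exact recovery by the SDP).
   Context: Models. $\sigma^*\in\{\pm1\}^n$, $n\ge2$, is the (deterministic) ground-truth label vector, $Y^*=\sigma^*(\sigma^* )^\top$. The observed matrix $A\in\mathbb{R}^{n\times n}$ is symmetric with independent entries $\{A_{ij}:i\le j\}$: - $\mathbb{Z}_2$ Synchronization: $A_{ij}\sim N(\sigma_i^*\sigma_j^*,\tau^2)$, $\tau>0$ (may depend on $n$). - Censored Block Model: $A_{ij}=\sigma_i^*\sigma_j^*$ w.p. $\alpha(1-\epsilon)$, $-\sigma_i^*\sigma_j^*$ w.p. $\alpha\epsilon$, $0$ w.p. $1-\alpha$; $\alpha\in(0,1]$ may depend on $n$, $\epsilon\in(0,\frac12)$ is a constant. - Binary symmetric Stochastic Block Model: $\sum_i\sigma_i^*=0$, and $A_{ij}\sim\mathrm{Ber}(p)$ if $\sigma_i^*\sigma_j^*=1$, $A_{ij}\sim\mathrm{Ber}(q)$ if $\sigma_i^*\sigma_j^*=-1$;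 $0<q<p<1$ may depend on $n$. $I^*=(2\tau^2)^{-1}$, resp. $I^*=(\sqrt{\alpha(1-\epsilon)}-\sqrt{\alpha\epsilon})^2$, resp. $I^*=-2\log[\sqrt{pq}+\sqrt{(1-p)(1-q)}]$ for the three models. $\bar n=n$ for the first two models and $\bar n=n/2$ for the Stochastic Block Model. SDP: maximize $\langle A,Y\rangle=\sum_{i,j}A_{ij}Y_{ij}$ over $Y\in\mathbb{R}^{n\times n}$ with $Y\succeq0$ (symmetric positive semidefinite), $Y_{ii}=1$ for all $i$, and, for the Stochastic Block Model only, additionally $\sum_{i,j}Y_{ij}=0$. $\mathcal{Y}(A)$ is the set of SDP-feasible $Y$ with $\langle A,Y\rangle\ge\langle A,Y^*\rangle$. *)

theory Defs
  imports "HOL-Probability.Probability" "Jordan_Normal_Form.Matrix"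
begin

definition label_vec :: "nat \<Rightarrow> real vec \<Rightarrow> bool" where
  "label_vec n \<sigma> \<longleftrightarrow> \<sigma> \<in> carrier_vec n \<and> (\<forall>i<n. \<sigma> $ i \<in> {-1, 1})"

definition outer_mat :: "nat \<Rightarrow> real vec \<Rightarrow> real mat" where
  "outer_mat n \<sigma> = mat n n (\<lambda>(i, j). \<sigma> $ i * \<sigma> $ j)"

text \<open>The observed matrix is represented by its law \<open>M\<close>, a probability measure on matrices whose
  sigma-algebra makes all entries random variables.  Since all conclusions concern a single matrix
  and depend on nothing else, this is the same as a random matrix on an arbitrary probability space;
  it avoids a type variable for the sample space, on which the constants of a theorem could depend.\<close>

definition random_symmetric_mat :: "nat \<Rightarrow> real mat measure \<Rightarrow> bool" where
  "random_symmetric_mat n M \<longleftrightarrow>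
     prob_space M \<and>
     (\<forall>A\<in>space M. A \<in> carrier_mat n n \<and> transpose_mat A = A) \<and>
     prob_space.indep_vars M (\<lambda>_. borel) (\<lambda>(i, j) A. A $$ (i, j)) {(i, j). i \<le> j \<and> j < n}"

definition Z2_sync :: "nat \<Rightarrow> real vec \<Rightarrow> real \<Rightarrow> real mat measure \<Rightarrow> bool" where
  "Z2_sync n \<sigma> \<tau> M \<longleftrightarrow>
     random_symmetric_mat n M \<and>
     (\<forall>i j. i \<le> j \<and> j < n \<longrightarrow>
        distributed M lborel (\<lambda>A. A $$ (i, j)) (normal_density (\<sigma> $ i * \<sigma> $ j) \<tau>))"

definition censored_block :: "nat \<Rightarrow> real vec \<Rightarrow> real \<Rightarrow> real \<Rightarrow> real mat measure \<Rightarrow> bool" where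
  "censored_block n \<sigma> \<alpha> \<epsilon> M \<longleftrightarrow>
     random_symmetric_mat n M \<and>
     (\<forall>i j. i \<le> j \<and> j < n \<longrightarrow>
        measure M {A \<in> space M. A $$ (i, j) = \<sigma> $ i * \<sigma> $ j} = \<alpha> * (1 - \<epsilon>) \<and>
        measure M {A \<in> space M. A $$ (i, j) = - (\<sigma> $ i * \<sigma> $ j)} = \<alpha> * \<epsilon> \<and>
        measure M {A \<in> space M. A $$ (i, j) = 0} = 1 - \<alpha>)"

definition symmetric_SBM :: "nat \<Rightarrow> real vec \<Rightarrow> real \<Rightarrow> real \<Rightarrow> real mat measure \<Rightarrow> bool" where
  "symmetric_SBM n \<sigma> p q M \<longleftrightarrow>
     (\<Sum>i<n. \<sigma> $ i) = 0 \<and>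
     random_symmetric_mat n M \<and>
     (\<forall>i j. i \<le> j \<and> j < n \<longrightarrow>
        (\<sigma> $ i * \<sigma> $ j = 1 \<longrightarrow>
           distr M borel (\<lambda>A. A $$ (i, j)) = distr (measure_pmf (bernoulli_pmf p)) borel of_bool) \<and>
        (\<sigma> $ i * \<sigma> $ j = -1 \<longrightarrow>
           distr M borel (\<lambda>A. A $$ (i, j)) = distr (measure_pmf (bernoulli_pmf q)) borel of_bool))"

definition I_Z2 :: "real \<Rightarrow> real" where
  "I_Z2 \<tau> = 1 / (2 * \<tau>\<^sup>2)"

definition I_CBM :: "real \<Rightarrow> real \<Rightarrow> real" where
  "I_CBM \<alpha> \<epsilon> = (sqrt (\<alpha> * (1 - \<epsilon>)) - sqrt (\<alpha> * \<epsilon>))\<^sup>2"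

definition I_SBM :: "real \<Rightarrow> real \<Rightarrow> real" where
  "I_SBM p q = - 2 * ln (sqrt (p * q) + sqrt ((1 - p) * (1 - q)))"

definition mat_inner :: "nat \<Rightarrow> real mat \<Rightarrow> real mat \<Rightarrow> real" where
  "mat_inner n A Y = (\<Sum>i<n. \<Sum>j<n. A $$ (i, j) * Y $$ (i, j))"

definition psd_mat :: "nat \<Rightarrow> real mat \<Rightarrow> bool" where
  "psd_mat n Y \<longleftrightarrow>
     Y \<in> carrier_mat n n \<and> transpose_mat Y = Y \<and>
     (\<forall>v\<in>carrier_vec n. 0 \<le> scalar_prod v (Y *\<^sub>v v))"

definition sdp_feasible :: "nat \<Rightarrow> real mat set" where
  "sdp_feasible n = {Y. psd_mat n Y \<and> (\<forall>i<n. Y $$ (i, i) = 1)}"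

definition sdp_feasible_SBM :: "nat \<Rightarrow> real mat set" where
  "sdp_feasible_SBM n = {Y \<in> sdp_feasible n. (\<Sum>i<n. \<Sum>j<n. Y $$ (i, j)) = 0}"

definition sdp_superlevel :: "nat \<Rightarrow> real mat set \<Rightarrow> real vec \<Rightarrow> real mat \<Rightarrow> real mat set" where
  "sdp_superlevel n F \<sigma> A =
     {Y \<in> F. mat_inner n A Y \<ge> mat_inner n A (outer_mat n \<sigma>)}"

definition exact_recovery_prob :: "nat \<Rightarrow> real mat set \<Rightarrow> real vec \<Rightarrow> real mat measure \<Rightarrow> real" where
  "exact_recovery_prob n F \<sigma> M =
     measure M {A \<in> space M. \<forall>Y \<in> sdp_superlevel n F \<sigma> A. Y = outer_mat n \<sigma>}"

end

theory Submission
  imports Defs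
begin

text \<open>Put \<open>D\<close> for the diagonal matrix with entries \<open>d i = (\<Sum>j. A i j * \<sigma> i * \<sigma> j)\<close>.  The matrix
  \<open>D - A\<close> annihilates \<open>\<sigma>\<close>, and it is a dual certificate of uniqueness as soon as it is positive definite
  on the complement of \<open>\<sigma>\<close> (and of the all-ones vector for the block model).  There the mean of \<open>A\<close>
  vanishes as a quadratic form, so it suffices that every \<open>d i\<close> exceeds the norm of the noise
  \<open>A - E A\<close>.  That norm is \<open>O(\<tau> \<surd>n)\<close> or \<open>O(\<surd>(n \<alpha>))\<close> or \<open>O(\<surd>(n p))\<close>, and moving the Chernoff threshold
  of \<open>d i\<close> from \<open>0\<close> to this level changes the exponent \<open>x = nbar I\<close> only to \<open>x - K \<surd>x\<close>, which is the
  second-order term of the theorem.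

  The norm bound in the sparse models, where \<open>n \<alpha>\<close> may be as small as \<open>ln n\<close>, uses a trace moment
  of order \<open>2 p\<close> with \<open>p\<close> of order \<open>n \<alpha>\<close>.  Only closed walks traversing every edge at least twice
  contribute; counting them by shape shows that, up to a factor \<open>n\<close>, the moment is at most that of
  a \<open>2 p\<close>-dimensional matrix with independent bounded entries whose moments of order at least two
  are at least one, and the latter is controlled by a net argument.\<close>

section \<open>Gram decomposition and the dual certificate\<close>

text \<open>A net applied directly to the sparse noise fails: an entry of variance about \<alpha>
  and range of order one has exponential moments far above those of a Gaussian of variance \<alpha>,
  and the scaling of the norm would be lost. Moments are compared instead. A closed walk of length 2
  p with m + 1 distinct vertices has at least m distinct edges, and m <= p when every edge is
  doubled, so its shape carries weight at most n^(m+1) \<alpha>^m <= n p^m. In dimension 2 p the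
  same shape has at least p^m realizations, and there the matrix is dense, so the net is sharp up to
  constants. The stray factor n is harmless because p is at least of order ln n: enlarging the norm
  bound by a constant factor gains exp (s p), enough to leave failure probability 1/n. The Chernoff
  tilt t stays at its optimum for threshold 0. Raising the threshold to the noise level s costs a
  factor exp (t s), and in each model t s <= K sqrt x with K built from the norm constants.\<close>

definition bform :: "nat \<Rightarrow> (nat \<Rightarrow> nat \<Rightarrow> real) \<Rightarrow> (nat \<Rightarrow> real) \<Rightarrow> (nat \<Rightarrow> real) \<Rightarrow> real" where
  "bform n W x y = (\<Sum>i<n. \<Sum>j<n. x i * W i j * y j)"

lemma bform_add_left: "bform n W (\<lambda>i. x i + z i) y = bform n W x y + bform n W z y"
  by (simp add: bform_def sum.distrib algebra_simps)

lemma bform_add_right: "bform n W x (\<lambda>i. y i + z i) = bform n W x y + bform n W x z"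
  by (simp add: bform_def sum.distrib algebra_simps)

lemma bform_scale_left: "bform n W (\<lambda>i. c * x i) y = c * bform n W x y"
  by (simp add: bform_def sum_distrib_left mult.assoc)

lemma bform_scale_right: "bform n W x (\<lambda>i. c * y i) = c * bform n W x y"
  by (simp add: bform_def sum_distrib_left mult_ac)

lemma bform_add_mat: "bform n (\<lambda>i j. V i j + W i j) x y = bform n V x y + bform n W x y"
  by (simp add: bform_def sum.distrib algebra_simps)

lemma bform_Suc:
  "bform (Suc n) W x y = bform n W x y + y n * (\<Sum>i<n. x i * W i n)
     + x n * (\<Sum>j<n. W n j * y j) + x n * W n n * y n"
  by (simp add: bform_def sum.distrib sum_distrib_left algebra_simps)

lemma bform_cong:
  assumes "\<And>i. i < n \<Longrightarrow> x i = x' i" "\<And>i. i < n \<Longrightarrow> y i = y' i"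
  shows "bform n W x y = bform n W x' y'"
  unfolding bform_def using assms by (intro sum.cong) auto

lemma bform_le_scale:
  assumes "\<And>x. (\<Sum>i<n. (x i)\<^sup>2) = 1 \<Longrightarrow> bform n W x x \<le> T"
  shows "bform n W x x \<le> T * (\<Sum>i<n. (x i)\<^sup>2)"
proof (cases "(\<Sum>i<n. (x i)\<^sup>2) = 0")
  case True
  then have "x i = 0" if "i < n" for i using that by (subst (asm) sum_nonneg_eq_0_iff) auto
  then show ?thesis using True by (simp add: bform_def)
next
  case False
  define s where "s = (\<Sum>i<n. (x i)\<^sup>2)"
  have s: "s > 0" using False by (simp add: s_def order_less_le sum_nonneg)
  have "(\<Sum>i<n. (1 / sqrt s * x i)\<^sup>2) = (\<Sum>i<n. (x i)\<^sup>2) / s"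
    using s by (simp add: power_mult_distrib power_divide sum_divide_distrib)
  then have "(\<Sum>i<n. (1 / sqrt s * x i)\<^sup>2) = 1" using s by (simp add: s_def)
  then have "bform n W (\<lambda>i. 1 / sqrt s * x i) (\<lambda>i. 1 / sqrt s * x i) \<le> T" by (rule assms)
  moreover have "bform n W (\<lambda>i. 1 / sqrt s * x i) (\<lambda>i. 1 / sqrt s * x i) = bform n W x x / s"
    unfolding bform_scale_left bform_scale_right using s by simp
  ultimately show ?thesis using s by (simp add: s_def pos_divide_le_eq)
qed

text \<open>Otherwise the linear term dominates at a small t of the sign opposite to b. This is how
  a vanishing diagonal entry of a positive semidefinite matrix kills its column.\<close>

lemma linear_quadratic_zero:
  fixes a b :: real
  assumes "\<And>t. 0 \<le> t * t * a + 2 * t * b"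
  shows "b = 0"
proof (rule ccontr)
  assume b: "b \<noteq> 0"
  \<comment> \<open>At \<open>t = - b / k\<close> the expression is b^2 / k^2 times (a - 2 k), and
    this \<open>k\<close> makes the bracket negative for every a.\<close>
  define k where "k = \<bar>a\<bar> + 1"
  have k: "k > 0" "k \<noteq> 0" "a < 2 * k" by (auto simp: k_def)
  have "0 \<le> (- b / k) * (- b / k) * a + 2 * (- b / k) * b" by (rule assms)
  also have "\<dots> = (b\<^sup>2 / k\<^sup>2) * (a - 2 * k)"
    using k(2) by (simp add: power2_eq_square divide_simps) (simp add: algebra_simps)
  also have "\<dots> < 0" using b k by (intro mult_pos_neg) auto
  finally show False by simp
qed

text \<open>Induction by Schur complement: subtracting the rank-one matrix of the last column,
  divided by the root of the last diagonal entry, clears the last row and column and keeps the rest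
  positive semidefinite. It plays the role of a square root of Y without eigenvalues.\<close>

lemma psd_gram:
  fixes Y :: "nat \<Rightarrow> nat \<Rightarrow> real"
  assumes "\<And>i j. i < n \<Longrightarrow> j < n \<Longrightarrow> Y i j = Y j i"
    and "\<And>x. 0 \<le> bform n Y x x"
  shows "\<exists>v. \<forall>i<n. \<forall>j<n. Y i j = (\<Sum>k<n. v k i * v k j)"
  using assms
proof (induction n arbitrary: Y)
  case 0
  show ?case by simp
next
  case (Suc n)
  define a where "a = Y n n"
  have form: "bform (Suc n) Y x x = bform n Y x x + 2 * x n * (\<Sum>i<n. x i * Y i n) + a * (x n)\<^sup>2" for x
  proof -
    have "(\<Sum>j<n. Y n j * x j) = (\<Sum>i<n. x i * Y i n)"
      using Suc.prems(1) by (intro sum.cong) auto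
    then show ?thesis by (simp add: bform_Suc a_def power2_eq_square)
  qed
  have a0: "0 \<le> a"
    using Suc.prems(2)[of "\<lambda>i. if i = n then 1 else 0"] by (simp add: form bform_def a_def)
  have zero: "Y i n = 0" if "a = 0" "i < n" for i
  proof (rule linear_quadratic_zero)
    fix t :: real
    let ?x = "\<lambda>j. if j = n then 1 else if j = i then t else 0 :: real"
    have "bform n Y ?x ?x = (\<Sum>k<n. if k = i then (\<Sum>l<n. if l = i then t * t * Y i i else 0) else 0)"
    proof (unfold bform_def, intro sum.cong refl)
      fix k assume "k \<in> {..<n}"
      have "(\<Sum>j<n. ?x k * Y k j * ?x j) = (\<Sum>l<n. if l = i then ?x k * Y k i * t else 0)"
        using that by (intro sum.cong) auto
      also have "\<dots> = ?x k * Y k i * t" using that by simp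
      finally show "(\<Sum>j<n. ?x k * Y k j * ?x j) =
          (if k = i then (\<Sum>l<n. if l = i then t * t * Y i i else 0) else 0)"
        using that \<open>k \<in> {..<n}\<close> by simp
    qed
    also have "\<dots> = t * t * Y i i" using that by simp
    finally have b: "bform n Y ?x ?x = t * t * Y i i" .
    have s: "(\<Sum>k<n. ?x k * Y k n) = (\<Sum>k<n. if k = i then t * Y i n else 0)"
      by (intro sum.cong) auto
    show "0 \<le> t * t * Y i i + 2 * t * Y i n"
      using Suc.prems(2)[of ?x] that unfolding form b s by simp
  qed
  \<comment> \<open>For a = 0 the division by zero gives w = 0, which agrees with the last column,
    already shown to vanish.\<close>
  define w where "w i = Y i n / sqrt a" for i
  have wn: "Y i n = w i * w n" if "i \<le> n" for i
  proof (cases "a = 0")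
    case True
    then show ?thesis using zero[of i] that a_def by (cases "i = n") (auto simp: w_def)
  next
    case False
    then show ?thesis using a0 by (simp add: w_def a_def)
  qed
  define Y' where "Y' i j = Y i j - w i * w j" for i j
  have psd': "0 \<le> bform n Y' x x" for x
  proof -
    define s where "s = (\<Sum>i<n. x i * w i)"
    \<comment> \<open>The last coordinate that minimises the larger form for given x; the minimum is
      the form of the Schur complement.\<close>
    define c where "c = (if a = 0 then 0 else - s / sqrt a)"
    let ?x = "\<lambda>i. if i = n then c else x i"
    have sY: "(\<Sum>i<n. x i * Y i n) = s * w n"
      unfolding s_def sum_distrib_right using wn by (intro sum.cong) auto
    have "bform n Y' x x = bform n Y x x - s * s"
      unfolding bform_def Y'_def s_def sum_product
      by (simp add: sum_subtractf algebra_simps)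
    moreover have "bform (Suc n) Y ?x ?x = bform n Y x x + 2 * c * (s * w n) + a * c\<^sup>2"
    proof -
      have "bform n Y ?x ?x = bform n Y x x" by (intro bform_cong) auto
      moreover have "(\<Sum>i<n. ?x i * Y i n) = s * w n" unfolding sY[symmetric] by (intro sum.cong) auto
      ultimately show ?thesis by (simp add: form)
    qed
    moreover have "2 * c * (s * w n) + a * c\<^sup>2 = - s * s" if "a \<noteq> 0"
    proof -
      have "w n = sqrt a" using a0 that by (simp add: w_def a_def real_div_sqrt)
      then show ?thesis using that a0 by (simp add: c_def power2_eq_square field_simps)
    qed
    moreover have "s = 0" if "a = 0"
      using that by (simp add: s_def w_def)
    ultimately show ?thesis using Suc.prems(2)[of ?x] by (cases "a = 0") (auto simp: c_def)
  qed
  have "\<exists>v. \<forall>i<n. \<forall>j<n. Y' i j = (\<Sum>k<n. v k i * v k j)"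
  proof (rule Suc.IH[OF _ psd'])
    fix i j assume "i < n" "j < n"
    then show "Y' i j = Y' j i" using Suc.prems(1)[of i j] by (simp add: Y'_def)
  qed
  then obtain v where v: "\<And>i j. i < n \<Longrightarrow> j < n \<Longrightarrow> Y' i j = (\<Sum>k<n. v k i * v k j)" by blast
  define u where "u k i = (if k = n then w i else if i = n then 0 else v k i)" for k i
  have "Y i j = (\<Sum>k<Suc n. u k i * u k j)" if "i < Suc n" "j < Suc n" for i j
  proof (cases "i < n \<and> j < n")
    case True
    then have "(\<Sum>k<n. u k i * u k j) = Y' i j" by (subst v) (auto simp: u_def)
    then show ?thesis by (simp add: u_def Y'_def)
  next
    case False
    then have "(\<Sum>k<n. u k i * u k j) = 0" using that by (intro sum.neutral) (auto simp: u_def)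
    moreover have "Y i j = w i * w j"
    proof (cases "j = n")
      case True
      then show ?thesis using wn[of i] that by auto
    next
      case False
      then have "i = n" using \<open>\<not> (i < n \<and> j < n)\<close> that by auto
      then show ?thesis using wn[of j] Suc.prems(1)[of n j] that by auto
    qed
    ultimately show ?thesis by (simp add: u_def)
  qed
  then show ?case by blast
qed

text \<open>Duality with complementary slackness. The form \<open>q\<close> of D - A, summed over
  the Gram factors \<open>v k\<close> of Y, is the objective at the truth minus the objective at Y,
  hence at most 0. As D - A annihilates \<sigma>, projecting each factor off \<sigma> leaves
  \<open>q\<close> unchanged, and positivity on the complement forces all projections to vanish; the
  unit diagonal then fixes the remaining multiple. The flag \<open>c\<close> switches on the balance
  constraints of the block model, and \<open>pos\<close> is positive definiteness on the constrained
  subspace in contrapositive form.\<close>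

lemma sdp_dual_certificate:
  fixes A Y :: "nat \<Rightarrow> nat \<Rightarrow> real" and \<sigma> :: "nat \<Rightarrow> real" and n :: nat
  defines "d \<equiv> \<lambda>i. \<Sum>j<n. A i j * \<sigma> i * \<sigma> j"
  assumes \<sigma>: "\<And>i. i < n \<Longrightarrow> \<sigma> i = -1 \<or> \<sigma> i = 1"
    and symA: "\<And>i j. i < n \<Longrightarrow> j < n \<Longrightarrow> A i j = A j i"
    and symY: "\<And>i j. i < n \<Longrightarrow> j < n \<Longrightarrow> Y i j = Y j i"
    and psd: "\<And>x. 0 \<le> bform n Y x x"
    and diag: "\<And>i. i < n \<Longrightarrow> Y i i = 1"
    and bal: "c \<Longrightarrow> (\<Sum>i<n. \<sigma> i) = 0 \<and> (\<Sum>i<n. \<Sum>j<n. Y i j) = 0"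
    and pos: "\<And>x i. (\<Sum>i<n. \<sigma> i * x i) = 0 \<Longrightarrow> (c \<Longrightarrow> (\<Sum>i<n. x i) = 0) \<Longrightarrow>
        (\<Sum>i<n. d i * (x i)\<^sup>2) \<le> bform n A x x \<Longrightarrow> i < n \<Longrightarrow> x i = 0"
    and opt: "(\<Sum>i<n. \<Sum>j<n. A i j * (\<sigma> i * \<sigma> j)) \<le> (\<Sum>i<n. \<Sum>j<n. A i j * Y i j)"
    and ij: "i < n" "j < n"
  shows "Y i j = \<sigma> i * \<sigma> j"
proof -
  obtain v where v: "\<And>i j. i < n \<Longrightarrow> j < n \<Longrightarrow> Y i j = (\<Sum>k<n. v k i * v k j)"
    using psd_gram[of n Y] symY psd by blast
  have \<sigma>2: "\<sigma> i * \<sigma> i = 1" if "i < n" for i using \<sigma>[OF that] by auto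
  define q where "q x = (\<Sum>i<n. d i * (x i)\<^sup>2) - bform n A x x" for x
  define a where "a k = (\<Sum>i<n. \<sigma> i * v k i) / n" for k
  define w where "w k i = v k i - a k * \<sigma> i" for k i
  have w\<sigma>: "(\<Sum>i<n. \<sigma> i * w k i) = 0" for k
  proof -
    have "(\<Sum>i<n. \<sigma> i * w k i) = (\<Sum>i<n. \<sigma> i * v k i) - a k * (\<Sum>i<n. \<sigma> i * \<sigma> i)"
      by (simp add: w_def right_diff_distrib sum_subtractf sum_distrib_left mult_ac)
    also have "(\<Sum>i<n. \<sigma> i * \<sigma> i) = n" using \<sigma>2 by simp
    finally show ?thesis using ij by (simp add: a_def)
  qed
  \<comment> \<open>The entry sum of Y is the sum over k of the squared coordinate sums of
    \<open>v k\<close>, so a zero total makes every factor orthogonal to the all-ones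
    vector.\<close>
  have w1: "(\<Sum>i<n. w k i) = 0" if c "k < n" for k
  proof -
    have "(\<Sum>k<n. (\<Sum>i<n. v k i)\<^sup>2) = (\<Sum>k<n. \<Sum>i<n. \<Sum>j<n. v k i * v k j)"
      by (simp add: power2_eq_square sum_product)
    also have "\<dots> = (\<Sum>i<n. \<Sum>k<n. \<Sum>j<n. v k i * v k j)"
      by (rule sum.swap)
    also have "\<dots> = (\<Sum>i<n. \<Sum>j<n. \<Sum>k<n. v k i * v k j)"
      by (intro sum.cong refl sum.swap)
    also have "\<dots> = (\<Sum>i<n. \<Sum>j<n. Y i j)" using v by simp
    also have "\<dots> = 0" using bal that by simp
    finally have "(\<Sum>i<n. v k i)\<^sup>2 = 0" using that
      by (subst (asm) sum_nonneg_eq_0_iff) auto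
    then have "(\<Sum>i<n. v k i) = 0" by simp
    then show ?thesis using bal that
      by (simp add: w_def sum_subtractf sum_distrib_left[symmetric])
  qed
  have S\<sigma>: "(\<Sum>i<n. d i * (\<sigma> i * x i)) = bform n A \<sigma> x" for x
  proof -
    have "bform n A \<sigma> x = (\<Sum>j<n. \<Sum>i<n. \<sigma> i * A i j * x j)"
      unfolding bform_def by (rule sum.swap)
    also have "\<dots> = (\<Sum>j<n. d j * (\<sigma> j * x j))"
    proof (intro sum.cong refl)
      fix j assume "j \<in> {..<n}"
      then have j: "j < n" by simp
      have "d j * (\<sigma> j * x j) = (\<Sum>i<n. A j i * \<sigma> i * (\<sigma> j * \<sigma> j) * x j)"
        unfolding d_def sum_distrib_right by (intro sum.cong) (auto simp: mult_ac)
      also have "\<dots> = (\<Sum>i<n. \<sigma> i * A i j * x j)"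
        using symA j \<sigma>2[OF j] by (intro sum.cong) auto
      finally show "(\<Sum>i<n. \<sigma> i * A i j * x j) = d j * (\<sigma> j * x j)" by simp
    qed
    finally show ?thesis by simp
  qed
  have S\<sigma>': "bform n A x \<sigma> = bform n A \<sigma> x" for x
  proof -
    have "bform n A x \<sigma> = (\<Sum>j<n. \<Sum>i<n. x i * A i j * \<sigma> j)"
      unfolding bform_def by (rule sum.swap)
    also have "\<dots> = bform n A \<sigma> x"
      unfolding bform_def using symA by (intro sum.cong refl) (auto simp: mult_ac)
    finally show ?thesis .
  qed
  have qvw: "q (v k) = q (w k)" for k
  proof -
    have v: "v k = (\<lambda>i. w k i + a k * \<sigma> i)" by (auto simp: w_def)
    have "bform n A (v k) (v k) = bform n A (w k) (w k) + 2 * a k * bform n A \<sigma> (w k)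
        + a k * a k * bform n A \<sigma> \<sigma>"
      unfolding v bform_add_left bform_add_right bform_scale_left bform_scale_right
        S\<sigma>'[of "w k"] by (simp add: algebra_simps)
    moreover have "(\<Sum>i<n. d i * (v k i)\<^sup>2) = (\<Sum>i<n. d i * (w k i)\<^sup>2)
        + 2 * a k * (\<Sum>i<n. d i * (\<sigma> i * w k i)) + a k * a k * (\<Sum>i<n. d i * (\<sigma> i * \<sigma> i))"
      unfolding v by (simp add: sum.distrib sum_distrib_left power2_eq_square algebra_simps)
    ultimately show ?thesis by (simp add: q_def S\<sigma>)
  qed
  have "(\<Sum>k<n. q (v k)) \<le> 0"
  proof -
    have "(\<Sum>k<n. \<Sum>i<n. d i * (v k i)\<^sup>2) = (\<Sum>i<n. \<Sum>k<n. d i * (v k i)\<^sup>2)"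
      by (rule sum.swap)
    also have "\<dots> = (\<Sum>i<n. d i * Y i i)"
      by (simp add: v sum_distrib_left power2_eq_square)
    also have "\<dots> = (\<Sum>i<n. \<Sum>j<n. A i j * (\<sigma> i * \<sigma> j))"
      by (simp add: diag d_def mult_ac)
    finally have 1: "(\<Sum>k<n. \<Sum>i<n. d i * (v k i)\<^sup>2) = \<dots>" .
    have "(\<Sum>k<n. bform n A (v k) (v k)) = (\<Sum>i<n. \<Sum>k<n. \<Sum>j<n. v k i * A i j * v k j)"
      unfolding bform_def by (rule sum.swap)
    also have "\<dots> = (\<Sum>i<n. \<Sum>j<n. \<Sum>k<n. v k i * A i j * v k j)"
      by (intro sum.cong refl sum.swap)
    also have "\<dots> = (\<Sum>i<n. \<Sum>j<n. A i j * Y i j)"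
      by (intro sum.cong refl, subst v) (auto simp: sum_distrib_left mult_ac)
    finally show ?thesis using opt 1 by (simp add: q_def sum_subtractf)
  qed
  moreover have qw0: "0 \<le> q (w k)" if "k < n" for k
  proof (rule ccontr)
    assume neg: "\<not> 0 \<le> q (w k)"
    have "w k i = 0" if "i < n" for i
      by (rule pos[OF w\<sigma> w1 _ that]) (use neg \<open>k < n\<close> in \<open>auto simp: q_def\<close>)
    then have "q (w k) = 0" by (simp add: q_def bform_def)
    with neg show False by simp
  qed
  ultimately have "(\<Sum>k<n. q (w k)) = 0"
    by (intro antisym sum_nonneg) (auto simp: qvw)
  then have q0: "q (w k) = 0" if "k < n" for k
    using that qw0 by (subst (asm) sum_nonneg_eq_0_iff) auto
  have "w k i = 0" if "k < n" "i < n" for k i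
    by (rule pos[OF w\<sigma> w1 _ that(2)]) (use q0[OF that(1)] that(1) in \<open>auto simp: q_def\<close>)
  then have v': "v k i = a k * \<sigma> i" if "k < n" "i < n" for k i
    using that by (simp add: w_def)
  have Y: "Y i j = (\<Sum>k<n. a k * a k) * (\<sigma> i * \<sigma> j)" if "i < n" "j < n" for i j
    using that by (simp add: v v' sum_distrib_left sum_distrib_right mult_ac)
  have "(\<Sum>k<n. a k * a k) = 1"
    using Y[OF ij(1) ij(1)] diag[OF ij(1)] \<sigma>2[OF ij(1)] by simp
  then show ?thesis using Y[OF ij] by simp
qed

section \<open>Dense sub-Gaussian matrices\<close>

text \<open>Lattice points play the part of a net for the ball of radius sqrt n. The box gives a
  finite product set, over which the generating function of the count factors.\<close>

definition int_grid :: "nat \<Rightarrow> (nat \<Rightarrow> int) set" where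
  "int_grid n = {z \<in> {..<n} \<rightarrow>\<^sub>E {- int (4 * n)..int (4 * n)}. (\<Sum>i<n. (z i)\<^sup>2) \<le> 4 * int n}"

lemma finite_int_grid [simp, intro]: "finite (int_grid n)"
  by (rule finite_subset[of _ "{..<n} \<rightarrow>\<^sub>E {- int (4 * n)..int (4 * n)}"])
    (auto simp: int_grid_def intro!: finite_PiE)

lemma sum_half_power_abs:
  "(\<Sum>k\<in>{- int N..int N}. (1 / 2) ^ nat \<bar>k\<bar>) = (3 - 2 * (1 / 2) ^ N :: real)"
proof (induction N)
  case (Suc N)
  have "{- int (Suc N)..int (Suc N)} = insert (int (Suc N)) (insert (- int (Suc N)) {- int N..int N})"
    by auto
  then show ?case using Suc by (simp add: nat_add_distrib)
qed simp

text \<open>A generating-function count. On the grid the absolute values sum to at most 4 n, so each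
  point has weight at least 2^(-4 n) under the product of the weights 2^(-|k|), whose total per
  coordinate is at most 3. This gives 3^n 16^n = 48^n.\<close>

lemma card_int_grid: "card (int_grid n) \<le> 48 ^ n"
proof -
  let ?P = "{..<n} \<rightarrow>\<^sub>E {- int (4 * n)..int (4 * n)}"
  have "(1 / 2) ^ (4 * n) \<le> (\<Prod>i<n. (1 / 2 :: real) ^ nat \<bar>z i\<bar>)" if "z \<in> int_grid n" for z
  proof -
    have "(\<Sum>i<n. \<bar>z i\<bar>) \<le> (\<Sum>i<n. (z i)\<^sup>2)"
    proof (intro sum_mono)
      fix i show "\<bar>z i\<bar> \<le> (z i)\<^sup>2"
        using self_le_power[of "\<bar>z i\<bar>" 2] by (cases "z i = 0") auto
    qed
    then have "(\<Sum>i<n. \<bar>z i\<bar>) \<le> 4 * int n" using that by (simp add: int_grid_def)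
    moreover have "int (\<Sum>i<n. nat \<bar>z i\<bar>) = (\<Sum>i<n. \<bar>z i\<bar>)" by simp
    ultimately have "(\<Sum>i<n. nat \<bar>z i\<bar>) \<le> 4 * n" by linarith
    then have "(1 / 2 :: real) ^ (4 * n) \<le> (1 / 2) ^ (\<Sum>i<n. nat \<bar>z i\<bar>)"
      by (intro power_decreasing) auto
    then show ?thesis by (simp add: power_sum)
  qed
  then have "(\<Sum>z\<in>int_grid n. (1 / 2) ^ (4 * n))
      \<le> (\<Sum>z\<in>int_grid n. \<Prod>i<n. (1 / 2 :: real) ^ nat \<bar>z i\<bar>)"
    by (rule sum_mono)
  then have "card (int_grid n) * (1 / 2) ^ (4 * n)
      \<le> (\<Sum>z\<in>int_grid n. \<Prod>i<n. (1 / 2 :: real) ^ nat \<bar>z i\<bar>)"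
    by simp
  also have "\<dots> \<le> (\<Sum>z\<in>?P. \<Prod>i<n. (1 / 2 :: real) ^ nat \<bar>z i\<bar>)"
  proof (rule sum_mono2)
    show "finite ?P" by (intro finite_PiE) auto
    show "int_grid n \<subseteq> ?P" by (simp add: int_grid_def subset_eq)
  qed (intro prod_nonneg, simp)
  also have "\<dots> = (\<Prod>i<n. \<Sum>k\<in>{- int (4 * n)..int (4 * n)}. (1 / 2) ^ nat \<bar>k\<bar>)"
    by (rule prod_sum_PiE[symmetric]) auto
  also have "\<dots> \<le> (\<Prod>i<n. 3)"
    unfolding sum_half_power_abs
  proof (intro prod_mono conjI)
    have "(1 / 2 :: real) ^ (4 * n) \<le> 1" by (rule power_le_one) auto
    then show "0 \<le> (3 - 2 * (1 / 2) ^ (4 * n) :: real)" by linarith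
    show "(3 - 2 * (1 / 2) ^ (4 * n) :: real) \<le> 3" by simp
  qed
  finally have "card (int_grid n) \<le> 3 ^ n * (2::real) ^ (4 * n)"
    by (simp add: power_divide field_simps)
  also have "\<dots> = 48 ^ n"
    by (simp add: power_mult flip: power_mult_distrib)
  finally show ?thesis by (metis of_nat_le_iff of_nat_numeral of_nat_power)
qed

lemma zero_in_int_grid: "(\<lambda>i\<in>{..<n}. 0) \<in> int_grid n"
  by (auto simp: int_grid_def)

text \<open>Each coordinate is rounded in the direction favoured by the sign of its coefficient, so
  the linear functional does not decrease and no approximation error has to be absorbed. The price
  is the norm alone: (|u| + 1)^2 <= 2 u^2 + 2 at most doubles the radius.\<close>

lemma int_grid_rounding:
  fixes u c :: "nat \<Rightarrow> real"
  assumes "(\<Sum>i<n. (u i)\<^sup>2) \<le> n"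
  shows "\<exists>z\<in>int_grid n. (\<Sum>i<n. c i * u i) \<le> (\<Sum>i<n. c i * z i)"
proof
  define z where "z = (\<lambda>i\<in>{..<n}. \<lfloor>u i\<rfloor> + (if c i \<ge> 0 then 1 else 0))"
  have "real_of_int (z i) ^ 2 \<le> 2 * (u i)\<^sup>2 + 2" if "i < n" for i
  proof -
    have "\<bar>real_of_int (z i)\<bar> \<le> \<bar>u i\<bar> + 1" using that unfolding z_def by (auto; linarith)
    then have "\<bar>real_of_int (z i)\<bar>\<^sup>2 \<le> (\<bar>u i\<bar> + 1)\<^sup>2" by (intro power_mono) auto
    also have "\<dots> \<le> 2 * (u i)\<^sup>2 + 2"
      using sum_squares_ge_zero[of "\<bar>u i\<bar> - 1" 0] by (simp add: power2_eq_square algebra_simps)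
    finally show ?thesis by simp
  qed
  then have "(\<Sum>i<n. real_of_int (z i) ^ 2) \<le> (\<Sum>i<n. 2 * (u i)\<^sup>2 + 2)" by (intro sum_mono) auto
  also have "\<dots> \<le> 4 * real n" using assms by (simp add: sum.distrib flip: sum_distrib_left)
  finally have "real_of_int (\<Sum>i<n. (z i)\<^sup>2) \<le> real_of_int (4 * int n)" by simp
  then have sq: "(\<Sum>i<n. (z i)\<^sup>2) \<le> 4 * int n" by (simp only: of_int_le_iff)
  have "\<bar>z i\<bar> \<le> 4 * int n" if "i < n" for i
  proof -
    have "\<bar>z i\<bar> \<le> (z i)\<^sup>2" using self_le_power[of "\<bar>z i\<bar>" 2] by (cases "z i = 0") auto
    also have "\<dots> \<le> (\<Sum>i<n. (z i)\<^sup>2)" using that by (intro member_le_sum) auto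
    finally show ?thesis using sq by simp
  qed
  then show "z \<in> int_grid n"
    using sq by (fastforce simp: int_grid_def z_def abs_le_iff)
  show "(\<Sum>i<n. c i * u i) \<le> (\<Sum>i<n. c i * z i)"
  proof (intro sum_mono)
    fix i assume "i \<in> {..<n}"
    then have z: "real_of_int (z i) = \<lfloor>u i\<rfloor> + (if c i \<ge> 0 then 1 else 0)" by (simp add: z_def)
    show "c i * u i \<le> c i * z i"
    proof (cases "c i \<ge> 0")
      case True
      then have "u i \<le> z i" unfolding z by simp
      with True show ?thesis by (intro mult_left_mono)
    next
      case False
      then have "z i \<le> u i" unfolding z by simp
      with False show ?thesis by (intro mult_left_mono_neg) auto
    qed
  qed
qed

text \<open>After scaling by sqrt n, the left vector is rounded with the right one fixed, then the
  right one with the left already rounded; bilinearity makes each step a linear functional.\<close>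

lemma bform_le_int_grid:
  assumes "(\<Sum>i<n. (x i)\<^sup>2) \<le> 1" "(\<Sum>i<n. (y i)\<^sup>2) \<le> 1"
  shows "\<exists>z\<in>int_grid n. \<exists>z'\<in>int_grid n. n * bform n W x y \<le> bform n W z z'"
proof -
  define u v where "u i = sqrt n * x i" and "v i = sqrt n * y i" for i
  have "(\<Sum>i<n. (u i)\<^sup>2) = n * (\<Sum>i<n. (x i)\<^sup>2)" "(\<Sum>i<n. (v i)\<^sup>2) = n * (\<Sum>i<n. (y i)\<^sup>2)"
    by (simp_all add: u_def v_def power_mult_distrib sum_distrib_left)
  then have uv: "(\<Sum>i<n. (u i)\<^sup>2) \<le> n" "(\<Sum>i<n. (v i)\<^sup>2) \<le> n"
    using assms by (simp_all add: mult_left_le)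
  have left: "bform n W a b = (\<Sum>i<n. (\<Sum>j<n. W i j * b j) * a i)" for a b
    unfolding bform_def by (simp add: sum_distrib_left mult_ac)
  have right: "bform n W a b = (\<Sum>j<n. (\<Sum>i<n. a i * W i j) * b j)" for a b
    unfolding bform_def sum_distrib_right by (rule sum.swap)
  obtain z where z: "z \<in> int_grid n" "bform n W u v \<le> bform n W z v"
    unfolding left using int_grid_rounding[OF uv(1), of "\<lambda>i. \<Sum>j<n. W i j * v j"] by auto
  obtain z' where z': "z' \<in> int_grid n" "bform n W z v \<le> bform n W z z'"
    unfolding right using int_grid_rounding[OF uv(2), of "\<lambda>j. \<Sum>i<n. z i * W i j"] by auto
  have "n * bform n W x y = bform n W u v"
    unfolding u_def v_def bform_scale_left bform_scale_right by simp
  then show ?thesis using z z' by (intro bexI[of _ z] bexI[of _ z']) auto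
qed

section \<open>Forms in the independent entries on and above the diagonal\<close>

definition upper :: "nat \<Rightarrow> (nat \<times> nat) set" where
  "upper n = {(i, j). i \<le> j \<and> j < n}"

lemma finite_upper [simp, intro]: "finite (upper n)"
  by (rule finite_subset[of _ "{..<n} \<times> {..<n}"]) (auto simp: upper_def)

lemma sum_square_upper:
  fixes f :: "nat \<Rightarrow> nat \<Rightarrow> 'a :: comm_monoid_add"
  shows "(\<Sum>i<n. \<Sum>j<n. f i j) = (\<Sum>(i, j)\<in>upper n. if i = j then f i j else f i j + f j i)"
proof -
  let ?J = "{(i, j). i < j \<and> j < n}"
  have fin: "finite ?J" by (rule finite_subset[OF _ finite_upper[of n]]) (auto simp: upper_def)
  have "(\<Sum>i<n. \<Sum>j<n. f i j) = (\<Sum>(i, j)\<in>upper n \<union> prod.swap ` ?J. f i j)"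
    unfolding sum.cartesian_product by (intro sum.cong) (auto simp: upper_def image_iff)
  also have "\<dots> = (\<Sum>(i, j)\<in>upper n. f i j) + (\<Sum>(i, j)\<in>prod.swap ` ?J. f i j)"
    by (rule sum.union_disjoint[OF finite_upper finite_imageI[OF fin]]) (auto simp: upper_def)
  also have "(\<Sum>(i, j)\<in>prod.swap ` ?J. f i j) = (\<Sum>(i, j)\<in>?J. f j i)"
    by (subst sum.reindex) (auto simp: case_prod_beta)
  also have "\<dots> = (\<Sum>(i, j)\<in>upper n. if i = j then 0 else f j i)"
    by (intro sum.mono_neutral_cong_left finite_upper) (auto simp: upper_def split: if_splits)
  finally show ?thesis
    unfolding sum.distrib[symmetric] by (auto intro!: sum.cong)
qed

definition symm :: "(nat \<times> nat \<Rightarrow> 'a \<Rightarrow> real) \<Rightarrow> 'a \<Rightarrow> nat \<Rightarrow> nat \<Rightarrow> real" where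
  "symm X \<omega> i j = X (min i j, max i j) \<omega>"

lemma symm_sym: "symm X \<omega> i j = symm X \<omega> j i"
  by (simp add: symm_def min.commute max.commute)

lemma bform_symm_upper:
  "bform n (symm X \<omega>) a b =
     (\<Sum>(i, j)\<in>upper n. (if i = j then a i * b j else a i * b j + a j * b i) * X (i, j) \<omega>)"
  unfolding bform_def sum_square_upper
  by (intro sum.cong refl) (auto simp: upper_def symm_def algebra_simps min_def max_def)

lemma sum_upper_coeff_le:
  fixes a b :: "nat \<Rightarrow> real"
  shows "(\<Sum>(i, j)\<in>upper n. (if i = j then a i * b j else a i * b j + a j * b i)\<^sup>2)
     \<le> 2 * ((\<Sum>i<n. (a i)\<^sup>2) * (\<Sum>i<n. (b i)\<^sup>2))"
proof -
  have sq: "(x + y)\<^sup>2 \<le> 2 * x\<^sup>2 + 2 * y\<^sup>2" for x y :: real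
    using zero_le_power2[of "x - y"] by (simp add: power2_eq_square algebra_simps)
  have "(\<Sum>(i, j)\<in>upper n. (if i = j then a i * b j else a i * b j + a j * b i)\<^sup>2)
      \<le> (\<Sum>(i, j)\<in>upper n. if i = j then 2 * (a i * b j)\<^sup>2 else 2 * (a i * b j)\<^sup>2 + 2 * (a j * b i)\<^sup>2)"
    by (intro sum_mono) (auto simp: sq)
  also have "\<dots> = (\<Sum>i<n. \<Sum>j<n. 2 * (a i * b j)\<^sup>2)"
    by (rule sum_square_upper[symmetric])
  also have "\<dots> = 2 * ((\<Sum>i<n. (a i)\<^sup>2) * (\<Sum>i<n. (b i)\<^sup>2))"
    by (simp add: sum_product power_mult_distrib flip: sum_distrib_left)
  finally show ?thesis .
qed

text \<open>The form is linear in independent entries, so the sub-Gaussian factors with variance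
  proxy v multiply. Off-diagonal coefficients are sums of two products, which costs the factor 2 of
  \<open>sum_upper_coeff_le\<close>.\<close>

lemma (in prob_space) nn_integral_exp_bform_le:
  fixes X :: "nat \<times> nat \<Rightarrow> 'a \<Rightarrow> real"
  assumes indep: "indep_vars (\<lambda>_. borel) X (upper n)"
    and mgf: "\<And>i l. i \<in> upper n \<Longrightarrow> (\<integral>\<^sup>+\<omega>. ennreal (exp (l * X i \<omega>)) \<partial>M) \<le> ennreal (exp (v * l\<^sup>2 / 2))"
    and v: "0 \<le> v"
  shows "(\<integral>\<^sup>+\<omega>. ennreal (exp (\<theta> * bform n (symm X \<omega>) a b)) \<partial>M)
     \<le> ennreal (exp (v * \<theta>\<^sup>2 * ((\<Sum>i<n. (a i)\<^sup>2) * (\<Sum>i<n. (b i)\<^sup>2))))"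
proof -
  define c where "c = (\<lambda>(i, j). if i = j then a i * b j else a i * b j + a j * b i)"
  have b: "bform n (symm X \<omega>) a b = (\<Sum>i\<in>upper n. c i * X i \<omega>)" for \<omega>
    unfolding bform_symm_upper c_def by (intro sum.cong) auto
  have "(\<integral>\<^sup>+\<omega>. ennreal (exp (\<theta> * bform n (symm X \<omega>) a b)) \<partial>M)
      = (\<integral>\<^sup>+\<omega>. (\<Prod>i\<in>upper n. ennreal (exp (\<theta> * c i * X i \<omega>))) \<partial>M)"
    unfolding b by (simp add: sum_distrib_left exp_sum prod_ennreal mult_ac)
  also have "\<dots> = (\<Prod>i\<in>upper n. \<integral>\<^sup>+\<omega>. ennreal (exp (\<theta> * c i * X i \<omega>)) \<partial>M)"
  proof (rule indep_vars_nn_integral)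
    show "indep_vars (\<lambda>_. borel) (\<lambda>i \<omega>. ennreal (exp (\<theta> * c i * X i \<omega>))) (upper n)"
      by (rule indep_vars_compose2[OF indep, where Y = "\<lambda>i x. ennreal (exp (\<theta> * c i * x))"]) measurable
  qed auto
  also have "\<dots> \<le> (\<Prod>i\<in>upper n. ennreal (exp (v * (\<theta> * c i)\<^sup>2 / 2)))"
    by (intro prod_mono_ennreal mgf)
  also have "\<dots> = ennreal (exp (\<Sum>i\<in>upper n. v * (\<theta> * c i)\<^sup>2 / 2))"
    by (simp add: prod_ennreal exp_sum)
  also have "(\<Sum>i\<in>upper n. v * (\<theta> * c i)\<^sup>2 / 2) = v * \<theta>\<^sup>2 / 2 * (\<Sum>i\<in>upper n. (c i)\<^sup>2)"
    by (simp add: sum_distrib_left power_mult_distrib mult_ac)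
  also have "(\<Sum>i\<in>upper n. (c i)\<^sup>2) = (\<Sum>(i, j)\<in>upper n. (if i = j then a i * b j else a i * b j + a j * b i)\<^sup>2)"
    unfolding c_def by (intro sum.cong) auto
  also have "ennreal (exp (v * \<theta>\<^sup>2 / 2 * \<dots>)) \<le> ennreal (exp (v * \<theta>\<^sup>2 / 2 * (2 * ((\<Sum>i<n. (a i)\<^sup>2) * (\<Sum>i<n. (b i)\<^sup>2)))))"
    using v by (intro ennreal_leI) (simp only: exp_le_cancel_iff, intro mult_left_mono sum_upper_coeff_le, auto)
  finally show ?thesis by (simp add: mult.assoc)
qed

text \<open>A soft maximum of the form over pairs of grid points. Its expectation is a finite sum of
  exponential moments and replaces a union bound over the net, for expectations as well as for
  probabilities.\<close>

definition grid_mgf :: "nat \<Rightarrow> real \<Rightarrow> (nat \<Rightarrow> nat \<Rightarrow> real) \<Rightarrow> real" where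
  "grid_mgf n \<theta> W = (\<Sum>z\<in>int_grid n. \<Sum>z'\<in>int_grid n. exp (\<theta> * bform n W z z'))"

text \<open>The pair of zero vectors contributes exp 0; this keeps the logarithm
  nonnegative.\<close>

lemma grid_mgf_ge_1: "1 \<le> grid_mgf n \<theta> W"
proof -
  let ?z = "\<lambda>i\<in>{..<n}. 0 :: int"
  have "1 = exp (\<theta> * bform n W ?z ?z)" by (simp add: bform_def)
  also have "\<dots> \<le> (\<Sum>z'\<in>int_grid n. exp (\<theta> * bform n W ?z z'))"
    by (rule member_le_sum[of ?z _ "\<lambda>z'. exp (\<theta> * bform n W ?z z')"]) (auto simp: zero_in_int_grid)
  also have "\<dots> \<le> grid_mgf n \<theta> W"
    unfolding grid_mgf_def
    by (rule member_le_sum[of ?z _ "\<lambda>z. \<Sum>z'\<in>int_grid n. exp (\<theta> * bform n W z z')"])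
      (auto simp: zero_in_int_grid intro!: sum_nonneg)
  finally show ?thesis .
qed

lemma bform_le_ln_grid_mgf:
  assumes "0 < \<theta>" "0 < n" "(\<Sum>i<n. (x i)\<^sup>2) \<le> 1" "(\<Sum>i<n. (y i)\<^sup>2) \<le> 1"
  shows "bform n W x y \<le> ln (grid_mgf n \<theta> W) / (\<theta> * n)"
proof -
  obtain z z' where z: "z \<in> int_grid n" "z' \<in> int_grid n" "n * bform n W x y \<le> bform n W z z'"
    using bform_le_int_grid[OF assms(3,4)] by blast
  have "exp (\<theta> * bform n W z z') \<le> (\<Sum>z'\<in>int_grid n. exp (\<theta> * bform n W z z'))"
    by (rule member_le_sum[of z' _ "\<lambda>z'. exp (\<theta> * bform n W z z')"]) (auto simp: z)
  also have "\<dots> \<le> grid_mgf n \<theta> W"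
    unfolding grid_mgf_def
    by (rule member_le_sum[of z _ "\<lambda>z. \<Sum>z'\<in>int_grid n. exp (\<theta> * bform n W z z')"])
      (auto simp: z intro!: sum_nonneg)
  finally have "\<theta> * bform n W z z' \<le> ln (grid_mgf n \<theta> W)"
    using grid_mgf_ge_1[of n \<theta> W] by (simp add: ln_ge_iff)
  moreover have "\<theta> * (n * bform n W x y) \<le> \<theta> * bform n W z z'"
    using assms(1) z(3) by simp
  ultimately have "\<theta> * (n * bform n W x y) \<le> ln (grid_mgf n \<theta> W)" by linarith
  then show ?thesis using assms(1,2) by (simp add: pos_le_divide_eq mult_ac)
qed

text \<open>At most 48^(2 n) pairs of grid points, with product of squared norms at most (4 n)^2,
  whence the 16 in the exponent.\<close>

lemma (in prob_space) nn_integral_grid_mgf_le: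
  fixes X :: "nat \<times> nat \<Rightarrow> 'a \<Rightarrow> real"
  assumes indep: "indep_vars (\<lambda>_. borel) X (upper n)"
    and mgf: "\<And>i l. i \<in> upper n \<Longrightarrow> (\<integral>\<^sup>+\<omega>. ennreal (exp (l * X i \<omega>)) \<partial>M) \<le> ennreal (exp (v * l\<^sup>2 / 2))"
    and v: "0 \<le> v"
  shows "(\<integral>\<^sup>+\<omega>. ennreal (grid_mgf n \<theta> (symm X \<omega>)) \<partial>M)
     \<le> ennreal (48 ^ (2 * n) * exp (16 * v * \<theta>\<^sup>2 * (real n)\<^sup>2))"
proof -
  let ?B = "exp (16 * v * \<theta>\<^sup>2 * (real n)\<^sup>2)"
  have meas: "(\<lambda>\<omega>. ennreal (exp (\<theta> * bform n (symm X \<omega>) a b))) \<in> borel_measurable M" for a b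
  proof -
    have "random_variable borel (X i)" if "i \<in> upper n" for i
      using indep that by (auto simp: indep_vars_def)
    then show ?thesis unfolding bform_symm_upper
      by (intro measurable_compose[OF _ measurable_ennreal] borel_measurable_exp
        borel_measurable_times borel_measurable_const borel_measurable_sum)
       (auto intro!: borel_measurable_times)
  qed
  have one: "(\<integral>\<^sup>+\<omega>. ennreal (exp (\<theta> * bform n (symm X \<omega>) z z')) \<partial>M) \<le> ennreal ?B"
    if "z \<in> int_grid n" "z' \<in> int_grid n" for z z'
  proof -
    have g: "(\<Sum>i<n. (real_of_int (z i))\<^sup>2) \<le> 4 * real n" if "z \<in> int_grid n" for z
    proof -
      have "real_of_int (\<Sum>i<n. (z i)\<^sup>2) \<le> real_of_int (4 * int n)"
        using that unfolding int_grid_def by (subst of_int_le_iff) auto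
      then show ?thesis by simp
    qed
    have "(\<Sum>i<n. (real_of_int (z i))\<^sup>2) * (\<Sum>i<n. (real_of_int (z' i))\<^sup>2) \<le> (4 * real n) * (4 * real n)"
      by (intro mult_mono g that sum_nonneg) auto
    then have "v * \<theta>\<^sup>2 * ((\<Sum>i<n. (real_of_int (z i))\<^sup>2) * (\<Sum>i<n. (real_of_int (z' i))\<^sup>2))
        \<le> v * \<theta>\<^sup>2 * ((4 * real n) * (4 * real n))"
      using v by (intro mult_left_mono) auto
    also have "\<dots> = 16 * v * \<theta>\<^sup>2 * (real n)\<^sup>2" by (simp add: power2_eq_square)
    finally show ?thesis
      by (intro order.trans[OF nn_integral_exp_bform_le[OF indep mgf v]] ennreal_leI) auto
  qed
  have "(\<integral>\<^sup>+\<omega>. ennreal (grid_mgf n \<theta> (symm X \<omega>)) \<partial>M)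
     = (\<integral>\<^sup>+\<omega>. (\<Sum>z\<in>int_grid n. \<Sum>z'\<in>int_grid n. ennreal (exp (\<theta> * bform n (symm X \<omega>) z z'))) \<partial>M)"
    unfolding grid_mgf_def by (simp add: sum_nonneg flip: sum_ennreal)
  also have "\<dots> = (\<Sum>z\<in>int_grid n. \<Sum>z'\<in>int_grid n. \<integral>\<^sup>+\<omega>. ennreal (exp (\<theta> * bform n (symm X \<omega>) z z')) \<partial>M)"
    by (subst nn_integral_sum, (intro borel_measurable_sum meas)[1])
      (intro sum.cong refl nn_integral_sum meas)
  also have "\<dots> \<le> (\<Sum>z\<in>int_grid n. \<Sum>z'\<in>int_grid n. ennreal ?B)"
    by (intro sum_mono one)
  also have "\<dots> = ennreal (card (int_grid n) * (card (int_grid n) * ?B))"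
    by (simp add: ennreal_mult ennreal_of_nat_eq_real_of_nat)
  also have "\<dots> \<le> ennreal (48 ^ n * (48 ^ n * ?B))"
  proof -
    have "real (card (int_grid n)) \<le> 48 ^ n" using card_int_grid[of n] by (metis of_nat_le_iff of_nat_numeral of_nat_power)
    then show ?thesis by (intro ennreal_leI mult_mono) auto
  qed
  also have "48 ^ n * (48 ^ n * ?B) = 48 ^ (2 * n) * ?B" by (simp add: mult_2 power_add)
  finally show ?thesis .
qed

section \<open>Traces of powers and closed walks\<close>

fun mpow :: "nat \<Rightarrow> (nat \<Rightarrow> nat \<Rightarrow> real) \<Rightarrow> nat \<Rightarrow> nat \<Rightarrow> nat \<Rightarrow> real" where
  "mpow n W 0 i j = (if i = j then 1 else 0)"
| "mpow n W (Suc k) i j = (\<Sum>l<n. W i l * mpow n W k l j)"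

lemma mpow_add:
  assumes "i < n"
  shows "mpow n W (a + b) i j = (\<Sum>l<n. mpow n W a i l * mpow n W b l j)"
  using assms
proof (induction a arbitrary: i)
  case 0
  have "(\<Sum>l<n. mpow n W 0 i l * mpow n W b l j) = (\<Sum>l<n. if l = i then mpow n W b i j else 0)"
    by (intro sum.cong) auto
  then show ?case using 0 by simp
next
  case (Suc a)
  have "mpow n W (Suc a + b) i j = (\<Sum>k<n. W i k * (\<Sum>l<n. mpow n W a k l * mpow n W b l j))"
    using Suc.IH by simp
  also have "\<dots> = (\<Sum>k<n. \<Sum>l<n. W i k * mpow n W a k l * mpow n W b l j)"
    by (simp add: sum_distrib_left mult_ac)
  also have "\<dots> = (\<Sum>l<n. \<Sum>k<n. W i k * mpow n W a k l * mpow n W b l j)"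
    by (rule sum.swap)
  also have "\<dots> = (\<Sum>l<n. mpow n W (Suc a) i l * mpow n W b l j)"
    by (simp add: sum_distrib_right)
  finally show ?case .
qed

lemma mpow_1:
  assumes "j < n"
  shows "mpow n W (Suc 0) i j = W i j"
proof -
  have "mpow n W (Suc 0) i j = (\<Sum>l<n. if l = j then W i j else 0)"
    unfolding mpow.simps by (intro sum.cong) auto
  then show ?thesis using assms by simp
qed

lemma mpow_sym:
  assumes "\<And>i j. i < n \<Longrightarrow> j < n \<Longrightarrow> W i j = W j i" "i < n" "j < n"
  shows "mpow n W k i j = mpow n W k j i"
  using assms(2,3)
proof (induction k arbitrary: i j)
  case (Suc k)
  have "mpow n W (Suc k) i j = (\<Sum>l<n. mpow n W k j l * mpow n W (Suc 0) l i)"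
    using Suc assms(1) by (simp del: mpow.simps(2) add: mpow.simps(2)[of n W k] mpow_1 mult.commute)
  also have "\<dots> = mpow n W (Suc k) j i"
    using mpow_add[of j n W k "Suc 0" i] Suc.prems by simp
  finally show ?case .
qed simp

lemma bform_mpow_double:
  assumes "\<And>i j. i < n \<Longrightarrow> j < n \<Longrightarrow> W i j = W j i"
  shows "bform n (mpow n W (k + k)) x x = (\<Sum>l<n. (\<Sum>i<n. x i * mpow n W k i l)\<^sup>2)"
proof -
  have "bform n (mpow n W (k + k)) x x =
      (\<Sum>i<n. \<Sum>j<n. \<Sum>l<n. x i * mpow n W k i l * (x j * mpow n W k j l))"
    unfolding bform_def
  proof (intro sum.cong refl)
    fix i j assume "i \<in> {..<n}" "j \<in> {..<n}"
    then have ij: "i < n" "j < n" by auto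
    have "x i * mpow n W (k + k) i j * x j = (\<Sum>l<n. x i * (mpow n W k i l * mpow n W k l j) * x j)"
      by (simp add: mpow_add[OF ij(1)] sum_distrib_left sum_distrib_right)
    also have "\<dots> = (\<Sum>l<n. x i * mpow n W k i l * (x j * mpow n W k j l))"
      using mpow_sym[OF assms _ ij(2)] by (intro sum.cong) auto
    finally show "x i * mpow n W (k + k) i j * x j = \<dots>" .
  qed
  also have "\<dots> = (\<Sum>i<n. \<Sum>l<n. \<Sum>j<n. x i * mpow n W k i l * (x j * mpow n W k j l))"
    by (intro sum.cong[OF refl] sum.swap)
  also have "\<dots> = (\<Sum>l<n. \<Sum>i<n. \<Sum>j<n. x i * mpow n W k i l * (x j * mpow n W k j l))"
    by (rule sum.swap)
  also have "\<dots> = (\<Sum>l<n. (\<Sum>i<n. x i * mpow n W k i l)\<^sup>2)"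
    by (simp add: power2_eq_square sum_product)
  finally show ?thesis .
qed

definition mtrace :: "nat \<Rightarrow> (nat \<Rightarrow> nat \<Rightarrow> real) \<Rightarrow> nat \<Rightarrow> real" where
  "mtrace n W k = (\<Sum>i<n. mpow n W k i i)"

lemma mtrace_double:
  assumes "\<And>i j. i < n \<Longrightarrow> j < n \<Longrightarrow> W i j = W j i"
  shows "mtrace n W (k + k) = (\<Sum>l<n. \<Sum>i<n. (mpow n W k i l)\<^sup>2)"
proof -
  have "mtrace n W (k + k) = (\<Sum>i<n. \<Sum>l<n. mpow n W k i l * mpow n W k l i)"
    by (simp add: mtrace_def mpow_add)
  also have "\<dots> = (\<Sum>i<n. \<Sum>l<n. (mpow n W k l i)\<^sup>2)"
    using mpow_sym[OF assms] by (intro sum.cong) (auto simp: power2_eq_square)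
  finally show ?thesis .
qed

text \<open>Repeated squaring stands in for the spectral theorem: for a unit vector, Cauchy-Schwarz
  bounds the squared form of W^k by the squared norm of W^k x, which is the form of W^(2 k). At the
  end the squared norm of W^(2^k) x is at most the squared Hilbert-Schmidt norm, a trace. Hence only
  powers of two occur as exponents.\<close>

lemma bform_power_le_mtrace:
  assumes sym: "\<And>i j. i < n \<Longrightarrow> j < n \<Longrightarrow> W i j = W j i"
    and x: "(\<Sum>i<n. (x i)\<^sup>2) = 1"
  shows "(bform n W x x) ^ (2 ^ Suc k) \<le> mtrace n W (2 ^ Suc k)"
proof -
  have cs: "(bform n (mpow n W k) x x)\<^sup>2 \<le> bform n (mpow n W (k + k)) x x" for k
  proof -
    have "bform n (mpow n W k) x x = (\<Sum>l<n. (\<Sum>i<n. x i * mpow n W k i l) * x l)"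
      unfolding bform_def sum_distrib_right by (rule sum.swap)
    then show ?thesis
      using Cauchy_Schwarz_ineq_sum[of "\<lambda>l. \<Sum>i<n. x i * mpow n W k i l" x "{..<n}"]
      by (simp add: x bform_mpow_double[of n W, OF sym])
  qed
  have step: "(bform n W x x) ^ (2 ^ Suc k) \<le> bform n (mpow n W (2 ^ Suc k)) x x" for k
  proof (induction k)
    case 0
    have "bform n (mpow n W (Suc 0)) x x = bform n W x x"
      unfolding bform_def by (intro sum.cong) (auto simp del: mpow.simps simp: mpow_1)
    then show ?case using cs[of "Suc 0"] by (simp add: numeral_2_eq_2 del: mpow.simps)
  next
    case (Suc k)
    have "(bform n W x x) ^ (2 ^ Suc (Suc k)) = ((bform n W x x) ^ (2 ^ Suc k))\<^sup>2"
      by (simp flip: power_mult add: mult.commute)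
    also have "\<dots> \<le> (bform n (mpow n W (2 ^ Suc k)) x x)\<^sup>2"
      by (intro power_mono Suc.IH) simp
    also have "\<dots> \<le> bform n (mpow n W (2 ^ Suc (Suc k))) x x"
      using cs[of "2 ^ Suc k"] by (simp add: mult_2)
    finally show ?case .
  qed
  have "bform n (mpow n W (2 ^ Suc k)) x x = (\<Sum>l<n. (\<Sum>i<n. x i * mpow n W (2 ^ k) i l)\<^sup>2)"
    using bform_mpow_double[of n W "2 ^ k" x, OF sym] by (simp add: mult_2)
  also have "\<dots> \<le> (\<Sum>l<n. \<Sum>i<n. (mpow n W (2 ^ k) i l)\<^sup>2)"
  proof (intro sum_mono)
    fix l
    show "(\<Sum>i<n. x i * mpow n W (2 ^ k) i l)\<^sup>2 \<le> (\<Sum>i<n. (mpow n W (2 ^ k) i l)\<^sup>2)"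
      using Cauchy_Schwarz_ineq_sum[of x "\<lambda>i. mpow n W (2 ^ k) i l" "{..<n}"] by (simp add: x)
  qed
  also have "\<dots> = mtrace n W (2 ^ Suc k)"
    using mtrace_double[of n W "2 ^ k", OF sym] by (simp add: mult_2)
  finally show ?thesis using step[of k] by simp
qed

lemma bform_le_of_mtrace:
  assumes sym: "\<And>i j. i < n \<Longrightarrow> j < n \<Longrightarrow> W i j = W j i"
    and T: "0 \<le> T" "mtrace n W (2 ^ Suc k) \<le> T ^ (2 ^ Suc k)"
  shows "bform n W x x \<le> T * (\<Sum>i<n. (x i)\<^sup>2)"
proof (rule bform_le_scale)
  fix x :: "nat \<Rightarrow> real" assume "(\<Sum>i<n. (x i)\<^sup>2) = 1"
  from bform_power_le_mtrace[OF sym this] T(2)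
  have "(bform n W x x) ^ (2 ^ Suc k) \<le> T ^ (2 ^ Suc k)" by (rule order.trans)
  then show "bform n W x x \<le> T"
    using power_strict_mono[of T "bform n W x x" "2 ^ Suc k"] T(1) by fastforce
qed

text \<open>Testing the form against u = W z gives |W z| <= L |z|, so every column of W^k has
  squared norm at most L^(2 k), and the trace of the even power is the sum over the n
  columns.\<close>

lemma mtrace_le_of_bform:
  assumes sym: "\<And>i j. i < n \<Longrightarrow> j < n \<Longrightarrow> W i j = W j i"
    and L: "0 \<le> L" "\<And>x y. (\<Sum>i<n. (x i)\<^sup>2) \<le> 1 \<Longrightarrow> (\<Sum>i<n. (y i)\<^sup>2) \<le> 1 \<Longrightarrow> bform n W x y \<le> L"
  shows "mtrace n W (k + k) \<le> n * L ^ (k + k)"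
proof -
  have Wz: "(\<Sum>i<n. (\<Sum>j<n. W i j * z j)\<^sup>2) \<le> L\<^sup>2 * (\<Sum>j<n. (z j)\<^sup>2)" for z
  proof -
    define b where "b = (\<Sum>j<n. (z j)\<^sup>2)"
    define u where "u i = (\<Sum>j<n. W i j * z j)" for i
    define a where "a = (\<Sum>i<n. (u i)\<^sup>2)"
    have ab: "a \<ge> 0" "b \<ge> 0" by (auto simp: a_def b_def sum_nonneg)
    have ua: "bform n W u z = a"
      by (simp add: a_def u_def bform_def sum_distrib_left power2_eq_square mult_ac)
    have "a \<le> L\<^sup>2 * b"
    proof (cases "a = 0 \<or> b = 0")
      case True
      have "a = 0" if "b = 0"
      proof -
        have "z i = 0" if "i < n" for i
          using that \<open>b = 0\<close> unfolding b_def by (subst (asm) sum_nonneg_eq_0_iff) auto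
        then show ?thesis by (simp add: a_def u_def)
      qed
      then show ?thesis using True ab by auto
    next
      case False
      then have pos: "a > 0" "b > 0" using ab by auto
      have "bform n W (\<lambda>i. 1 / sqrt a * u i) (\<lambda>i. 1 / sqrt b * z i) \<le> L"
        using pos by (intro L(2))
          (simp_all add: power_mult_distrib power_divide flip: sum_divide_distrib a_def b_def)
      then have "a / (sqrt a * sqrt b) \<le> L"
        unfolding bform_scale_left bform_scale_right ua by (simp add: mult_ac)
      then have "(a / (sqrt a * sqrt b))\<^sup>2 \<le> L\<^sup>2"
        using pos by (intro power_mono) auto
      moreover have "(a / (sqrt a * sqrt b))\<^sup>2 = a / b"
        using pos by (simp add: power_divide power_mult_distrib) (simp add: power2_eq_square)
      ultimately show ?thesis using pos by (simp add: field_simps)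
    qed
    then show ?thesis by (simp add: a_def b_def u_def)
  qed
  have col: "(\<Sum>i<n. (mpow n W k i l)\<^sup>2) \<le> L ^ (k + k)" if "l < n" for k l
  proof (induction k)
    case 0
    have "(\<Sum>i<n. (mpow n W 0 i l)\<^sup>2) = (\<Sum>i<n. if i = l then 1 else 0)"
      by (intro sum.cong) auto
    then show ?case using that by simp
  next
    case (Suc k)
    have "(\<Sum>i<n. (mpow n W (Suc k) i l)\<^sup>2) \<le> L\<^sup>2 * (\<Sum>i<n. (mpow n W k i l)\<^sup>2)"
      unfolding mpow.simps by (rule Wz)
    also have "\<dots> \<le> L\<^sup>2 * L ^ (k + k)" by (intro mult_left_mono Suc.IH) simp
    finally show ?case by (simp add: power2_eq_square mult_ac)
  qed
  have "(\<Sum>l<n. \<Sum>i<n. (mpow n W k i l)\<^sup>2) \<le> (\<Sum>l<n. L ^ (k + k))"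
    by (intro sum_mono col) simp
  then show ?thesis using mtrace_double[of n W k, OF sym] by simp
qed

section \<open>Closed walks as vertex lists\<close>

definition walks :: "nat \<Rightarrow> nat \<Rightarrow> nat list set" where
  "walks n k = {xs. set xs \<subseteq> {..<n} \<and> length xs = k}"

lemma finite_walks [simp, intro]: "finite (walks n k)"
  unfolding walks_def by (rule finite_lists_length_eq) simp

lemma sum_walks_0: "(\<Sum>xs\<in>walks n 0. f xs) = f []"
proof -
  have "walks n 0 = {[]}" by (auto simp: walks_def)
  then show ?thesis by simp
qed

lemma sum_walks_Suc:
  "(\<Sum>xs\<in>walks n (Suc k). f xs) = (\<Sum>i<n. \<Sum>xs\<in>walks n k. f (i # xs))"
proof -
  have "(\<Sum>i<n. \<Sum>xs\<in>walks n k. f (i # xs)) = (\<Sum>(i, xs)\<in>{..<n} \<times> walks n k. f (i # xs))"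
    by (simp add: sum.cartesian_product)
  also have "\<dots> = (\<Sum>xs\<in>walks n (Suc k). f xs)"
    by (rule sum.reindex_bij_witness[of _ "\<lambda>xs. (hd xs, tl xs)" "\<lambda>(i, xs). i # xs"])
      (auto simp: walks_def length_Suc_conv)
  finally show ?thesis by simp
qed

text \<open>Edges are sets, so that both directions of traversal coincide, as for a symmetric
  matrix; a loop is a singleton.\<close>

fun edges :: "'a list \<Rightarrow> 'a set list" where
  "edges (x # y # xs) = {x, y} # edges (y # xs)"
| "edges _ = []"

abbreviation cedges :: "'a list \<Rightarrow> 'a set list" where
  "cedges xs \<equiv> edges (xs @ [hd xs])"

lemma length_edges: "length (edges xs) = length xs - 1"
  by (induction xs rule: edges.induct) auto

lemma edges_map: "edges (map f xs) = map (image f) (edges xs)"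
  by (induction xs rule: edges.induct) auto

lemma cedges_map: "xs \<noteq> [] \<Longrightarrow> cedges (map f xs) = map (image f) (cedges xs)"
  using edges_map[of f "xs @ [hd xs]"] by (simp add: hd_map)

lemma edges_subset: "e \<in> set (edges xs) \<Longrightarrow> \<exists>x y. e = {x, y} \<and> x \<in> set xs \<and> y \<in> set xs"
  by (induction xs rule: edges.induct) (auto 4 4)

text \<open>A walk is connected: prepending a new vertex prepends an edge that has not occurred
  before.\<close>

lemma card_set_le_edges: "card (set xs) \<le> card (set (edges xs)) + 1"
proof (induction xs rule: edges.induct)
  case (1 x y xs)
  show ?case
  proof (cases "x \<in> set (y # xs)")
    case True
    have "card (set (edges (y # xs))) \<le> card (set (edges (x # y # xs)))"
      by (intro card_mono) auto
    then show ?thesis using 1 True by (simp add: insert_absorb)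
  next
    case False
    then have "{x, y} \<notin> set (edges (y # xs))"
      using edges_subset[of "{x, y}" "y # xs"] by (auto simp: doubleton_eq_iff)
    then show ?thesis using 1 False by simp
  qed
qed auto

text \<open>The lists hold only the k interior vertices of a walk with k + 1 steps from i to
  j.\<close>

lemma mpow_eq_sum_walks:
  assumes "j < n"
  shows "mpow n (\<lambda>i j. V {i, j}) (Suc k) i j = (\<Sum>xs\<in>walks n k. prod_list (map V (edges (i # xs @ [j]))))"
proof (induction k arbitrary: i)
  case 0
  show ?case using assms by (simp add: mpow_1 sum_walks_0 del: mpow.simps)
next
  case (Suc k)
  show ?case
    unfolding mpow.simps(2)[of n _ "Suc k"] Suc.IH sum_walks_Suc
    by (simp add: sum_distrib_left)
qed

lemma prod_list_count:
  "prod_list (map f xs) = (\<Prod>x\<in>set xs. (f x :: 'b :: comm_monoid_mult) ^ count_list xs x)"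
proof (induction xs)
  case (Cons a xs)
  show ?case
  proof (cases "a \<in> set xs")
    case True
    have "(\<Prod>x\<in>set xs. f x ^ count_list (a # xs) x) = (\<Prod>x\<in>set xs. (if x = a then f x else 1) * f x ^ count_list xs x)"
      by (intro prod.cong) auto
    also have "\<dots> = f a * (\<Prod>x\<in>set xs. f x ^ count_list xs x)"
      using True by (simp add: prod.distrib)
    finally show ?thesis using True Cons by (simp add: insert_absorb)
  next
    case False
    have "(\<Prod>x\<in>set xs. f x ^ count_list (a # xs) x) = (\<Prod>x\<in>set xs. f x ^ count_list xs x)"
      using False by (intro prod.cong) auto
    then show ?thesis using False Cons by simp
  qed
qed simp

text \<open>Grouping the factors by distinct edges prepares for independence, which turns each edge
  into a single moment.\<close>

lemma mtrace_eq_sum_walks: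
  "mtrace n (\<lambda>i j. V {i, j}) (Suc k) =
     (\<Sum>xs\<in>walks n (Suc k). \<Prod>e\<in>set (cedges xs). V e ^ count_list (cedges xs) e)"
proof -
  have "mtrace n (\<lambda>i j. V {i, j}) (Suc k) =
      (\<Sum>i<n. \<Sum>xs\<in>walks n k. prod_list (map V (edges (i # xs @ [i]))))"
    unfolding mtrace_def by (intro sum.cong refl mpow_eq_sum_walks) auto
  also have "\<dots> = (\<Sum>xs\<in>walks n (Suc k). prod_list (map V (cedges xs)))"
    unfolding sum_walks_Suc by simp
  finally show ?thesis unfolding prod_list_count .
qed

section \<open>Comparing closed walks in different dimensions\<close>

definition first_index :: "'a list \<Rightarrow> 'a \<Rightarrow> nat" where
  "first_index xs x = (LEAST t. t < length xs \<and> xs ! t = x)"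

text \<open>The shape of a walk: naming vertices by the position of their first occurrence is a
  normal form under injective relabelling.\<close>

definition canon :: "'a list \<Rightarrow> nat list" where
  "canon xs = map (first_index xs) xs"

definition doubled :: "'a list \<Rightarrow> bool" where
  "doubled xs \<longleftrightarrow> (\<forall>e\<in>set (cedges xs). 2 \<le> count_list (cedges xs) e)"

lemma first_index:
  assumes "x \<in> set xs"
  shows "first_index xs x < length xs" "xs ! first_index xs x = x"
proof -
  have "\<exists>t. t < length xs \<and> xs ! t = x" using assms by (auto simp: in_set_conv_nth)
  from LeastI_ex[OF this] show "first_index xs x < length xs" "xs ! first_index xs x = x"
    by (auto simp: first_index_def)
qed

lemma map_nth_canon: "map ((!) xs) (canon xs) = xs"
  by (simp add: canon_def map_idI first_index)

lemma inj_on_nth_canon: "inj_on ((!) xs) (set (canon xs))"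
  by (auto simp: canon_def inj_on_def first_index)

lemma length_canon [simp]: "length (canon xs) = length xs"
  by (simp add: canon_def)

text \<open>First positions depend only on which list entries are equal, and an injection preserves
  that.\<close>

lemma canon_map:
  assumes "inj_on h (set xs)"
  shows "canon (map h xs) = canon xs"
proof -
  have "first_index (map h xs) (h x) = first_index xs x" if "x \<in> set xs" for x
  proof -
    have "t < length (map h xs) \<and> map h xs ! t = h x \<longleftrightarrow> t < length xs \<and> xs ! t = x" for t
      using that inj_on_eq_iff[OF assms, of "xs ! t" x] by auto
    then show ?thesis by (simp add: first_index_def)
  qed
  then show ?thesis by (simp add: canon_def)
qed

lemma canon_canon [simp]: "canon (canon xs) = canon xs"
  using canon_map[OF inj_on_nth_canon, of xs] by (simp add: map_nth_canon)

lemma cedges_subset_Pow: "xs \<noteq> [] \<Longrightarrow> set (cedges xs) \<subseteq> Pow (set xs)"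
  using edges_subset[of _ "xs @ [hd xs]"] by (fastforce simp: hd_in_set)

text \<open>An injection on vertices induces one on edge sets, so edge multiplicities depend on the
  shape alone.\<close>

lemma
  assumes "inj_on h (set xs)" "xs \<noteq> []"
  shows doubled_map: "doubled (map h xs) \<longleftrightarrow> doubled xs"
    and card_cedges_map: "card (set (cedges (map h xs))) = card (set (cedges xs))"
proof -
  have "inj_on (image h) (Pow (set xs))" using assms(1) by (rule inj_on_image_Pow)
  then have inj: "inj_on (image h) (set (cedges xs))"
    using cedges_subset_Pow[OF assms(2)] by (rule inj_on_subset)
  show "doubled (map h xs) \<longleftrightarrow> doubled xs"
    unfolding doubled_def cedges_map[OF assms(2)] by (simp add: count_list_inj_map[OF inj])
  show "card (set (cedges (map h xs))) = card (set (cedges xs))"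
    unfolding cedges_map[OF assms(2)] by (simp add: card_image[OF inj])
qed

lemma card_cedges_ge: "xs \<noteq> [] \<Longrightarrow> card (set xs) \<le> card (set (cedges xs)) + 1"
  using card_set_le_edges[of "xs @ [hd xs]"] by (simp add: insert_absorb)

text \<open>Double counting of the steps: a closed walk has as many steps as its list has
  entries.\<close>

lemma card_cedges_le:
  assumes "doubled xs"
  shows "2 * card (set (cedges xs)) \<le> length xs"
proof -
  have "2 * card (set (cedges xs)) = (\<Sum>e\<in>set (cedges xs). 2)" by simp
  also have "\<dots> \<le> (\<Sum>e\<in>set (cedges xs). count_list (cedges xs) e)"
    using assms by (intro sum_mono) (auto simp: doubled_def)
  also have "\<dots> = length xs" by (simp add: sum_count_set length_edges)
  finally show ?thesis .
qed

text \<open>Such a walk is recovered from its values at the first-occurrence positions, which are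
  the members of \<open>set c\<close>.\<close>

lemma card_canon_fiber_le:
  assumes "c \<noteq> []"
  shows "card {xs \<in> walks n (length c). canon xs = c} \<le> n ^ card (set c)"
proof -
  have "card {xs \<in> walks n (length c). canon xs = c} \<le> card (set c \<rightarrow>\<^sub>E {..<n})"
  proof (rule card_inj_on_le)
    let ?g = "\<lambda>xs. restrict ((!) xs) (set c)"
    show "inj_on ?g {xs \<in> walks n (length c). canon xs = c}"
    proof (rule inj_onI, clarify)
      fix xs ys :: "nat list"
      assume eq: "restrict ((!) xs) (set (canon xs)) = restrict ((!) ys) (set (canon xs))" and c: "canon ys = canon xs"
      have "map ((!) xs) (canon xs) = map ((!) ys) (canon xs)"
        using eq by (intro map_cong refl) (metis restrict_apply')
      then show "xs = ys" using map_nth_canon[of xs] map_nth_canon[of ys] c by simp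
    qed
    show "?g ` {xs \<in> walks n (length c). canon xs = c} \<subseteq> set c \<rightarrow>\<^sub>E {..<n}"
    proof (clarsimp)
      fix xs i assume xs: "xs \<in> walks n (length xs)" and i: "i \<in> set (canon xs)"
      then have "i < length xs" by (auto simp: canon_def first_index)
      then show "xs ! i < n" using xs by (auto simp: walks_def dest: nth_mem)
    qed
  qed (simp add: finite_PiE)
  then show ?thesis by (simp add: card_funcsetE)
qed

text \<open>Every injective relabelling of c is a walk of the same shape, and the falling factorial
  counts these; truncated subtraction makes it 0 when r is too small.\<close>

lemma card_canon_fiber_ge:
  assumes "canon c = c"
  shows "(\<Prod>i<card (set c). r - i) \<le> card {xs \<in> walks r (length c). canon xs = c}"
proof -
  have "(\<Prod>i<card (set c). r - i) = card {h \<in> set c \<rightarrow>\<^sub>E {..<r}. inj_on h (set c)}"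
    by (subst card_inj_on_subset_funcset) (auto simp: atLeast0LessThan)
  also have "\<dots> \<le> card {xs \<in> walks r (length c). canon xs = c}"
  proof (rule card_inj_on_le)
    show "inj_on (\<lambda>h. map h c) {h \<in> set c \<rightarrow>\<^sub>E {..<r}. inj_on h (set c)}"
      by (rule inj_onI, rule PiE_ext[of _ "set c" "\<lambda>_. {..<r}"]) auto
    show "(\<lambda>h. map h c) ` {h \<in> set c \<rightarrow>\<^sub>E {..<r}. inj_on h (set c)}
        \<subseteq> {xs \<in> walks r (length c). canon xs = c}"
      using assms by (auto simp: walks_def canon_map)
  qed (rule finite_subset[OF _ finite_walks[of r "length c"]], auto)
  finally show ?thesis .
qed

text \<open>Summation shape by shape. The dimension p + p leaves room for the falling factorial even
  when a shape has the largest possible number p + 1 of vertices.\<close>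

lemma doubled_walks_comparison:
  fixes \<alpha> :: real
  assumes p: "1 \<le> p" and \<alpha>: "0 \<le> \<alpha>" "\<alpha> \<le> 1" and d: "n * \<alpha> \<le> p"
  shows "(\<Sum>xs\<in>{xs\<in>walks n (p + p). doubled xs}. \<alpha> ^ card (set (cedges xs)))
     \<le> n * card {ys\<in>walks (p + p) (p + p). doubled ys}"
proof -
  define S where "S = {xs\<in>walks n (p + p). doubled xs}"
  define R where "R = {ys\<in>walks (p + p) (p + p). doubled ys}"
  define F where "F c = {ys\<in>R. canon ys = c}" for c
  have fin: "finite S" "finite R" by (auto simp: S_def R_def)
  have fiber: "(\<Sum>xs\<in>{xs\<in>S. canon xs = c}. \<alpha> ^ card (set (cedges xs))) \<le> n * card (F c)"
    if cS: "c \<in> canon ` S" for c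
  proof -
    obtain xs0 where xs0: "xs0 \<in> S" "c = canon xs0" using cS by auto
    have len: "length c = p + p" using xs0 by (simp add: S_def walks_def)
    have cne: "c \<noteq> []" using len p by auto
    have cc: "canon c = c" using xs0 by simp
    have c: "doubled xs \<longleftrightarrow> doubled c" "card (set (cedges xs)) = card (set (cedges c))"
      if "canon xs = c" for xs :: "nat list"
      using doubled_map[OF inj_on_nth_canon[of xs]] card_cedges_map[OF inj_on_nth_canon[of xs]]
        that cne map_nth_canon[of xs] by simp_all
    have dc: "doubled c" using c(1)[of xs0] xs0 by (simp add: S_def)
    define m where "m = card (set c) - 1"
    have m1: "card (set c) = Suc m" using cne by (simp add: m_def card_gt_0_iff)
    have mp: "m \<le> p" "m \<le> card (set (cedges c))"
      using card_cedges_le[OF dc] card_cedges_ge[OF cne] m1 len by auto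
    have "(\<Sum>xs\<in>{xs\<in>S. canon xs = c}. \<alpha> ^ card (set (cedges xs)))
        = card {xs\<in>S. canon xs = c} * \<alpha> ^ card (set (cedges c))"
      using c(2) by simp
    also have "\<dots> \<le> (n * real n ^ m) * \<alpha> ^ m"
    proof (intro mult_mono)
      have "card {xs\<in>S. canon xs = c} \<le> card {xs \<in> walks n (length c). canon xs = c}"
        using len by (intro card_mono finite_subset[OF _ finite_walks]) (auto simp: S_def)
      also have "\<dots> \<le> n ^ Suc m" using card_canon_fiber_le[OF cne] m1 by simp
      finally have "real (card {xs\<in>S. canon xs = c}) \<le> real (n ^ Suc m)" by (simp only: of_nat_le_iff)
      then show "real (card {xs\<in>S. canon xs = c}) \<le> n * real n ^ m" by simp
      show "\<alpha> ^ card (set (cedges c)) \<le> \<alpha> ^ m" using mp \<alpha> by (intro power_decreasing) auto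
    qed (use \<alpha> in auto)
    also have "\<dots> = n * (n * \<alpha>) ^ m" by (simp add: power_mult_distrib)
    also have "\<dots> \<le> n * real p ^ m" using d \<alpha> by (intro mult_left_mono power_mono) auto
    also have "\<dots> = n * real (p ^ m)" by simp
    \<comment> \<open>Since i < m <= p, the first m factors are at least p; the last one,
      \<open>p + p - m\<close>, is at least 1.\<close>
    also have "p ^ m \<le> (\<Prod>i<card (set c). p + p - i)"
    proof -
      have "p ^ m = (\<Prod>i<m. p)" by simp
      also have "\<dots> \<le> (\<Prod>i<m. p + p - i)" using mp by (intro prod_mono) auto
      also have "\<dots> \<le> (\<Prod>i<m. p + p - i) * (p + p - m)" using mp p by simp
      finally show ?thesis by (simp add: m1)
    qed
    also have "\<dots> \<le> card {xs \<in> walks (p + p) (length c). canon xs = c}"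
      by (rule card_canon_fiber_ge[OF cc])
    also have "{xs \<in> walks (p + p) (length c). canon xs = c} = F c"
      using len c(1) dc by (auto simp: F_def R_def)
    finally show ?thesis by (simp add: mult_left_mono)
  qed
  have "(\<Sum>xs\<in>S. \<alpha> ^ card (set (cedges xs)))
      = (\<Sum>c\<in>canon ` S. \<Sum>xs\<in>{xs\<in>S. canon xs = c}. \<alpha> ^ card (set (cedges xs)))"
    by (rule sum.image_gen[OF fin(1)])
  also have "\<dots> \<le> (\<Sum>c\<in>canon ` S. n * real (card (F c)))"
    by (intro sum_mono) (use fiber in auto)
  also have "\<dots> = n * (\<Sum>c\<in>canon ` S. card (F c))" by (simp add: sum_distrib_left)
  also have "(\<Sum>c\<in>canon ` S. card (F c)) = card (\<Union>c\<in>canon ` S. F c)"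
    using fin by (subst card_UN_disjoint) (auto simp: F_def)
  also have "\<dots> \<le> card R" using fin(2) by (intro card_mono) (auto simp: F_def)
  finally show ?thesis by (simp add: S_def R_def mult_left_mono)
qed

section \<open>Expected trace moments\<close>

text \<open>Translates a set-valued edge into the index of the independent entry that it
  uses.\<close>

definition edge_pair :: "nat set \<Rightarrow> nat \<times> nat" where
  "edge_pair e = (Min e, Max e)"

lemma edge_pair_doubleton [simp]: "edge_pair {i, j} = (min i j, max i j)"
  by (simp add: edge_pair_def)

lemma inj_on_edge_pair: "inj_on edge_pair {{i, j} |i j. True}"
  by (auto simp: inj_on_def min_def max_def split: if_splits)

lemma cedges_walk:
  assumes "xs \<in> walks n (Suc k)"
  shows "set (cedges xs) \<subseteq> {{i, j} |i j. i < n \<and> j < n}"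
proof
  fix e assume "e \<in> set (cedges xs)"
  then obtain x y where "e = {x, y}" "x \<in> set (xs @ [hd xs])" "y \<in> set (xs @ [hd xs])"
    using edges_subset[of e "xs @ [hd xs]"] by blast
  moreover have "set (xs @ [hd xs]) \<subseteq> {..<n}"
    using assms hd_in_set[of xs] by (cases xs) (auto simp: walks_def)
  ultimately show "e \<in> {{i, j} |i j. i < n \<and> j < n}" by blast
qed

lemma edge_pair_cedges:
  assumes "xs \<in> walks n (Suc k)" "e \<in> set (cedges xs)"
  shows "edge_pair e \<in> upper n"
  using cedges_walk[OF assms(1)] assms(2) by (auto simp: upper_def)

context prob_space
begin

text \<open>Distinct edges of a walk index distinct independent entries, so the expectation of each
  walk factors into moments; boundedness makes all moments integrable.\<close>

lemma
  fixes X :: "nat \<times> nat \<Rightarrow> 'a \<Rightarrow> real"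
  assumes indep: "indep_vars (\<lambda>_. borel) X (upper n)"
    and bnd: "\<And>i. i \<in> upper n \<Longrightarrow> AE \<omega> in M. \<bar>X i \<omega>\<bar> \<le> B"
  shows expectation_mtrace: "expectation (\<lambda>\<omega>. mtrace n (symm X \<omega>) (Suc k)) =
      (\<Sum>xs\<in>walks n (Suc k). \<Prod>e\<in>set (cedges xs).
         expectation (\<lambda>\<omega>. X (edge_pair e) \<omega> ^ count_list (cedges xs) e))"
    and integrable_mtrace: "integrable M (\<lambda>\<omega>. mtrace n (symm X \<omega>) (Suc k))"
proof -
  have rv: "random_variable borel (X i)" if "i \<in> upper n" for i
    using indep that by (auto simp: indep_vars_def)
  have pow: "integrable M (\<lambda>\<omega>. X i \<omega> ^ m)" if "i \<in> upper n" for i m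
  proof (rule integrable_const_bound[of _ "B ^ m"])
    show "AE \<omega> in M. norm (X i \<omega> ^ m) \<le> B ^ m"
      using bnd[OF that] by eventually_elim (simp add: power_abs power_mono)
  qed (use rv[OF that] in measurable)
  have V: "symm X \<omega> = (\<lambda>i j. X (edge_pair {i, j}) \<omega>)" for \<omega>
    by (intro ext) (simp add: symm_def)
  have mt: "mtrace n (symm X \<omega>) (Suc k) = (\<Sum>xs\<in>walks n (Suc k). \<Prod>e\<in>set (cedges xs).
      X (edge_pair e) \<omega> ^ count_list (cedges xs) e)" for \<omega>
    unfolding V by (rule mtrace_eq_sum_walks)
  have walk: "expectation (\<lambda>\<omega>. \<Prod>e\<in>set (cedges xs). X (edge_pair e) \<omega> ^ count_list (cedges xs) e)
      = (\<Prod>e\<in>set (cedges xs). expectation (\<lambda>\<omega>. X (edge_pair e) \<omega> ^ count_list (cedges xs) e)) \<and>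
      integrable M (\<lambda>\<omega>. \<Prod>e\<in>set (cedges xs). X (edge_pair e) \<omega> ^ count_list (cedges xs) e)"
    if xs: "xs \<in> walks n (Suc k)" for xs
  proof -
    let ?F = "set (cedges xs)"
    define h where "h = (\<lambda>(i, j). {i, j :: nat})"
    define Y where "Y i \<omega> = X i \<omega> ^ count_list (cedges xs) (h i)" for i \<omega>
    have F: "?F \<subseteq> {{i, j} |i j. True}" using cedges_walk[OF xs] by blast
    have inj: "inj_on edge_pair ?F" by (rule inj_on_subset[OF inj_on_edge_pair F])
    have h: "h (edge_pair e) = e" if "e \<in> ?F" for e
    proof -
      from that F obtain i j where "e = {i, j}" by blast
      then show ?thesis by (auto simp: h_def min_def max_def)
    qed
    have re: "(\<Prod>e\<in>?F. X (edge_pair e) \<omega> ^ count_list (cedges xs) e) = (\<Prod>i\<in>edge_pair ` ?F. Y i \<omega>)" for \<omega>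
      by (simp add: prod.reindex[OF inj] Y_def h)
    have re': "(\<Prod>e\<in>?F. expectation (\<lambda>\<omega>. X (edge_pair e) \<omega> ^ count_list (cedges xs) e))
        = (\<Prod>i\<in>edge_pair ` ?F. expectation (Y i))"
      by (simp add: prod.reindex[OF inj] Y_def[abs_def] h)
    have sub: "edge_pair ` ?F \<subseteq> upper n" using edge_pair_cedges[OF xs] by blast
    have ind: "indep_vars (\<lambda>_. borel) Y (edge_pair ` ?F)"
      unfolding Y_def[abs_def]
      by (rule indep_vars_compose2[OF indep_vars_subset[OF indep sub],
            where Y = "\<lambda>i x. x ^ count_list (cedges xs) (h i)"]) measurable
    have int: "integrable M (Y i)" if "i \<in> edge_pair ` ?F" for i
      unfolding Y_def[abs_def] using that sub by (intro pow) blast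
    show ?thesis unfolding re re'
      using indep_vars_lebesgue_integral[OF _ ind int] indep_vars_integrable[OF _ ind int] by simp
  qed
  show "expectation (\<lambda>\<omega>. mtrace n (symm X \<omega>) (Suc k)) =
      (\<Sum>xs\<in>walks n (Suc k). \<Prod>e\<in>set (cedges xs).
         expectation (\<lambda>\<omega>. X (edge_pair e) \<omega> ^ count_list (cedges xs) e))"
    unfolding mt by (subst Bochner_Integration.integral_sum) (simp_all add: walk)
  show "integrable M (\<lambda>\<omega>. mtrace n (symm X \<omega>) (Suc k))"
    unfolding mt by (intro Bochner_Integration.integrable_sum) (simp add: walk)
qed

lemma not_doubledE:
  assumes "\<not> doubled xs"
  obtains e where "e \<in> set (cedges xs)" "count_list (cedges xs) e = 1"
proof -
  obtain e where e: "e \<in> set (cedges xs)" "\<not> 2 \<le> count_list (cedges xs) e"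
    using assms by (auto simp: doubled_def)
  moreover have "count_list (cedges xs) e \<noteq> 0" using e by (simp add: count_list_0_iff)
  ultimately show ?thesis using that[of e] by simp
qed

text \<open>An edge traversed once contributes its mean, which is 0. Higher moments are at most the
  second one because the entries are bounded by 1.\<close>

lemma expectation_mtrace_le:
  fixes X :: "nat \<times> nat \<Rightarrow> 'a \<Rightarrow> real"
  assumes indep: "indep_vars (\<lambda>_. borel) X (upper n)"
    and bnd: "\<And>i. i \<in> upper n \<Longrightarrow> AE \<omega> in M. \<bar>X i \<omega>\<bar> \<le> 1"
    and mean: "\<And>i. i \<in> upper n \<Longrightarrow> expectation (X i) = 0"
    and var: "\<And>i. i \<in> upper n \<Longrightarrow> expectation (\<lambda>\<omega>. (X i \<omega>)\<^sup>2) \<le> \<alpha>"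
  shows "expectation (\<lambda>\<omega>. mtrace n (symm X \<omega>) (Suc k)) \<le>
      (\<Sum>xs\<in>{xs\<in>walks n (Suc k). doubled xs}. \<alpha> ^ card (set (cedges xs)))"
proof -
  let ?E = "\<lambda>xs. \<Prod>e\<in>set (cedges xs). expectation (\<lambda>\<omega>. X (edge_pair e) \<omega> ^ count_list (cedges xs) e)"
  have mom: "\<bar>expectation (\<lambda>\<omega>. X i \<omega> ^ m)\<bar> \<le> \<alpha>" if i: "i \<in> upper n" and m: "2 \<le> m" for i m
  proof -
    have rv: "random_variable borel (X i)" using indep i by (auto simp: indep_vars_def)
    have int: "integrable M (\<lambda>\<omega>. X i \<omega> ^ m)" for m
    proof (rule integrable_const_bound[of _ 1])
      show "AE \<omega> in M. norm (X i \<omega> ^ m) \<le> 1"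
        using bnd[OF i] by eventually_elim (simp add: power_abs power_le_one)
    qed (use rv in measurable)
    have "\<bar>expectation (\<lambda>\<omega>. X i \<omega> ^ m)\<bar> \<le> expectation (\<lambda>\<omega>. \<bar>X i \<omega> ^ m\<bar>)" by simp
    also have "\<dots> \<le> expectation (\<lambda>\<omega>. (X i \<omega>)\<^sup>2)"
    proof (rule integral_mono_AE)
      show "AE \<omega> in M. \<bar>X i \<omega> ^ m\<bar> \<le> (X i \<omega>)\<^sup>2"
        using bnd[OF i]
      proof eventually_elim
        case (elim \<omega>)
        then have "\<bar>X i \<omega>\<bar> ^ m \<le> \<bar>X i \<omega>\<bar>\<^sup>2" using m by (intro power_decreasing) auto
        then show ?case by (simp add: power_abs)
      qed
    qed (use int in auto)
    also have "\<dots> \<le> \<alpha>" by (rule var[OF i])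
    finally show ?thesis .
  qed
  have d: "?E xs \<le> \<alpha> ^ card (set (cedges xs))" if "xs \<in> walks n (Suc k)" "doubled xs" for xs
  proof -
    have "?E xs \<le> \<bar>?E xs\<bar>" by simp
    also have "\<dots> = (\<Prod>e\<in>set (cedges xs). \<bar>expectation (\<lambda>\<omega>. X (edge_pair e) \<omega> ^ count_list (cedges xs) e)\<bar>)"
      by (rule abs_prod)
    also have "\<dots> \<le> (\<Prod>e\<in>set (cedges xs). \<alpha>)"
      using that by (intro prod_mono conjI abs_ge_zero mom edge_pair_cedges[OF that(1)]) (auto simp: doubled_def)
    finally show ?thesis by simp
  qed
  have nd: "?E xs = 0" if xs: "xs \<in> walks n (Suc k)" and nd: "\<not> doubled xs" for xs
  proof -
    obtain e where e: "e \<in> set (cedges xs)" "count_list (cedges xs) e = 1"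
      using not_doubledE[OF nd] .
    have "expectation (\<lambda>\<omega>. X (edge_pair e) \<omega> ^ count_list (cedges xs) e) = 0"
      using e mean[OF edge_pair_cedges[OF xs e(1)]] by simp
    then show ?thesis using e(1) by (intro prod_zero) auto
  qed
  have "(\<Sum>xs\<in>walks n (Suc k). ?E xs) \<le>
      (\<Sum>xs\<in>walks n (Suc k). if doubled xs then \<alpha> ^ card (set (cedges xs)) else 0)"
  proof (intro sum_mono)
    fix xs assume "xs \<in> walks n (Suc k)"
    then show "?E xs \<le> (if doubled xs then \<alpha> ^ card (set (cedges xs)) else 0)"
      using d[of xs] nd[of xs] by (cases "doubled xs") (simp_all only: if_True if_False order_refl simp_thms)
  qed
  then show ?thesis
    using expectation_mtrace[OF indep bnd, of k] by (simp add: sum.inter_filter)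
qed

text \<open>Walks that are not doubled vanish exactly, and each doubled walk contributes at least 1,
  so the trace moment bounds their number.\<close>

lemma expectation_mtrace_ge:
  fixes X :: "nat \<times> nat \<Rightarrow> 'a \<Rightarrow> real"
  assumes indep: "indep_vars (\<lambda>_. borel) X (upper n)"
    and bnd: "\<And>i. i \<in> upper n \<Longrightarrow> AE \<omega> in M. \<bar>X i \<omega>\<bar> \<le> B"
    and mean: "\<And>i. i \<in> upper n \<Longrightarrow> expectation (X i) = 0"
    and mom: "\<And>i m. i \<in> upper n \<Longrightarrow> 2 \<le> m \<Longrightarrow> 1 \<le> expectation (\<lambda>\<omega>. X i \<omega> ^ m)"
  shows "card {xs\<in>walks n (Suc k). doubled xs} \<le> expectation (\<lambda>\<omega>. mtrace n (symm X \<omega>) (Suc k))"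
proof -
  let ?E = "\<lambda>xs. \<Prod>e\<in>set (cedges xs). expectation (\<lambda>\<omega>. X (edge_pair e) \<omega> ^ count_list (cedges xs) e)"
  have d: "1 \<le> ?E xs" if "xs \<in> walks n (Suc k)" "doubled xs" for xs
    using that by (intro prod_ge_1 mom edge_pair_cedges[OF that(1)]) (auto simp: doubled_def)
  have nd: "?E xs = 0" if xs: "xs \<in> walks n (Suc k)" and nd: "\<not> doubled xs" for xs
  proof -
    obtain e where e: "e \<in> set (cedges xs)" "count_list (cedges xs) e = 1"
      using not_doubledE[OF nd] .
    have "expectation (\<lambda>\<omega>. X (edge_pair e) \<omega> ^ count_list (cedges xs) e) = 0"
      using e mean[OF edge_pair_cedges[OF xs e(1)]] by simp
    then show ?thesis using e(1) by (intro prod_zero) auto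
  qed
  have "(\<Sum>xs\<in>walks n (Suc k). if doubled xs then 1 else 0) \<le> (\<Sum>xs\<in>walks n (Suc k). ?E xs)"
  proof (intro sum_mono)
    fix xs assume "xs \<in> walks n (Suc k)"
    then show "(if doubled xs then 1 else 0) \<le> ?E xs"
      using d[of xs] nd[of xs] by (cases "doubled xs") (simp_all only: if_True if_False order_refl simp_thms)
  qed
  then show ?thesis
    using expectation_mtrace[OF indep bnd, of k] by (simp add: sum.inter_filter[symmetric])
qed

text \<open>Hoeffding's lemma settles l > 0; negative l is the same statement for - f on the
  reflected interval.\<close>

lemma nn_integral_exp_interval_le:
  fixes f :: "'a \<Rightarrow> real"
  assumes rv: "random_variable borel f" and ab: "AE x in M. f x \<in> {a..b}" and mean: "expectation f = 0"
  shows "(\<integral>\<^sup>+x. ennreal (exp (l * f x)) \<partial>M) \<le> ennreal (exp (l\<^sup>2 * (b - a)\<^sup>2 / 8))"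
proof -
  consider "l > 0" | "l = 0" | "l < 0" by linarith
  then show ?thesis
  proof cases
    case 1
    interpret interval_bounded_random_variable M f a b
      by unfold_locales (use assms in auto)
    show ?thesis by (rule Hoeffdings_lemma_nn_integral_0[OF 1 mean])
  next
    case 2
    then show ?thesis by (simp add: emeasure_space_1)
  next
    case 3
    interpret interval_bounded_random_variable M "\<lambda>x. - f x" "- b" "- a"
      by unfold_locales (use assms in auto)
    show ?thesis
      using Hoeffdings_lemma_nn_integral_0[of "- l"] 3 mean by simp
  qed
qed

end

section \<open>The norm of a sparse random matrix\<close>

lemma power_le_exp:
  fixes x :: real
  assumes "0 \<le> x" "0 < k"
  shows "x ^ k \<le> real k ^ k * exp x"
proof -
  have "(x / k) ^ k \<le> (1 + x / k) ^ k" using assms by (intro power_mono) auto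
  also have "\<dots> \<le> exp x" using assms by (intro exp_ge_one_plus_x_over_n_power_n) auto
  finally show ?thesis using assms by (simp add: power_divide field_simps)
qed

text \<open>Collected per unit of p, with r = 2 p: 4 from r <= 4^p and 2 from r^p = 2^p p^p make the
  8; 48^4 comes from the 48^(2 r) pairs of grid points, and 72 p is 16 times 9/4 times r.\<close>

definition walk_const :: real where
  "walk_const = 8 * 48 ^ 4 * exp 72"

text \<open>A probabilistic count: the number is at most the expected trace moment of a random
  matrix whose relevant moments are at least one, and that trace is bounded through the
  norm.\<close>

lemma card_doubled_walks_le:
  assumes p: "1 \<le> p"
  shows "card {xs \<in> walks (p + p) (p + p). doubled xs} \<le> (walk_const * p) ^ p"
proof -
  define r where "r = p + p"
  define N where "N = measure_pmf (Pi_pmf (upper r) False (\<lambda>_. bernoulli_pmf (1 / 3)))"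
  (* a centred two-point variable all of whose moments of order at least two are at least one *)
  define Z :: "nat \<times> nat \<Rightarrow> (nat \<times> nat \<Rightarrow> bool) \<Rightarrow> real" where "Z i f = (if f i then 2 else - 1)" for i f
  interpret N: prob_space N unfolding N_def by (rule measure_pmf.prob_space_axioms)
  have r: "r > 0" using p by (simp add: r_def)
  have indep: "N.indep_vars (\<lambda>_. borel) Z (upper r)"
    unfolding Z_def[abs_def] N_def
    by (rule prob_space.indep_vars_compose2[OF measure_pmf.prob_space_axioms indep_vars_Pi_pmf[OF finite_upper],
        where Y = "\<lambda>_ x. if x then 2 else - 1"]) measurable
  have bnd: "AE f in N. \<bar>Z i f\<bar> \<le> 2" "AE f in N. Z i f \<in> {- 1..2}" for i
    by (auto simp: Z_def)
  have mom: "N.expectation (\<lambda>f. Z i f ^ m) = (2 ^ m + 2 * (- 1) ^ m) / 3" if "i \<in> upper r" for i m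
  proof -
    have "N.expectation (\<lambda>f. Z i f ^ m) =
        measure_pmf.expectation (map_pmf (\<lambda>f. f i) (Pi_pmf (upper r) False (\<lambda>_. bernoulli_pmf (1 / 3))))
          (\<lambda>b. (if b then 2 else - 1) ^ m)"
      unfolding N_def Z_def integral_map_pmf ..
    also have "\<dots> = measure_pmf.expectation (bernoulli_pmf (1 / 3)) (\<lambda>b. (if b then 2 else - 1) ^ m)"
      using that by (subst Pi_pmf_component) auto
    also have "\<dots> = (2 ^ m + 2 * (- 1) ^ m) / 3" by (simp add: field_simps)
    finally show ?thesis .
  qed
  have mean: "N.expectation (Z i) = 0" if "i \<in> upper r" for i
    using mom[OF that, of 1] by simp
  have mom1: "1 \<le> N.expectation (\<lambda>f. Z i f ^ m)" if "i \<in> upper r" "2 \<le> m" for i m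
  proof -
    have "(4::real) \<le> 2 ^ m" using power_increasing[OF that(2), of "2::real"] by simp
    \<comment> \<open>An odd exponent is at least 3 here, so that 2^m - 2 >= 3.\<close>
    moreover have "(- 1 :: real) ^ m \<ge> 1 \<or> (2::real) ^ m \<ge> 5"
    proof (cases "even m")
      case False
      then have "3 \<le> m" using that(2) by (cases "m = 2") auto
      then show ?thesis using power_increasing[of 3 m "2::real"] by simp
    qed simp
    moreover have "(- 1 :: real) ^ m \<ge> - 1" by (cases "even m") auto
    ultimately show ?thesis unfolding mom[OF that(1)] by auto
  qed
  have rv: "N.random_variable borel (Z i)" for i by (simp add: N_def)
  \<comment> \<open>Hoeffding on an interval of length 3 gives 9 l^2 / 8, that is, variance proxy
    9/4.\<close>
  have mgf: "(\<integral>\<^sup>+f. ennreal (exp (l * Z i f)) \<partial>N) \<le> ennreal (exp ((9 / 4) * l\<^sup>2 / 2))" if "i \<in> upper r" for i l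
    using N.nn_integral_exp_interval_le[OF rv bnd(2) mean[OF that], of l]
    by (simp add: power2_eq_square mult_ac)
  \<comment> \<open>This scale makes the exponent 36 \<theta>^2 r^2 of the grid moment linear in r,
    of the same order as the entropy ln 48^(2 r).\<close>
  define \<theta> where "\<theta> = 1 / sqrt r"
  have \<theta>: "\<theta> > 0" "\<theta> * r = sqrt r" "\<theta>\<^sup>2 * (real r)\<^sup>2 = r"
    using r by (simp_all add: \<theta>_def power_divide real_div_sqrt) (simp add: power2_eq_square)
  have pt: "mtrace r (symm Z f) (p + p) \<le> r * real r ^ p * grid_mgf r \<theta> (symm Z f)"
    and nn: "0 \<le> mtrace r (symm Z f) (p + p)" for f
  proof -
    let ?S = "grid_mgf r \<theta> (symm Z f)"
    have S: "1 \<le> ?S" by (rule grid_mgf_ge_1)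
    have "mtrace r (symm Z f) (p + p) \<le> r * (ln ?S / (\<theta> * r)) ^ (p + p)"
    proof (rule mtrace_le_of_bform)
      show "0 \<le> ln ?S / (\<theta> * r)" using S \<theta> r by simp
    qed (use bform_le_ln_grid_mgf[OF \<theta>(1) r] symm_sym in auto)
    also have "(ln ?S / (\<theta> * r)) ^ (p + p) = ln ?S ^ (p + p) / real r ^ p"
      unfolding \<theta>(2) power_divide by (simp add: power_add flip: power_mult_distrib)
    \<comment> \<open>The power of the logarithm is traded for a multiple of \<open>grid_mgf\<close>
      itself: an expectation is wanted, and the first moment of \<open>grid_mgf\<close> is what is
      under control.\<close>
    also have "\<dots> \<le> (real (p + p) ^ (p + p) * exp (ln ?S)) / real r ^ p"
      using S p by (intro divide_right_mono power_le_exp) auto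
    also have "\<dots> = real r ^ p * ?S"
      using S r unfolding r_def[symmetric] by (simp add: power_add r_def[symmetric]) (simp add: r_def power_add)
    finally show "mtrace r (symm Z f) (p + p) \<le> r * real r ^ p * ?S"
      by (simp add: mult_left_mono mult.assoc)
    have "mtrace r (symm Z f) (p + p) = (\<Sum>l<r. \<Sum>i<r. (mpow r (symm Z f) p i l)\<^sup>2)"
      by (intro mtrace_double symm_sym)
    then show "0 \<le> mtrace r (symm Z f) (p + p)" by (simp add: sum_nonneg)
  qed
  obtain k where k: "p + p = Suc k" using p by (cases "p + p") auto
  have int: "integrable N (\<lambda>f. mtrace r (symm Z f) (p + p))"
    unfolding k using N.integrable_mtrace[OF indep bnd(1)] .
  have "real (card {xs \<in> walks (p + p) (p + p). doubled xs}) \<le> N.expectation (\<lambda>f. mtrace r (symm Z f) (p + p))"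
    using N.expectation_mtrace_ge[OF indep bnd(1) mean mom1, of k] by (simp add: k r_def)
  then have "ennreal (card {xs \<in> walks (p + p) (p + p). doubled xs})
      \<le> (\<integral>\<^sup>+f. ennreal (mtrace r (symm Z f) (p + p)) \<partial>N)"
    using int nn by (subst nn_integral_eq_integral) (auto intro: ennreal_leI)
  also have "\<dots> \<le> (\<integral>\<^sup>+f. ennreal (r * real r ^ p) * ennreal (grid_mgf r \<theta> (symm Z f)) \<partial>N)"
    using pt by (intro nn_integral_mono) (auto simp: ennreal_mult'[symmetric] intro!: ennreal_leI)
  also have "\<dots> = ennreal (r * real r ^ p) * (\<integral>\<^sup>+f. ennreal (grid_mgf r \<theta> (symm Z f)) \<partial>N)"
    by (rule nn_integral_cmult) (simp add: N_def)
  also have "\<dots> \<le> ennreal (r * real r ^ p) * ennreal (48 ^ (2 * r) * exp (16 * (9 / 4) * \<theta>\<^sup>2 * (real r)\<^sup>2))"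
    by (intro mult_left_mono N.nn_integral_grid_mgf_le[OF indep mgf]) auto
  also have "\<dots> = ennreal (r * real r ^ p * (48 ^ (2 * r) * exp (16 * (9 / 4) * r)))"
    using \<theta>(3) by (simp add: mult.assoc flip: ennreal_mult')
  finally have "card {xs \<in> walks (p + p) (p + p). doubled xs} \<le> r * real r ^ p * (48 ^ (2 * r) * exp (16 * (9 / 4) * r))"
    by (simp add: ennreal_le_iff)
  also have "\<dots> \<le> 4 ^ p * real r ^ p * (48 ^ (2 * r) * exp (16 * (9 / 4) * r))"
  proof (intro mult_right_mono)
    have "p + p \<le> 4 ^ p"
    proof (induction p)
      case (Suc p)
      have "1 \<le> (4::nat) ^ p" by simp
      then show ?case using Suc unfolding power_Suc by linarith
    qed simp
    then show "real r \<le> 4 ^ p" unfolding r_def by (metis of_nat_le_iff of_nat_numeral of_nat_power)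
  qed auto
  also have "real r ^ p = 2 ^ p * real p ^ p"
  proof -
    have "real r = 2 * real p" by (simp add: r_def)
    then show ?thesis by (simp only: power_mult_distrib)
  qed
  also have "(48::real) ^ (2 * r) = (48 ^ 4) ^ p" by (simp only: power_mult[symmetric] r_def) simp
  also have "exp (16 * (9 / 4) * real r) = exp 72 ^ p" by (simp add: r_def flip: exp_of_nat_mult)
  also have "4 ^ p * (2 ^ p * real p ^ p) * ((48 ^ 4) ^ p * exp 72 ^ p) = (walk_const * real p) ^ p"
  proof -
    have "(8::real) ^ p = (4 * 2) ^ p" by simp
    also have "\<dots> = 4 ^ p * 2 ^ p" by (rule power_mult_distrib)
    finally have "(8::real) ^ p = 4 ^ p * 2 ^ p" .
    then show ?thesis unfolding walk_const_def power_mult_distrib by (simp only: mult_ac)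
  qed
  finally show ?thesis .
qed

lemma ex_power_of_two_between:
  fixes y :: real
  assumes "1 \<le> y"
  shows "\<exists>k. y \<le> 2 ^ k \<and> 2 ^ k \<le> 2 * y"
proof -
  define k where "k = (LEAST k. y \<le> 2 ^ k)"
  have ex: "\<exists>k. y \<le> 2 ^ k" using real_arch_pow[of 2 y] by (auto intro: less_imp_le)
  have k: "y \<le> 2 ^ k" unfolding k_def by (rule LeastI_ex[OF ex])
  moreover have "2 ^ k \<le> 2 * y"
  proof (cases k)
    case (Suc m)
    then have "\<not> y \<le> 2 ^ m" using not_less_Least[of m "\<lambda>k. y \<le> 2 ^ k"] by (simp add: k_def)
    then show ?thesis using Suc by simp
  qed (use assms in auto)
  ultimately show ?thesis by blast
qed

text \<open>The exponential pays for Markov's inequality, and the last factor 2 / c bounds the ratio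
  of p to n \<alpha>.\<close>

definition norm_const :: "real \<Rightarrow> real" where
  "norm_const c = sqrt (walk_const * exp (2 / c) * (2 / c))"

text \<open>Markov's inequality for the trace of order 2 p at level T^(2 p). The factor exp s under
  the root in T gains exp (s p), which is at least n^2 as p >= c ln n; one n pays for the factor in
  the walk comparison, the other leaves failure probability 1 / n.\<close>

lemma (in prob_space) sparse_norm_bound:
  fixes X :: "nat \<times> nat \<Rightarrow> 'a \<Rightarrow> real"
  assumes indep: "indep_vars (\<lambda>_. borel) X (upper n)"
    and bnd: "\<And>i. i \<in> upper n \<Longrightarrow> AE \<omega> in M. \<bar>X i \<omega>\<bar> \<le> 1"
    and mean: "\<And>i. i \<in> upper n \<Longrightarrow> expectation (X i) = 0"
    and var: "\<And>i. i \<in> upper n \<Longrightarrow> expectation (\<lambda>\<omega>. (X i \<omega>)\<^sup>2) \<le> \<alpha>"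
    and n: "1 \<le> n" and \<alpha>: "0 \<le> \<alpha>" "\<alpha> \<le> 1"
    and c: "0 < c" "c \<le> 1" "c * (1 + ln n) \<le> n * \<alpha>"
  obtains G where "G \<in> events" "prob G \<ge> 1 - 1 / n"
    "\<And>\<omega> x. \<omega> \<in> G \<Longrightarrow> bform n (symm X \<omega>) x x \<le> norm_const c * sqrt (n * \<alpha>) * (\<Sum>i<n. (x i)\<^sup>2)"
proof -
  \<comment> \<open>The order is a power of two, as the trace bound demands; the maximum with 1
    covers n \<alpha> < 1.\<close>
  obtain k where k: "max (n * \<alpha>) 1 \<le> 2 ^ k" "2 ^ k \<le> 2 * max (n * \<alpha>) 1"
    using ex_power_of_two_between[of "max (n * \<alpha>) 1"] by auto
  define p :: nat where "p = 2 ^ k"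
  have p: "n * \<alpha> \<le> p" "1 \<le> p" "p \<le> 2 * max (n * \<alpha>) 1" using k by (auto simp: p_def)
  have ln_n: "0 \<le> ln (real n)" using n by simp
  \<comment> \<open>The summand 1 beside ln n keeps n \<alpha> above c, so the maximum with 1 costs
    at most a factor 1 / c.\<close>
  have "c * 1 \<le> c * (1 + ln n)" "c * ln n \<le> c * (1 + ln n)"
    using c ln_n by (auto intro!: mult_left_mono)
  then have "c \<le> n * \<alpha>" and c_ln: "c * ln n \<le> n * \<alpha>" using c(3) by linarith+
  then have p2: "p \<le> (2 / c) * (n * \<alpha>)"
  proof -
    have "(n * \<alpha>) * c \<le> n * \<alpha>" using c \<alpha> by (intro mult_left_le) auto
    then have "1 \<le> (n * \<alpha>) / c" "n * \<alpha> \<le> (n * \<alpha>) / c"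
      using \<open>c \<le> n * \<alpha>\<close> c by (auto simp: pos_le_divide_eq)
    then have "max (n * \<alpha>) 1 \<le> (n * \<alpha>) / c" by simp
    then have "p \<le> 2 * ((n * \<alpha>) / c)" using p(3) by linarith
    then show ?thesis by simp
  qed
  define s where "s = 2 / c"
  define T where "T = sqrt (walk_const * exp s * p)"
  have wc: "walk_const > 0" by (simp add: walk_const_def)
  have T: "0 \<le> T" "T ^ (p + p) = (walk_const * p) ^ p * exp (s * p)" "0 < T ^ (p + p)"
  proof -
    show "0 \<le> T" using wc by (simp add: T_def)
    have "T ^ (p + p) = (T * T) ^ p" by (simp add: power_add power_mult_distrib)
    also have "T * T = walk_const * p * exp s" using wc by (simp add: T_def)
    also have "\<dots> ^ p = (walk_const * p) ^ p * exp (s * p)"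
      by (simp add: power_mult_distrib exp_of_nat_mult[symmetric] mult.commute)
    finally show "T ^ (p + p) = (walk_const * p) ^ p * exp (s * p)" .
    then show "0 < T ^ (p + p)" using wc p by simp
  qed
  have L: "p + p = 2 ^ Suc k" by (simp add: p_def)
  obtain l where l: "p + p = Suc l" using p by (cases "p + p") auto
  let ?m = "\<lambda>\<omega>. mtrace n (symm X \<omega>) (p + p)"
  have int: "integrable M ?m" unfolding l by (rule integrable_mtrace[OF indep bnd])
  have nn: "0 \<le> ?m \<omega>" for \<omega>
  proof -
    have "?m \<omega> = (\<Sum>l<n. \<Sum>i<n. (mpow n (symm X \<omega>) p i l)\<^sup>2)"
      by (intro mtrace_double symm_sym)
    then show ?thesis by (simp add: sum_nonneg)
  qed
  have "expectation ?m \<le> (\<Sum>xs\<in>{xs\<in>walks n (p + p). doubled xs}. \<alpha> ^ card (set (cedges xs)))"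
    unfolding l by (rule expectation_mtrace_le[OF indep bnd mean var])
  also have "\<dots> \<le> real (n * card {ys\<in>walks (p + p) (p + p). doubled ys})"
    by (rule doubled_walks_comparison[OF p(2) \<alpha> p(1)])
  also have "\<dots> \<le> n * (walk_const * p) ^ p"
    using card_doubled_walks_le[OF p(2)] by (simp add: mult_left_mono)
  finally have E: "expectation ?m \<le> n * (walk_const * p) ^ p" .
  define G where "G = {\<omega>\<in>space M. ?m \<omega> < T ^ (p + p)}"
  have meas: "?m \<in> borel_measurable M" using int by auto
  have "prob {\<omega>\<in>space M. T ^ (p + p) \<le> ?m \<omega>} \<le> expectation ?m / T ^ (p + p)"
    using int nn T(3) by (intro integral_Markov_inequality_measure[where A = "{}"]) auto
  also have "\<dots> \<le> (n * (walk_const * p) ^ p) / T ^ (p + p)"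
    using E T(3) by (intro divide_right_mono) auto
  also have "\<dots> = n * exp (- (s * p))"
    unfolding T(2) using wc p by (simp add: exp_minus field_simps)
  also have "\<dots> \<le> n * exp (- (2 * ln n))"
  proof -
    have "c * ln n \<le> p" using c_ln p(1) by linarith
    then have "2 * ln n \<le> s * p" using c by (simp add: s_def field_simps)
    then show ?thesis by (intro mult_left_mono) auto
  qed
  also have "\<dots> = 1 / n"
    using n by (simp add: exp_minus exp_double ln_realpow[symmetric] power2_eq_square field_simps)
  finally have bad: "prob {\<omega>\<in>space M. T ^ (p + p) \<le> ?m \<omega>} \<le> 1 / n" .
  have Gev: "G \<in> events" unfolding G_def using meas by measurable
  have "prob G = 1 - prob (space M - G)" using prob_compl[OF Gev] by simp
  moreover have "space M - G = {\<omega>\<in>space M. T ^ (p + p) \<le> ?m \<omega>}" by (auto simp: G_def)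
  ultimately have "prob G \<ge> 1 - 1 / n" using bad by simp
  moreover have "bform n (symm X \<omega>) x x \<le> norm_const c * sqrt (n * \<alpha>) * (\<Sum>i<n. (x i)\<^sup>2)"
    if "\<omega> \<in> G" for \<omega> x
  proof -
    have "bform n (symm X \<omega>) x x \<le> T * (\<Sum>i<n. (x i)\<^sup>2)"
      using that L by (intro bform_le_of_mtrace[of n _ T k] symm_sym T(1)) (simp add: G_def less_imp_le)
    also have "T \<le> sqrt (walk_const * exp s * ((2 / c) * (n * \<alpha>)))"
      unfolding T_def using wc p2 by (intro real_sqrt_le_mono mult_left_mono) auto
    also have "\<dots> = norm_const c * sqrt (n * \<alpha>)"
      unfolding norm_const_def s_def by (simp only: real_sqrt_mult[symmetric]) (simp add: mult_ac)
    finally show ?thesis by (simp add: sum_nonneg mult_right_mono)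
  qed
  ultimately show ?thesis using that[of G] Gev by blast
qed

section \<open>Measurability of exact recovery\<close>

abbreviation square :: "nat \<Rightarrow> (nat \<times> nat) set" where
  "square n \<equiv> {..<n} \<times> {..<n}"

lemma compact_unit_box: "compact (UNIV \<rightarrow>\<^sub>E {- 1..1} :: ('i \<Rightarrow> real) set)"
  using compactin_PiE[of "\<lambda>_. euclidean :: real topology" UNIV "\<lambda>_. {- 1..1}"]
  by (simp add: euclidean_product_topology)

text \<open>Tube lemma: the inequality is open in the pair (A, Y), and compactness of K makes the
  neighbourhood of A uniform in Y.\<close>

lemma open_all_negative:
  fixes K :: "('i \<Rightarrow> real) set"
  assumes "compact K" "finite S"
  shows "open {A. \<forall>Y\<in>K. (\<Sum>p\<in>S. A p * (Y p - y0 p)) < 0}"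
proof -
  define W where "W = {z :: ('i \<Rightarrow> real) \<times> ('i \<Rightarrow> real). (\<Sum>p\<in>S. fst z p * (snd z p - y0 p)) < 0}"
  have "continuous_on UNIV (\<lambda>z :: ('i \<Rightarrow> real) \<times> ('i \<Rightarrow> real). \<Sum>p\<in>S. fst z p * (snd z p - y0 p))"
    by (intro continuous_intros continuous_on_product_then_coordinatewise)
  then have W: "open W" unfolding W_def by (intro open_Collect_less continuous_on_const)
  show ?thesis
  proof (subst open_subopen, intro ballI)
    fix A assume "A \<in> {A. \<forall>Y\<in>K. (\<Sum>p\<in>S. A p * (Y p - y0 p)) < 0}"
    then have "{A} \<times> K \<subseteq> W" by (auto simp: W_def)
    from Elementary_Topology.tube_lemma[OF assms(1) W this] obtain X0 where "A \<in> X0" "open X0" "X0 \<times> K \<subseteq> W" by blast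
    then show "\<exists>T. open T \<and> A \<in> T \<and> T \<subseteq> {A. \<forall>Y\<in>K. (\<Sum>p\<in>S. A p * (Y p - y0 p)) < 0}"
      by (intro exI[of _ X0]) (fastforce simp: W_def)
  qed
qed

text \<open>The condition ranges over uncountably many Y. It becomes a countable intersection of
  open sets: at level m, all Y in F at squared distance at least 1 / (m + 1) from \<open>y0\<close>
  have strictly smaller value.\<close>

lemma borel_unique_maximizer:
  fixes F :: "('i \<Rightarrow> real) set"
  assumes F: "compact F" and S: "finite S"
    and supp: "\<And>Y. Y \<in> F \<Longrightarrow> (\<forall>p\<in>S. Y p = y0 p) \<Longrightarrow> Y = y0"
  shows "{A. \<forall>Y\<in>F. (\<Sum>p\<in>S. A p * y0 p) \<le> (\<Sum>p\<in>S. A p * Y p) \<longrightarrow> Y = y0} \<in> sets borel"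
proof -
  define K where "K m = F \<inter> {Y. 1 / real (Suc m) \<le> (\<Sum>p\<in>S. (Y p - y0 p)\<^sup>2)}" for m
  have "closed {Y :: 'i \<Rightarrow> real. 1 / real (Suc m) \<le> (\<Sum>p\<in>S. (Y p - y0 p)\<^sup>2)}" for m
    by (intro closed_Collect_le continuous_intros continuous_on_product_then_coordinatewise)
  then have K: "compact (K m)" for m unfolding K_def by (intro compact_Int_closed F)
  have iff: "Y = y0 \<longleftrightarrow> (\<forall>m. Y \<notin> K m)" if "Y \<in> F" for Y
  proof
    assume Y: "\<forall>m. Y \<notin> K m"
    have "(\<Sum>p\<in>S. (Y p - y0 p)\<^sup>2) \<le> 0"
    proof (rule ccontr)
      assume "\<not> (\<Sum>p\<in>S. (Y p - y0 p)\<^sup>2) \<le> 0"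
      then obtain m where "inverse (real (Suc m)) < (\<Sum>p\<in>S. (Y p - y0 p)\<^sup>2)"
        using reals_Archimedean[of "\<Sum>p\<in>S. (Y p - y0 p)\<^sup>2"] by auto
      then have "Y \<in> K m" using that by (simp add: K_def inverse_eq_divide less_imp_le)
      then show False using Y by blast
    qed
    then have "(\<Sum>p\<in>S. (Y p - y0 p)\<^sup>2) = 0" by (intro antisym sum_nonneg) auto
    then have "\<forall>p\<in>S. Y p = y0 p" using S by (subst (asm) sum_nonneg_eq_0_iff) auto
    then show "Y = y0" by (rule supp[OF that])
  qed (auto simp: K_def)
  have "{A. \<forall>Y\<in>F. (\<Sum>p\<in>S. A p * y0 p) \<le> (\<Sum>p\<in>S. A p * Y p) \<longrightarrow> Y = y0}
      = (\<Inter>m. {A. \<forall>Y\<in>K m. (\<Sum>p\<in>S. A p * (Y p - y0 p)) < 0})"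
  proof -
    have "(\<Sum>p\<in>S. A p * (Y p - y0 p)) < 0 \<longleftrightarrow> \<not> (\<Sum>p\<in>S. A p * y0 p) \<le> (\<Sum>p\<in>S. A p * Y p)" for A Y
      by (auto simp: right_diff_distrib sum_subtractf)
    then show ?thesis using iff by (auto simp: K_def)
  qed
  also have "\<dots> \<in> sets borel"
    using borel_open[OF open_all_negative[OF K S]] by (intro sets.countable_INT') auto
  finally show ?thesis .
qed

text \<open>Entries outside the square are fixed to 0, which turns feasible matrices into points of
  a product space.\<close>

definition feasible_fun :: "nat \<Rightarrow> bool \<Rightarrow> (nat \<times> nat \<Rightarrow> real) set" where
  "feasible_fun n c = {Y. (\<forall>p. p \<notin> square n \<longrightarrow> Y p = 0) \<and> (\<forall>i<n. \<forall>j<n. Y (i, j) = Y (j, i)) \<and>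
     (\<forall>i<n. Y (i, i) = 1) \<and> (\<forall>x. 0 \<le> bform n (\<lambda>i j. Y (i, j)) x x) \<and>
     (c \<longrightarrow> (\<Sum>i<n. \<Sum>j<n. Y (i, j)) = 0)}"

lemma psd_entry_bound:
  assumes sym: "\<And>i j. i < n \<Longrightarrow> j < n \<Longrightarrow> Y i j = Y j i"
    and psd: "\<And>x. 0 \<le> bform n Y x x" and diag: "\<And>i. i < n \<Longrightarrow> Y i i = 1"
    and ij: "i < n" "j < n"
  shows "\<bar>Y i j\<bar> \<le> 1"
proof -
  obtain v where v: "\<And>i j. i < n \<Longrightarrow> j < n \<Longrightarrow> Y i j = (\<Sum>k<n. v k i * v k j)"
    using psd_gram[of n Y] sym psd by blast
  have "(Y i j)\<^sup>2 \<le> (\<Sum>k<n. (v k i)\<^sup>2) * (\<Sum>k<n. (v k j)\<^sup>2)"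
    unfolding v[OF ij] by (rule Cauchy_Schwarz_ineq_sum)
  also have "\<dots> = Y i i * Y j j" using v ij by (simp add: power2_eq_square)
  finally show ?thesis using diag ij by (simp add: abs_square_le_1)
qed

text \<open>A closed subset of the unit box, the entries being bounded by Cauchy-Schwarz on the Gram
  vectors.\<close>

lemma compact_feasible_fun: "compact (feasible_fun n c)"
proof -
  have coord: "continuous_on UNIV (\<lambda>Y :: nat \<times> nat \<Rightarrow> real. Y p)" for p by simp
  have form: "continuous_on UNIV (\<lambda>Y :: nat \<times> nat \<Rightarrow> real. bform n (\<lambda>i j. Y (i, j)) x x)" for x
    unfolding bform_def by (intro continuous_intros continuous_on_product_then_coordinatewise)
  have total: "continuous_on UNIV (\<lambda>Y :: nat \<times> nat \<Rightarrow> real. \<Sum>i<n. \<Sum>j<n. Y (i, j))"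
    by (intro continuous_intros continuous_on_product_then_coordinatewise)
  have "closed (feasible_fun n c)"
  proof -
    have "feasible_fun n c = (\<Inter>p\<in>- square n. {Y. Y p = 0})
        \<inter> (\<Inter>i\<in>{..<n}. \<Inter>j\<in>{..<n}. {Y. Y (i, j) = Y (j, i)}) \<inter> (\<Inter>i\<in>{..<n}. {Y. Y (i, i) = 1})
        \<inter> (\<Inter>x. {Y. 0 \<le> bform n (\<lambda>i j. Y (i, j)) x x})
        \<inter> (if c then {Y. (\<Sum>i<n. \<Sum>j<n. Y (i, j)) = 0} else UNIV)"
      unfolding feasible_fun_def by (auto; blast)
    also have "closed \<dots>"
      by (intro closed_Int closed_INT ballI closed_Collect_eq closed_Collect_le coord form continuous_on_const)
        (auto intro!: closed_Collect_eq total)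
    finally show ?thesis .
  qed
  moreover have "feasible_fun n c \<subseteq> UNIV \<rightarrow>\<^sub>E {- 1..1}"
  proof
    fix Y assume Y: "Y \<in> feasible_fun n c"
    have "\<bar>Y p\<bar> \<le> 1" for p
    proof (cases "p \<in> square n")
      case True
      then show ?thesis
        using Y psd_entry_bound[of n "\<lambda>i j. Y (i, j)" "fst p" "snd p"] by (auto simp: feasible_fun_def)
    next
      case False
      then have "Y p = 0" using Y unfolding feasible_fun_def by blast
      then show ?thesis by simp
    qed
    then show "Y \<in> UNIV \<rightarrow>\<^sub>E {- 1..1}" by (auto simp: abs_le_iff; smt (verit))
  qed
  ultimately show ?thesis
    using compact_Int_closed[OF compact_unit_box, of "feasible_fun n c"] by (simp add: Int_absorb1)
qed

definition sdp_set :: "nat \<Rightarrow> bool \<Rightarrow> real mat set" where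
  "sdp_set n c = (if c then sdp_feasible_SBM n else sdp_feasible n)"

lemma scalar_prod_mult_mat_vec:
  assumes "Y \<in> carrier_mat n n" "v \<in> carrier_vec n"
  shows "scalar_prod v (Y *\<^sub>v v) = bform n (\<lambda>i j. Y $$ (i, j)) (\<lambda>i. v $ i) (\<lambda>i. v $ i)"
  using assms
  by (auto simp: scalar_prod_def bform_def sum_distrib_left atLeast0LessThan mult_ac intro!: sum.cong)

lemma mem_sdp_set_iff:
  "Y \<in> sdp_set n c \<longleftrightarrow> Y \<in> carrier_mat n n \<and> (\<forall>i<n. \<forall>j<n. Y $$ (i, j) = Y $$ (j, i)) \<and>
     (\<forall>i<n. Y $$ (i, i) = 1) \<and> (\<forall>x. 0 \<le> bform n (\<lambda>i j. Y $$ (i, j)) x x) \<and>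
     (c \<longrightarrow> (\<Sum>i<n. \<Sum>j<n. Y $$ (i, j)) = 0)"
proof -
  have sym: "transpose_mat Y = Y \<longleftrightarrow> (\<forall>i<n. \<forall>j<n. Y $$ (i, j) = Y $$ (j, i))"
    if "Y \<in> carrier_mat n n"
  proof
    assume t: "transpose_mat Y = Y"
    show "\<forall>i<n. \<forall>j<n. Y $$ (i, j) = Y $$ (j, i)"
    proof (intro allI impI)
      fix i j assume "i < n" "j < n"
      then have "transpose_mat Y $$ (i, j) = Y $$ (j, i)" using that by auto
      then show "Y $$ (i, j) = Y $$ (j, i)" unfolding t .
    qed
  next
    assume "\<forall>i<n. \<forall>j<n. Y $$ (i, j) = Y $$ (j, i)"
    then show "transpose_mat Y = Y" using that by (intro eq_matI) auto
  qed
  have psd: "(\<forall>v\<in>carrier_vec n. 0 \<le> scalar_prod v (Y *\<^sub>v v)) \<longleftrightarrow> (\<forall>x. 0 \<le> bform n (\<lambda>i j. Y $$ (i, j)) x x)"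
    if "Y \<in> carrier_mat n n"
  proof
    assume p: "\<forall>v\<in>carrier_vec n. 0 \<le> scalar_prod v (Y *\<^sub>v v)"
    show "\<forall>x. 0 \<le> bform n (\<lambda>i j. Y $$ (i, j)) x x"
    proof
      fix x :: "nat \<Rightarrow> real"
      have "0 \<le> scalar_prod (vec n x) (Y *\<^sub>v vec n x)" using p by simp
      also have "\<dots> = bform n (\<lambda>i j. Y $$ (i, j)) x x"
        unfolding scalar_prod_mult_mat_vec[OF that vec_carrier] by (intro bform_cong) auto
      finally show "0 \<le> bform n (\<lambda>i j. Y $$ (i, j)) x x" .
    qed
  qed (simp add: scalar_prod_mult_mat_vec[OF that])
  show ?thesis
  proof (cases "Y \<in> carrier_mat n n")
    case True
    have "psd_mat n Y \<longleftrightarrow> (\<forall>i<n. \<forall>j<n. Y $$ (i, j) = Y $$ (j, i)) \<and>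
        (\<forall>x. 0 \<le> bform n (\<lambda>i j. Y $$ (i, j)) x x)"
      unfolding psd_mat_def sym[OF True] psd[OF True] by (simp only: True simp_thms)
    then show ?thesis
      unfolding sdp_set_def sdp_feasible_def sdp_feasible_SBM_def
      by (cases c) (simp_all only: if_True if_False mem_Collect_eq True simp_thms conj_ac)
  next
    case False
    then show ?thesis
      unfolding sdp_set_def sdp_feasible_def sdp_feasible_SBM_def psd_mat_def
      by (cases c) (simp_all only: if_True if_False mem_Collect_eq False simp_thms)
  qed
qed

lemma mat_inner_eq_square: "mat_inner n A Y = (\<Sum>p\<in>square n. A $$ p * Y $$ p)"
  unfolding mat_inner_def by (simp add: sum.cartesian_product)

lemma random_symmetric_mat_entry:
  assumes M: "random_symmetric_mat n M" and ij: "i < n" "j < n"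
  shows "(\<lambda>A. A $$ (i, j)) \<in> borel_measurable M"
proof -
  have M': "prob_space M" "\<And>A. A \<in> space M \<Longrightarrow> A \<in> carrier_mat n n \<and> transpose_mat A = A"
    "prob_space.indep_vars M (\<lambda>_. borel) (\<lambda>(i, j) A. A $$ (i, j)) {(i, j). i \<le> j \<and> j < n}"
    using M by (auto simp: random_symmetric_mat_def)
  have up: "(\<lambda>A. A $$ (i, j)) \<in> borel_measurable M" if "i \<le> j" "j < n" for i j
  proof -
    have "\<forall>p\<in>{(i, j). i \<le> j \<and> j < n}. (\<lambda>(i, j) A. A $$ (i, j)) p \<in> borel_measurable M"
      using M'(3) unfolding prob_space.indep_vars_def[OF M'(1)] by (rule conjunct1)
    then show ?thesis using that by (auto dest: bspec[of _ _ "(i, j)"])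
  qed
  show ?thesis
  proof (cases "i \<le> j")
    case False
    have "A $$ (i, j) = A $$ (j, i)" if "A \<in> space M" for A
    proof -
      have "transpose_mat A $$ (i, j) = A $$ (j, i)" using M'(2)[OF that, THEN conjunct1] ij by auto
      then show ?thesis using M'(2)[OF that] by simp
    qed
    then show ?thesis using up[of j i] False ij by (subst measurable_cong) auto
  qed (use up ij in auto)
qed

text \<open>A set outside the sigma-algebra would have measure 0 by convention, so every lower bound
  on the recovery probability rests on this. The event is pulled back along \<open>f\<close> from
  the function space.\<close>

lemma recovery_event_measurable:
  assumes M: "random_symmetric_mat n M"
  shows "{A \<in> space M. \<forall>Y\<in>sdp_superlevel n (sdp_set n c) \<sigma> A. Y = outer_mat n \<sigma>} \<in> sets M"
proof -
  define f :: "real mat \<Rightarrow> nat \<times> nat \<Rightarrow> real" where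
    "f A p = (if p \<in> square n then A $$ p else 0)" for A p
  define y0 where "y0 = f (outer_mat n \<sigma>)"
  let ?B = "{A. \<forall>Y\<in>feasible_fun n c. (\<Sum>p\<in>square n. A p * y0 p) \<le> (\<Sum>p\<in>square n. A p * Y p) \<longrightarrow> Y = y0}"
  have B: "?B \<in> sets borel"
  proof (rule borel_unique_maximizer[OF compact_feasible_fun])
    fix Y assume "Y \<in> feasible_fun n c" "\<forall>p\<in>square n. Y p = y0 p"
    then show "Y = y0" by (intro ext) (auto simp: feasible_fun_def y0_def f_def)
  qed auto
  have f: "f \<in> borel_measurable M"
  proof (rule measurable_coordinatewise_then_product)
    fix p
    show "(\<lambda>A. f A p) \<in> borel_measurable M"
      using random_symmetric_mat_entry[OF M, of "fst p" "snd p"]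
      by (cases "p \<in> square n") (auto simp: f_def[abs_def])
  qed
  have img: "f ` sdp_set n c = feasible_fun n c"
  proof
    have "f Y \<in> feasible_fun n c" if "Y \<in> sdp_set n c" for Y
    proof -
      have "bform n (\<lambda>i j. f Y (i, j)) x x = bform n (\<lambda>i j. Y $$ (i, j)) x x" for x
        unfolding bform_def by (intro sum.cong) (auto simp: f_def)
      moreover have "(\<Sum>i<n. \<Sum>j<n. f Y (i, j)) = (\<Sum>i<n. \<Sum>j<n. Y $$ (i, j))"
        by (intro sum.cong) (auto simp: f_def)
      ultimately show ?thesis using that unfolding mem_sdp_set_iff feasible_fun_def by (simp add: f_def)
    qed
    then show "f ` sdp_set n c \<subseteq> feasible_fun n c" by blast
    show "feasible_fun n c \<subseteq> f ` sdp_set n c"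
    proof
      fix g assume g: "g \<in> feasible_fun n c"
      have "bform n (\<lambda>i j. mat n n g $$ (i, j)) x x = bform n (\<lambda>i j. g (i, j)) x x" for x
        unfolding bform_def by (intro sum.cong) auto
      moreover have "(\<Sum>i<n. \<Sum>j<n. mat n n g $$ (i, j)) = (\<Sum>i<n. \<Sum>j<n. g (i, j))"
        by (intro sum.cong) auto
      ultimately have "mat n n g \<in> sdp_set n c"
        using g unfolding mem_sdp_set_iff feasible_fun_def by simp
      moreover have "g = f (mat n n g)"
        using g by (intro ext) (auto simp: f_def feasible_fun_def)
      ultimately show "g \<in> f ` sdp_set n c" by blast
    qed
  qed
  have inj: "Y = outer_mat n \<sigma> \<longleftrightarrow> f Y = y0" if "Y \<in> sdp_set n c" for Y
  proof
    assume eq: "f Y = y0"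
    show "Y = outer_mat n \<sigma>"
    proof (rule eq_matI)
      fix i j assume "i < dim_row (outer_mat n \<sigma>)" "j < dim_col (outer_mat n \<sigma>)"
      then have "i < n" "j < n" by (auto simp: outer_mat_def)
      then show "Y $$ (i, j) = outer_mat n \<sigma> $$ (i, j)"
        using fun_cong[OF eq, of "(i, j)"] by (simp add: y0_def f_def)
    qed (use that in \<open>auto simp: mem_sdp_set_iff outer_mat_def\<close>)
  qed (simp add: y0_def)
  have inner: "mat_inner n A Y = (\<Sum>p\<in>square n. f A p * f Y p)" for A Y
    unfolding mat_inner_eq_square f_def by (intro sum.cong) auto
  have "{A \<in> space M. \<forall>Y\<in>sdp_superlevel n (sdp_set n c) \<sigma> A. Y = outer_mat n \<sigma>} = f -` ?B \<inter> space M"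
    unfolding sdp_superlevel_def inner img[symmetric] using inj by (auto simp: y0_def)
  also have "\<dots> \<in> sets M" by (rule measurable_sets[OF f B])
  finally show ?thesis .
qed

section \<open>Recovery from a norm bound and row-wise Chernoff bounds\<close>

text \<open>The entries of one row correspond to distinct upper-triangular pairs and are
  independent, although different rows share entries. The bounds \<open>m j\<close> vary with the
  column, as the block model requires.\<close>

lemma (in prob_space) chernoff_row:
  fixes X :: "nat \<times> nat \<Rightarrow> 'a \<Rightarrow> real"
  assumes indep: "indep_vars (\<lambda>_. borel) X (upper n)" and i: "i < n"
    and mgf: "\<And>j. j < n \<Longrightarrow> (\<integral>\<^sup>+\<omega>. ennreal (exp (- t * (a j * symm X \<omega> i j))) \<partial>M) \<le> ennreal (m j)"
    and m: "\<And>j. j < n \<Longrightarrow> 0 \<le> m j" and t: "0 \<le> t"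
  shows "prob {\<omega>\<in>space M. (\<Sum>j<n. a j * symm X \<omega> i j) \<le> s} \<le> exp (t * s) * (\<Prod>j<n. m j)"
proof -
  define g where "g j = (min i j, max i j)" for j
  \<comment> \<open>Recovers the column j from the pair \<open>g j\<close>; on the diagonal both
    coordinates are i.\<close>
  define h where "h p = (if fst p = i then snd p else fst p)" for p :: "nat \<times> nat"
  have hg: "h (g j) = j" for j by (auto simp: h_def g_def min_def max_def)
  have inj: "inj_on g {..<n}" by (rule inj_on_inverseI[of _ h]) (simp add: hg)
  have sub: "g ` {..<n} \<subseteq> upper n" using i by (auto simp: g_def upper_def)
  define Y where "Y p \<omega> = ennreal (exp (- t * (a (h p) * X p \<omega>)))" for p \<omega>
  have rv: "random_variable borel (X (g j))" if "j < n" for j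
    using indep sub that by (auto simp: indep_vars_def)
  have sx: "symm X \<omega> i j = X (g j) \<omega>" for \<omega> j by (simp add: symm_def g_def)
  have indY: "indep_vars (\<lambda>_. borel) Y (g ` {..<n})"
    unfolding Y_def[abs_def]
    by (rule indep_vars_compose2[OF indep_vars_subset[OF indep sub],
          where Y = "\<lambda>p x. ennreal (exp (- t * (a (h p) * x)))"]) measurable
  let ?d = "\<lambda>\<omega>. \<Sum>j<n. a j * symm X \<omega> i j"
  have meas: "?d \<in> borel_measurable M"
    unfolding sx using rv by (intro borel_measurable_sum borel_measurable_times) auto
  have "(\<integral>\<^sup>+\<omega>. ennreal (exp (- t * ?d \<omega>)) \<partial>M) = (\<integral>\<^sup>+\<omega>. (\<Prod>p\<in>g ` {..<n}. Y p \<omega>) \<partial>M)"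
    by (simp add: prod.reindex[OF inj] Y_def hg sx sum_distrib_left exp_sum prod_ennreal sum_negf[symmetric])
  also have "\<dots> = (\<Prod>p\<in>g ` {..<n}. \<integral>\<^sup>+\<omega>. Y p \<omega> \<partial>M)"
    by (rule indep_vars_nn_integral[OF _ indY]) auto
  also have "\<dots> = (\<Prod>j<n. \<integral>\<^sup>+\<omega>. ennreal (exp (- t * (a j * symm X \<omega> i j))) \<partial>M)"
    by (simp add: prod.reindex[OF inj] Y_def hg sx)
  also have "\<dots> \<le> (\<Prod>j<n. ennreal (m j))"
    by (intro prod_mono_ennreal mgf) auto
  also have "\<dots> = ennreal (\<Prod>j<n. m j)" by (intro prod_ennreal) (auto simp: m)
  finally have E: "(\<integral>\<^sup>+\<omega>. ennreal (exp (- t * ?d \<omega>)) \<partial>M) \<le> ennreal (\<Prod>j<n. m j)" .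
  have "emeasure M {\<omega>\<in>space M. ?d \<omega> \<le> s}
      \<le> emeasure M ({\<omega>\<in>space M. 1 \<le> ennreal (exp (t * s)) * ennreal (exp (- t * ?d \<omega>))} \<inter> space M)"
  proof (rule emeasure_mono)
    show "{\<omega>\<in>space M. 1 \<le> ennreal (exp (t * s)) * ennreal (exp (- t * ?d \<omega>))} \<inter> space M \<in> events"
      using meas by measurable
    show "{\<omega>\<in>space M. ?d \<omega> \<le> s}
        \<subseteq> {\<omega>\<in>space M. 1 \<le> ennreal (exp (t * s)) * ennreal (exp (- t * ?d \<omega>))} \<inter> space M"
    proof clarsimp
      fix \<omega> assume "?d \<omega> \<le> s"
      then have "0 \<le> t * s + - (t * ?d \<omega>)" using t by (simp add: mult_left_mono)
      then have "1 \<le> exp (t * s) * exp (- (t * ?d \<omega>))" by (simp flip: exp_add)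
      then show "1 \<le> ennreal (exp (t * s)) * ennreal (exp (- (t * ?d \<omega>)))"
        by (simp flip: ennreal_mult')
    qed
  qed
  also have "\<dots> \<le> ennreal (exp (t * s)) * (\<integral>\<^sup>+\<omega>. ennreal (exp (- t * ?d \<omega>)) * indicator (space M) \<omega> \<partial>M)"
    using meas nn_integral_Markov_inequality[of "\<lambda>\<omega>. ennreal (exp (- t * ?d \<omega>))" "space M" M "ennreal (exp (t * s))"]
    by (simp add: Int_def conj_commute)
  also have "(\<integral>\<^sup>+\<omega>. ennreal (exp (- t * ?d \<omega>)) * indicator (space M) \<omega> \<partial>M)
      = (\<integral>\<^sup>+\<omega>. ennreal (exp (- t * ?d \<omega>)) \<partial>M)"
    by (intro nn_integral_cong) simp
  also have "ennreal (exp (t * s)) * \<dots> \<le> ennreal (exp (t * s)) * ennreal (\<Prod>j<n. m j)"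
    by (intro mult_left_mono E) simp
  finally have "ennreal (prob {\<omega>\<in>space M. ?d \<omega> \<le> s}) \<le> ennreal (exp (t * s) * (\<Prod>j<n. m j))"
    by (simp add: emeasure_eq_measure ennreal_mult')
  then show ?thesis
    by (subst (asm) ennreal_le_iff) (use m in \<open>auto intro!: mult_nonneg_nonneg prod_nonneg\<close>)
qed

abbreviation entry :: "nat \<times> nat \<Rightarrow> real mat \<Rightarrow> real" where
  "entry p A \<equiv> A $$ p"

lemma random_symmetric_matD:
  assumes "random_symmetric_mat n M"
  shows "prob_space M" "prob_space.indep_vars M (\<lambda>_. borel) entry (upper n)"
    "\<And>A i j. A \<in> space M \<Longrightarrow> i < n \<Longrightarrow> j < n \<Longrightarrow> A $$ (i, j) = A $$ (j, i)"
proof -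
  have "(\<lambda>(i, j) A. A $$ (i, j)) = entry" by (auto simp: fun_eq_iff)
  then show "prob_space M" "prob_space.indep_vars M (\<lambda>_. borel) entry (upper n)"
    using assms by (auto simp: random_symmetric_mat_def upper_def)
  fix A i j assume A: "A \<in> space M" "i < n" "j < n"
  then have "A \<in> carrier_mat n n" "transpose_mat A = A" using assms by (auto simp: random_symmetric_mat_def)
  moreover from this A have "transpose_mat A $$ (i, j) = A $$ (j, i)" by (intro index_transpose_mat) auto
  ultimately show "A $$ (i, j) = A $$ (j, i)" by simp
qed

lemma symm_entry:
  assumes "random_symmetric_mat n M" "A \<in> space M" "i < n" "j < n"
  shows "symm entry A i j = A $$ (i, j)"
  using random_symmetric_matD(3)[OF assms] by (simp add: symm_def min_def max_def)

lemma label_vec_cases: "label_vec n \<sigma> \<Longrightarrow> i < n \<Longrightarrow> \<sigma> $ i = - 1 \<or> \<sigma> $ i = 1"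
  by (auto simp: label_vec_def)

text \<open>One number s serves as norm bound on the complement and as threshold for the row sums,
  so that on G and off the n row events the diagonal dominates. The norm hypothesis concerns A
  itself, since its mean vanishes on the constrained vectors.\<close>

lemma exact_recovery_prob_ge:
  fixes \<sigma> :: "real Matrix.vec"
  assumes M: "random_symmetric_mat n M" and \<sigma>: "label_vec n \<sigma>" and bal: "c \<Longrightarrow> (\<Sum>i<n. \<sigma> $ i) = 0"
    and t: "0 \<le> t"
    and mgf: "\<And>i j. i < n \<Longrightarrow> j < n \<Longrightarrow>
      (\<integral>\<^sup>+A. ennreal (exp (- t * (\<sigma> $ i * \<sigma> $ j * A $$ (i, j)))) \<partial>M) \<le> ennreal (m i j)"
    and m: "\<And>i j. i < n \<Longrightarrow> j < n \<Longrightarrow> 0 \<le> m i j"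
    and row: "\<And>i. i < n \<Longrightarrow> exp (t * s) * (\<Prod>j<n. m i j) \<le> b"
    and G: "G \<in> sets M" "1 - \<delta> \<le> measure M G"
    and norm: "\<And>A x. A \<in> G \<Longrightarrow> (\<Sum>i<n. \<sigma> $ i * x i) = 0 \<Longrightarrow> (c \<Longrightarrow> (\<Sum>i<n. x i) = 0) \<Longrightarrow>
      bform n (\<lambda>i j. A $$ (i, j)) x x \<le> s * (\<Sum>i<n. (x i)\<^sup>2)"
  shows "1 - (n * b + \<delta>) \<le> exact_recovery_prob n (sdp_set n c) \<sigma> M"
proof -
  interpret prob_space M by (rule random_symmetric_matD(1)[OF M])
  note indep = random_symmetric_matD(2)[OF M]
  define d where "d A i = (\<Sum>j<n. A $$ (i, j) * \<sigma> $ i * \<sigma> $ j)" for A :: "real mat" and i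
  define D where "D i = {A\<in>space M. d A i \<le> s}" for i
  have d: "d A i = (\<Sum>j<n. \<sigma> $ i * \<sigma> $ j * symm entry A i j)" if "A \<in> space M" "i < n" for A i
    unfolding d_def using that symm_entry[OF M] by (intro sum.cong) auto
  have Dp: "prob (D i) \<le> b" if i: "i < n" for i
  proof -
    have "D i = {A\<in>space M. (\<Sum>j<n. \<sigma> $ i * \<sigma> $ j * symm entry A i j) \<le> s}"
      using d i by (auto simp: D_def)
    also have "prob \<dots> \<le> exp (t * s) * (\<Prod>j<n. m i j)"
    proof (rule chernoff_row[OF indep i _ _ t])
      fix j assume j: "j < n"
      have "(\<integral>\<^sup>+A. ennreal (exp (- t * (\<sigma> $ i * \<sigma> $ j * symm entry A i j))) \<partial>M)
          = (\<integral>\<^sup>+A. ennreal (exp (- t * (\<sigma> $ i * \<sigma> $ j * A $$ (i, j)))) \<partial>M)"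
        using symm_entry[OF M] i j by (intro nn_integral_cong) simp
      then show "(\<integral>\<^sup>+A. ennreal (exp (- t * (\<sigma> $ i * \<sigma> $ j * symm entry A i j))) \<partial>M) \<le> ennreal (m i j)"
        using mgf[OF i j] by simp
    qed (use m i in auto)
    finally show ?thesis using row[OF i] by simp
  qed
  have Dev: "D i \<in> events" if "i < n" for i
    unfolding D_def d_def using random_symmetric_mat_entry[OF M that] by measurable
  let ?R = "{A \<in> space M. \<forall>Y\<in>sdp_superlevel n (sdp_set n c) \<sigma> A. Y = outer_mat n \<sigma>}"
  have sub: "G - (\<Union>i<n. D i) \<subseteq> ?R"
  proof
    fix A assume A: "A \<in> G - (\<Union>i<n. D i)"
    then have AM: "A \<in> space M" using G sets.sets_into_space by blast
    have dA: "s < d A i" if "i < n" for i using A AM that by (auto simp: D_def not_le)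
    have "Y = outer_mat n \<sigma>" if Y: "Y \<in> sdp_superlevel n (sdp_set n c) \<sigma> A" for Y
    proof -
      have Yc: "Y \<in> sdp_set n c" "mat_inner n A (outer_mat n \<sigma>) \<le> mat_inner n A Y"
        using Y by (auto simp: sdp_superlevel_def)
      note Y' = Yc(1)[unfolded mem_sdp_set_iff]
      have "Y $$ (i, j) = \<sigma> $ i * \<sigma> $ j" if ij: "i < n" "j < n" for i j
      proof (rule sdp_dual_certificate[where n = n and A = "\<lambda>i j. A $$ (i, j)" and Y = "\<lambda>i j. Y $$ (i, j)"
            and \<sigma> = "\<lambda>i. \<sigma> $ i" and c = c])
        fix x i
        assume x: "(\<Sum>i<n. \<sigma> $ i * x i) = 0" "c \<Longrightarrow> (\<Sum>i<n. x i) = 0"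
          and le: "(\<Sum>i<n. (\<Sum>j<n. A $$ (i, j) * \<sigma> $ i * \<sigma> $ j) * (x i)\<^sup>2) \<le> bform n (\<lambda>i j. A $$ (i, j)) x x"
          and i: "i < n"
        have "bform n (\<lambda>i j. A $$ (i, j)) x x \<le> s * (\<Sum>i<n. (x i)\<^sup>2)"
          using A x by (intro norm) auto
        with le have "(\<Sum>i<n. (d A i - s) * (x i)\<^sup>2) \<le> 0"
          by (simp add: d_def left_diff_distrib sum_subtractf sum_distrib_left)
        moreover have nn: "0 \<le> (d A k - s) * (x k)\<^sup>2" if "k < n" for k
          using dA[OF that] by simp
        ultimately have "(\<Sum>i<n. (d A i - s) * (x i)\<^sup>2) = 0"
          by (intro antisym sum_nonneg) auto
        then have "(d A i - s) * (x i)\<^sup>2 = 0"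
          using nn i by (subst (asm) sum_nonneg_eq_0_iff) auto
        then show "x i = 0" using dA[OF i] by simp
      next
        show "(\<Sum>i<n. \<Sum>j<n. A $$ (i, j) * (\<sigma> $ i * \<sigma> $ j)) \<le> (\<Sum>i<n. \<Sum>j<n. A $$ (i, j) * Y $$ (i, j))"
          using Yc(2) by (simp add: mat_inner_def outer_mat_def)
      next
        fix i j assume ij: "i < n" "j < n"
        show "\<sigma> $ i = - 1 \<or> \<sigma> $ i = 1" by (rule label_vec_cases[OF \<sigma> ij(1)])
        show "A $$ (i, j) = A $$ (j, i)" by (rule random_symmetric_matD(3)[OF M AM ij])
        show "Y $$ (i, j) = Y $$ (j, i)" using Y' ij by blast
        show "Y $$ (i, i) = 1" using Y' ij by blast
      next
        show "0 \<le> bform n (\<lambda>i j. Y $$ (i, j)) x x" for x using Y' by blast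
        show "(\<Sum>i<n. \<sigma> $ i) = 0 \<and> (\<Sum>i<n. \<Sum>j<n. Y $$ (i, j)) = 0" if c
          using Y' bal[OF that] that by blast
      qed (rule ij)+
      then show ?thesis
        using Y' by (intro eq_matI) (auto simp: outer_mat_def)
    qed
    then show "A \<in> ?R" using AM by blast
  qed
  have "prob (\<Union>i<n. D i) \<le> (\<Sum>i<n. prob (D i))"
    by (rule finite_measure_subadditive_finite) (use Dev in auto)
  also have "\<dots> \<le> n * b" using sum_mono[of "{..<n}" "\<lambda>i. prob (D i)" "\<lambda>_. b"] Dp by simp
  finally have DU: "prob (\<Union>i<n. D i) \<le> n * b" .
  have Uev: "(\<Union>i<n. D i) \<in> events" using Dev by auto
  have "prob G \<le> prob (G - (\<Union>i<n. D i)) + prob (\<Union>i<n. D i)"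
  proof -
    have "prob G \<le> prob ((G - (\<Union>i<n. D i)) \<union> (\<Union>i<n. D i))"
      using G Uev by (intro finite_measure_mono) auto
    also have "\<dots> \<le> prob (G - (\<Union>i<n. D i)) + prob (\<Union>i<n. D i)"
      using G Uev by (intro measure_Un_le) auto
    finally show ?thesis .
  qed
  also have "prob (G - (\<Union>i<n. D i)) \<le> prob ?R"
    by (intro finite_measure_mono sub recovery_event_measurable[OF M])
  finally show ?thesis using DU G(2) by (simp add: exact_recovery_prob_def)
qed

text \<open>With L = ln n the hypothesis gives sqrt x >= sqrt L + a, whence x - K sqrt x = sqrt x
  (sqrt x - K) >= (sqrt L + a) (sqrt L + 1) >= L + sqrt L; the 1 in a >= K + 1 produces the term
  sqrt L. The 10 is 1 for the n rows plus 9 >= exp 2 from 1 / n <= exp 2 exp (- sqrt L).\<close>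

lemma second_order_tail_bound:
  fixes K x a b \<delta> :: real and n :: nat
  assumes n: "1 \<le> n" and K: "0 \<le> K" "K + 1 \<le> a"
    and x: "ln n + 2 * a * sqrt (ln n) + a\<^sup>2 \<le> x"
    and b: "b \<le> exp (K * sqrt x - x)" and \<delta>: "\<delta> \<le> 1 / n"
  shows "n * b + \<delta> \<le> 10 * exp (- sqrt (ln n))"
proof -
  define L where "L = ln (real n)"
  have L: "0 \<le> L" using n by (simp add: L_def)
  have "(sqrt L + a)\<^sup>2 \<le> x" using x L by (simp add: L_def power2_sum mult_ac)
  then have y: "sqrt L + a \<le> sqrt x" by (rule real_le_rsqrt)
  have sL: "0 \<le> sqrt L" using L by simp
  have x0: "0 \<le> x" using \<open>(sqrt L + a)\<^sup>2 \<le> x\<close> by (meson order.trans zero_le_power2)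
  have "L + sqrt L \<le> (sqrt L + a) * (sqrt L + 1)"
    using L K sL by (simp add: algebra_simps)
  also have "\<dots> \<le> sqrt x * (sqrt x - K)" using y K sL x0 by (intro mult_mono) auto
  also have "\<dots> = x - K * sqrt x" using x0 by (simp add: algebra_simps)
  finally have "K * sqrt x - x \<le> - L - sqrt L" by simp
  then have "n * b \<le> n * exp (- L - sqrt L)" using b by (intro mult_left_mono) (auto intro: order.trans)
  also have "\<dots> = exp (- sqrt L)" using n by (simp add: exp_diff L_def exp_minus inverse_eq_divide)
  finally have 1: "n * b \<le> exp (- sqrt L)" .
  have "sqrt L \<le> L + 2"
  proof -
    have "0 \<le> (sqrt L - 1)\<^sup>2" by simp
    then show ?thesis using L sL by (simp add: power2_diff)
  qed
  then have "exp (- L) \<le> exp 2 * exp (- sqrt L)" by (simp flip: exp_add)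
  moreover have "exp 2 * exp (- sqrt L) \<le> 9 * exp (- sqrt L)"
  proof (rule mult_right_mono)
    have "exp (2::real) = exp 1 * exp 1" by (simp flip: exp_add)
    also have "\<dots> \<le> 3 * 3" using exp_le by (intro mult_mono) auto
    finally show "exp (2::real) \<le> 9" by simp
  qed simp
  moreover have "exp (- L) = 1 / n" using n by (simp add: L_def exp_minus inverse_eq_divide)
  ultimately have "1 / n \<le> 9 * exp (- sqrt L)"
    by linarith
  then show ?thesis using 1 \<delta> by (simp add: L_def)
qed

lemma scaled_threshold:
  assumes n: "2 \<le> (n::nat)" and h: "1 + C / sqrt (ln n) + D / ln n \<le> x / ln n"
  shows "ln n + C * sqrt (ln n) + D \<le> x"
proof -
  have L: "0 < ln n" using n by simp
  have "(1 + C / sqrt (ln n) + D / ln n) * ln n \<le> x"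
    using h L by (simp add: pos_le_divide_eq)
  moreover have "C / sqrt (ln n) * ln n = C * sqrt (ln n)"
  proof -
    have "C / sqrt (ln n) * ln n = C * (ln n / sqrt (ln n))" by simp
    also have "ln n / sqrt (ln n) = sqrt (ln n)" using L by (intro real_div_sqrt) simp
    finally show ?thesis .
  qed
  ultimately show ?thesis using L by (simp add: distrib_right)
qed

section \<open>Z2 synchronization\<close>

lemma bform_rank_one: "bform n (\<lambda>i j. k * (u i * w j)) x y = k * ((\<Sum>i<n. u i * x i) * (\<Sum>j<n. w j * y j))"
  unfolding bform_def sum_product by (simp add: sum_distrib_left mult_ac)

lemma bform_mat_cong:
  assumes "\<And>i j. i < n \<Longrightarrow> j < n \<Longrightarrow> V i j = W i j"
  shows "bform n V x y = bform n W x y"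
  unfolding bform_def using assms by (intro sum.cong) auto

text \<open>Completing the square: the tilt moves the mean by \<tau>^2 l and leaves a normal
  density.\<close>

lemma nn_integral_normal_exp:
  assumes "0 < \<tau>"
  shows "(\<integral>\<^sup>+x. ennreal (normal_density \<mu> \<tau> x) * ennreal (exp (l * (x - \<mu>))) \<partial>lborel)
     = ennreal (exp (\<tau>\<^sup>2 * l\<^sup>2 / 2))"
proof -
  have pt: "normal_density \<mu> \<tau> x * exp (l * (x - \<mu>))
      = exp (\<tau>\<^sup>2 * l\<^sup>2 / 2) * normal_density (\<mu> + \<tau>\<^sup>2 * l) \<tau> x" for x
  proof -
    have "- (x - \<mu>)\<^sup>2 / (2 * \<tau>\<^sup>2) + l * (x - \<mu>)
        = \<tau>\<^sup>2 * l\<^sup>2 / 2 + - (x - (\<mu> + \<tau>\<^sup>2 * l))\<^sup>2 / (2 * \<tau>\<^sup>2)"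
      using assms by (simp add: field_simps) (simp add: power2_eq_square power4_eq_xxxx algebra_simps)
    then have "exp (- (x - \<mu>)\<^sup>2 / (2 * \<tau>\<^sup>2)) * exp (l * (x - \<mu>))
        = exp (\<tau>\<^sup>2 * l\<^sup>2 / 2) * exp (- (x - (\<mu> + \<tau>\<^sup>2 * l))\<^sup>2 / (2 * \<tau>\<^sup>2))"
      by (simp only: exp_add[symmetric])
    then show ?thesis by (simp add: normal_density_def)
  qed
  have "(\<integral>\<^sup>+x. ennreal (normal_density \<mu> \<tau> x) * ennreal (exp (l * (x - \<mu>))) \<partial>lborel)
      = (\<integral>\<^sup>+x. ennreal (exp (\<tau>\<^sup>2 * l\<^sup>2 / 2)) * ennreal (normal_density (\<mu> + \<tau>\<^sup>2 * l) \<tau> x) \<partial>lborel)"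
    by (simp add: pt flip: ennreal_mult')
  also have "\<dots> = ennreal (exp (\<tau>\<^sup>2 * l\<^sup>2 / 2)) * (\<integral>\<^sup>+x. ennreal (normal_density (\<mu> + \<tau>\<^sup>2 * l) \<tau> x) \<partial>lborel)"
    by (intro nn_integral_cmult) simp
  also have "(\<integral>\<^sup>+x. ennreal (normal_density (\<mu> + \<tau>\<^sup>2 * l) \<tau> x) \<partial>lborel) = 1"
    using assms by (subst nn_integral_eq_integral) (auto simp: integral_normal_density integrable_normal_density)
  finally show ?thesis by simp
qed

lemma nn_integral_exp_normal:
  assumes "distributed M lborel X (normal_density \<mu> \<tau>)" "0 < \<tau>"
  shows "(\<integral>\<^sup>+\<omega>. ennreal (exp (l * (X \<omega> - \<mu>))) \<partial>M) = ennreal (exp (\<tau>\<^sup>2 * l\<^sup>2 / 2))"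
  using distributed_nn_integral[OF assms(1), of "\<lambda>x. ennreal (exp (l * (x - \<mu>)))"]
    nn_integral_normal_exp[OF assms(2)] by simp

lemma measurable_bform_symm:
  assumes "\<And>p. p \<in> upper n \<Longrightarrow> X p \<in> borel_measurable M"
  shows "(\<lambda>\<omega>. bform n (symm X \<omega>) a b) \<in> borel_measurable M"
  unfolding bform_symm_upper
proof (rule borel_measurable_sum)
  fix p assume p: "p \<in> upper n"
  obtain i j where ij: "p = (i, j)" by (cases p)
  have [measurable]: "X (i, j) \<in> borel_measurable M" using assms[OF p] ij by simp
  show "(\<lambda>\<omega>. case p of (i, j) \<Rightarrow> (if i = j then a i * b j else a i * b j + a j * b i) * X (i, j) \<omega>)
      \<in> borel_measurable M"
    unfolding ij prod.case by measurable
qed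

lemma measurable_grid_mgf:
  assumes "\<And>p. p \<in> upper n \<Longrightarrow> X p \<in> borel_measurable M"
  shows "(\<lambda>\<omega>. grid_mgf n \<theta> (symm X \<omega>)) \<in> borel_measurable M"
proof -
  have [measurable]: "(\<lambda>\<omega>. bform n (symm X \<omega>) a b) \<in> borel_measurable M" for a b
    by (rule measurable_bform_symm[OF assms])
  show ?thesis unfolding grid_mgf_def by measurable
qed

text \<open>Gaussian noise is sub-Gaussian at the scale of its variance, so the net applies without
  trace moments. The mean is the rank-one matrix of \<sigma>, diagonal included, and vanishes
  exactly on the complement of \<sigma>.\<close>

lemma Z2_exact_recovery:
  fixes \<sigma> :: "real Matrix.vec"
  assumes n: "2 \<le> n" and \<sigma>: "label_vec n \<sigma>" and \<tau>: "0 < \<tau>" and M: "Z2_sync n \<sigma> \<tau> M"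
    and a: "29 * sqrt 2 + 1 \<le> a"
    and x: "ln n + 2 * a * sqrt (ln n) + a\<^sup>2 \<le> n * I_Z2 \<tau>"
  shows "1 - 10 * exp (- sqrt (ln n)) \<le> exact_recovery_prob n (sdp_feasible n) \<sigma> M"
proof -
  have R: "random_symmetric_mat n M"
    and dist: "\<And>i j. i \<le> j \<Longrightarrow> j < n \<Longrightarrow> distributed M lborel (\<lambda>A. A $$ (i, j)) (normal_density (\<sigma> $ i * \<sigma> $ j) \<tau>)"
    using M by (auto simp: Z2_sync_def)
  interpret prob_space M by (rule random_symmetric_matD(1)[OF R])
  note indep = random_symmetric_matD(2)[OF R]
  define \<mu> where "\<mu> p = \<sigma> $ fst p * \<sigma> $ snd p" for p
  define X where "X p A = A $$ p - \<mu> p" for p and A :: "real mat"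
  have indX: "indep_vars (\<lambda>_. borel) X (upper n)"
    unfolding X_def[abs_def] by (rule indep_vars_compose2[OF indep, where Y = "\<lambda>p x. x - \<mu> p"]) measurable
  have mgf: "(\<integral>\<^sup>+A. ennreal (exp (l * X p A)) \<partial>M) = ennreal (exp (\<tau>\<^sup>2 * l\<^sup>2 / 2))" if "p \<in> upper n" for p l
    using nn_integral_exp_normal[OF dist \<tau>, of "fst p" "snd p" l] that by (auto simp: X_def \<mu>_def upper_def)
  have sX: "symm X A i j = A $$ (i, j) - \<sigma> $ i * \<sigma> $ j" if "A \<in> space M" "i < n" "j < n" for A i j
    using symm_entry[OF R that] by (simp add: symm_def X_def \<mu>_def min_def max_def)
  define \<theta> where "\<theta> = 1 / (\<tau> * sqrt n)"
  define B where "B = (48::real) ^ (2 * n) * exp (16 * n)"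
  \<comment> \<open>The slack exp n in Markov's inequality leaves failure probability exp (- n),
    below 1 / n.\<close>
  define G where "G = {A\<in>space M. grid_mgf n \<theta> (symm X A) < exp n * B}"
  have \<theta>: "0 < \<theta>" "16 * \<tau>\<^sup>2 * \<theta>\<^sup>2 * (real n)\<^sup>2 = 16 * n"
  proof -
    show "0 < \<theta>" using \<tau> n by (simp add: \<theta>_def)
    have "\<theta>\<^sup>2 = 1 / (\<tau>\<^sup>2 * n)" by (simp add: \<theta>_def power_divide power_mult_distrib)
    then show "16 * \<tau>\<^sup>2 * \<theta>\<^sup>2 * (real n)\<^sup>2 = 16 * n"
      using \<tau> n by (simp add: power2_eq_square)
  qed
  have B: "0 < B" by (simp add: B_def)
  have rv: "random_variable borel (X p)" if "p \<in> upper n" for p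
    using indX that by (auto simp: indep_vars_def)
  have meas: "(\<lambda>A. grid_mgf n \<theta> (symm X A)) \<in> borel_measurable M"
    by (rule measurable_grid_mgf[OF rv])
  have Gev: "G \<in> events" unfolding G_def using meas by measurable
  have E: "(\<integral>\<^sup>+A. ennreal (grid_mgf n \<theta> (symm X A)) \<partial>M) \<le> ennreal B"
    using nn_integral_grid_mgf_le[OF indX, of "\<tau>\<^sup>2" \<theta>] mgf \<theta>(2) by (simp add: B_def)
  have "emeasure M (space M - G) \<le> emeasure M ({A\<in>space M. 1 \<le> ennreal (1 / (exp n * B)) * ennreal (grid_mgf n \<theta> (symm X A))} \<inter> space M)"
  proof (rule emeasure_mono)
    show "{A\<in>space M. 1 \<le> ennreal (1 / (exp n * B)) * ennreal (grid_mgf n \<theta> (symm X A))} \<inter> space M \<in> events"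
      using meas by measurable
    show "space M - G \<subseteq> {A\<in>space M. 1 \<le> ennreal (1 / (exp n * B)) * ennreal (grid_mgf n \<theta> (symm X A))} \<inter> space M"
    proof
      fix A assume "A \<in> space M - G"
      then have A: "A \<in> space M" "exp n * B \<le> grid_mgf n \<theta> (symm X A)" by (auto simp: G_def)
      then have "1 \<le> 1 / (exp n * B) * grid_mgf n \<theta> (symm X A)" using B by simp
      then have "ennreal 1 \<le> ennreal (1 / (exp n * B) * grid_mgf n \<theta> (symm X A))" by (rule ennreal_leI)
      also have "\<dots> = ennreal (1 / (exp n * B)) * ennreal (grid_mgf n \<theta> (symm X A))"
        using B by (intro ennreal_mult') simp
      finally show "A \<in> {A\<in>space M. 1 \<le> ennreal (1 / (exp n * B)) * ennreal (grid_mgf n \<theta> (symm X A))} \<inter> space M"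
        using A(1) by auto
    qed
  qed
  also have "\<dots> \<le> ennreal (1 / (exp n * B)) * (\<integral>\<^sup>+A. ennreal (grid_mgf n \<theta> (symm X A)) * indicator (space M) A \<partial>M)"
    using meas nn_integral_Markov_inequality[of "\<lambda>A. ennreal (grid_mgf n \<theta> (symm X A))" "space M" M "ennreal (1 / (exp n * B))"]
    by (simp add: Int_def conj_commute)
  also have "(\<integral>\<^sup>+A. ennreal (grid_mgf n \<theta> (symm X A)) * indicator (space M) A \<partial>M)
      = (\<integral>\<^sup>+A. ennreal (grid_mgf n \<theta> (symm X A)) \<partial>M)"
    by (intro nn_integral_cong) simp
  also have "ennreal (1 / (exp n * B)) * \<dots> \<le> ennreal (1 / (exp n * B)) * ennreal B"
    by (intro mult_left_mono E) simp
  also have "\<dots> = ennreal (exp (- real n))"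
    using B by (simp add: exp_minus field_simps flip: ennreal_mult')
  finally have "prob (space M - G) \<le> exp (- real n)"
    by (simp add: emeasure_eq_measure)
  also have "\<dots> \<le> 1 / n"
  proof -
    have "real n \<le> exp (real n)" using exp_ge_add_one_self[of "real n"] by linarith
    then have "1 / exp (real n) \<le> 1 / real n" using n by (intro divide_left_mono) auto
    then show ?thesis by (simp add: exp_minus inverse_eq_divide)
  qed
  finally have GP: "1 - 1 / n \<le> prob G" using prob_compl[OF Gev] by simp
  \<comment> \<open>29 = 1 + 16 + 12: the Markov slack, the exponential moment, and two grids with
    ln 48 <= 6.\<close>
  define s where "s = 29 * \<tau> * sqrt n"
  have norm: "bform n (\<lambda>i j. A $$ (i, j)) x x \<le> s * (\<Sum>i<n. (x i)\<^sup>2)"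
    if A: "A \<in> G" and x: "(\<Sum>i<n. \<sigma> $ i * x i) = 0" for A x
  proof -
    have AM: "A \<in> space M" using A by (simp add: G_def)
    have "ln (grid_mgf n \<theta> (symm X A)) \<le> ln (exp n * B)"
      using A grid_mgf_ge_1[of n \<theta> "symm X A"] by (intro ln_mono) (auto simp: G_def)
    also have "\<dots> = 17 * n + 2 * n * ln 48"
      by (simp add: B_def ln_mult ln_realpow)
    also have "ln (48::real) \<le> 6"
    proof -
      have "(48::real) \<le> 2 ^ 6" by simp
      also have "\<dots> \<le> exp 1 ^ 6" using exp_ge_add_one_self[of "1::real"] by (intro power_mono) auto
      also have "\<dots> = exp (6::real)" by (simp flip: exp_of_nat_mult)
      finally have "ln 48 \<le> ln (exp (6::real))" by (intro ln_mono) auto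
      then show ?thesis by simp
    qed
    finally have ln: "ln (grid_mgf n \<theta> (symm X A)) \<le> 29 * n" by (simp add: mult_left_mono)
    have "bform n (symm X A) y y \<le> s" if "(\<Sum>i<n. (y i)\<^sup>2) = 1" for y
    proof -
      have "bform n (symm X A) y y \<le> ln (grid_mgf n \<theta> (symm X A)) / (\<theta> * n)"
        using \<theta> n that by (intro bform_le_ln_grid_mgf) auto
      also have "\<dots> \<le> 29 * n / (\<theta> * n)" using ln \<theta> by (intro divide_right_mono) auto
      also have "\<dots> = s" using n \<tau> by (simp add: \<theta>_def s_def)
      finally show ?thesis .
    qed
    then have "bform n (symm X A) x x \<le> s * (\<Sum>i<n. (x i)\<^sup>2)" by (rule bform_le_scale)
    moreover have "bform n (\<lambda>i j. A $$ (i, j)) x x = bform n (\<lambda>i j. symm X A i j + 1 * (\<sigma> $ i * \<sigma> $ j)) x x"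
      by (rule bform_mat_cong) (simp add: sX[OF AM])
    ultimately show ?thesis
      unfolding bform_add_mat bform_rank_one using x by simp
  qed
  \<comment> \<open>The minimiser of - t + \<tau>^2 t^2 / 2, with minimum - I.\<close>
  define t where "t = 1 / \<tau>\<^sup>2"
  define b where "b = exp (29 * sqrt 2 * sqrt (n * I_Z2 \<tau>) - n * I_Z2 \<tau>)"
  have "1 - (n * b + 1 / n) \<le> exact_recovery_prob n (sdp_set n False) \<sigma> M"
  proof (rule exact_recovery_prob_ge[OF R \<sigma>, where t = t and s = s and G = G and m = "\<lambda>_ _. exp (- t + \<tau>\<^sup>2 * t\<^sup>2 / 2)"])
    fix i j assume ij: "i < n" "j < n"
    let ?p = "(min i j, max i j)" and ?c = "\<sigma> $ i * \<sigma> $ j"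
    have c: "?c * ?c = 1" using label_vec_cases[OF \<sigma> ij(1)] label_vec_cases[OF \<sigma> ij(2)] by auto
    have "(\<integral>\<^sup>+A. ennreal (exp (- t * (\<sigma> $ i * \<sigma> $ j * A $$ (i, j)))) \<partial>M)
        = (\<integral>\<^sup>+A. ennreal (exp (- t)) * ennreal (exp ((- t * ?c) * X ?p A)) \<partial>M)"
    proof (rule nn_integral_cong)
      fix A assume A: "A \<in> space M"
      have e: "A $$ (i, j) = X ?p A + ?c" using sX[OF A ij] by (simp add: symm_def)
      have "- t * (?c * A $$ (i, j)) = - t * (?c * ?c) + (- t * ?c) * X ?p A"
        unfolding e by (simp add: algebra_simps)
      then have "exp (- t * (?c * A $$ (i, j))) = exp (- t) * exp ((- t * ?c) * X ?p A)"
        unfolding c by (simp add: exp_add[symmetric])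
      then show "ennreal (exp (- t * (?c * A $$ (i, j)))) = ennreal (exp (- t)) * ennreal (exp ((- t * ?c) * X ?p A))"
        by (simp add: ennreal_mult')
    qed
    also have "\<dots> = ennreal (exp (- t)) * (\<integral>\<^sup>+A. ennreal (exp ((- t * ?c) * X ?p A)) \<partial>M)"
      by (rule nn_integral_cmult) (use rv[of ?p] ij in \<open>auto simp: upper_def\<close>)
    also have "\<dots> = ennreal (exp (- t)) * ennreal (exp (\<tau>\<^sup>2 * (- t * ?c)\<^sup>2 / 2))"
      using ij by (subst mgf) (auto simp: upper_def)
    also have "(- t * ?c)\<^sup>2 = t\<^sup>2 * (?c * ?c)" by (simp add: power2_eq_square mult_ac)
    also have "t\<^sup>2 * (?c * ?c) = t\<^sup>2" unfolding c by simp
    also have "ennreal (exp (- t)) * ennreal (exp (\<tau>\<^sup>2 * t\<^sup>2 / 2)) = ennreal (exp (- t) * exp (\<tau>\<^sup>2 * t\<^sup>2 / 2))"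
      by (simp add: ennreal_mult')
    also have "\<dots> = ennreal (exp (- t + \<tau>\<^sup>2 * t\<^sup>2 / 2))" by (simp only: exp_add)
    finally show "(\<integral>\<^sup>+A. ennreal (exp (- t * (\<sigma> $ i * \<sigma> $ j * A $$ (i, j)))) \<partial>M)
        \<le> ennreal (exp (- t + \<tau>\<^sup>2 * t\<^sup>2 / 2))" by simp
  next
    fix i assume "i < n"
    have I: "n * I_Z2 \<tau> = n * t / 2" by (simp add: I_Z2_def t_def)
    have ts: "t * s = 29 * sqrt 2 * sqrt (n * I_Z2 \<tau>)"
    proof -
      have "sqrt 2 * sqrt (n * I_Z2 \<tau>) = sqrt (n * t)" unfolding I by (simp flip: real_sqrt_mult)
      also have "\<dots> = sqrt n / \<tau>" using \<tau> by (simp add: t_def real_sqrt_mult real_sqrt_divide)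
      finally show ?thesis using \<tau> by (simp add: t_def s_def power2_eq_square)
    qed
    have tt: "\<tau>\<^sup>2 * t\<^sup>2 = t" using \<tau> by (simp add: t_def power2_eq_square)
    have "exp (t * s) * (\<Prod>j<n. exp (- t + \<tau>\<^sup>2 * t\<^sup>2 / 2)) = exp (t * s) * exp (n * (- t + t / 2))"
      unfolding tt by (simp only: prod_constant card_lessThan exp_of_nat_mult)
    also have "\<dots> = exp (t * s + n * (- t + t / 2))" by (simp only: exp_add)
    also have "\<dots> = b" unfolding ts b_def I by (simp add: field_simps)
    finally show "exp (t * s) * (\<Prod>j<n. exp (- t + \<tau>\<^sup>2 * t\<^sup>2 / 2)) \<le> b" by simp
  qed (use Gev GP norm in \<open>auto simp: t_def\<close>)
  moreover have "n * b + 1 / n \<le> 10 * exp (- sqrt (ln n))"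
    by (rule second_order_tail_bound[OF _ _ a x]) (use n in \<open>auto simp: b_def\<close>)
  ultimately show ?thesis by (simp add: sdp_set_def)
qed

section \<open>Censored block model\<close>

context prob_space
begin

lemma
  fixes f :: "'a \<Rightarrow> real" and g :: "real \<Rightarrow> real"
  assumes f: "random_variable borel f" and V: "finite V" "(\<Sum>v\<in>V. prob {\<omega>\<in>space M. f \<omega> = v}) = 1"
  shows AE_discrete: "AE \<omega> in M. f \<omega> \<in> V"
    and integrable_discrete: "g \<in> borel_measurable borel \<Longrightarrow> integrable M (\<lambda>\<omega>. g (f \<omega>))"
    and expectation_discrete: "g \<in> borel_measurable borel \<Longrightarrow>
      expectation (\<lambda>\<omega>. g (f \<omega>)) = (\<Sum>v\<in>V. g v * prob {\<omega>\<in>space M. f \<omega> = v})"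
proof -
  let ?D = "\<lambda>v. {\<omega>\<in>space M. f \<omega> = v}"
  have D: "?D v \<in> events" for v using f by measurable
  have "prob (\<Union>v\<in>V. ?D v) = 1"
    using V D by (subst finite_measure_finite_Union) (auto simp: disjoint_family_on_def)
  then have "AE \<omega> in M. \<omega> \<in> (\<Union>v\<in>V. ?D v)" by (rule AE_prob_1)
  then show AE: "AE \<omega> in M. f \<omega> \<in> V" by eventually_elim auto
  assume g: "g \<in> borel_measurable borel"
  let ?h = "\<lambda>\<omega>. \<Sum>v\<in>V. g v * indicator (?D v) \<omega>"
  have gf: "(\<lambda>\<omega>. g (f \<omega>)) \<in> borel_measurable M" using measurable_compose[OF f g] .
  have h: "integrable M (\<lambda>\<omega>. g v * indicator (?D v) \<omega>)" for v
    using D by (intro integrable_mult_right integrable_real_indicator) (auto simp: emeasure_eq_measure)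
  have eq: "AE \<omega> in M. g (f \<omega>) = ?h \<omega>"
    using AE AE_space
  proof eventually_elim
    case (elim \<omega>)
    have "?h \<omega> = (\<Sum>v\<in>V. if v = f \<omega> then g v else 0)"
      using elim(2) by (intro sum.cong) (auto simp: indicator_def)
    then show ?case using V elim(1) by simp
  qed
  have int: "integrable M ?h" using h by simp
  show "integrable M (\<lambda>\<omega>. g (f \<omega>))"
    using int integrable_cong_AE[OF gf borel_measurable_integrable[OF int] eq] by simp
  have "expectation (\<lambda>\<omega>. g (f \<omega>)) = expectation ?h"
    by (rule integral_cong_AE[OF gf borel_measurable_integrable[OF int] eq])
  also have "\<dots> = (\<Sum>v\<in>V. g v * prob {\<omega>\<in>space M. f \<omega> = v})"
    using h D by (subst Bochner_Integration.integral_sum) auto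
  finally show "expectation (\<lambda>\<omega>. g (f \<omega>)) = (\<Sum>v\<in>V. g v * prob {\<omega>\<in>space M. f \<omega> = v})" .
qed

lemma nn_integral_discrete:
  fixes f :: "'a \<Rightarrow> real" and g :: "real \<Rightarrow> real"
  assumes f: "random_variable borel f" and V: "finite V" "(\<Sum>v\<in>V. prob {\<omega>\<in>space M. f \<omega> = v}) = 1"
    and g: "g \<in> borel_measurable borel" "\<And>x. 0 \<le> g x"
  shows "(\<integral>\<^sup>+\<omega>. ennreal (g (f \<omega>)) \<partial>M) = ennreal (\<Sum>v\<in>V. g v * prob {\<omega>\<in>space M. f \<omega> = v})"
  using integrable_discrete[OF f V g(1)] expectation_discrete[OF f V g(1)] g(2)
  by (simp add: nn_integral_eq_integral)

end

text \<open>Centred entries are halved to be bounded by 1 again; this is the factor 2. The second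
  moment of an entry dominates its variance, so a bound on the former suffices.\<close>

lemma centered_norm_bound:
  assumes R: "random_symmetric_mat n M"
    and bnd: "\<And>i j. i \<le> j \<Longrightarrow> j < n \<Longrightarrow> AE A in M. \<bar>A $$ (i, j)\<bar> \<le> 1"
    and sq: "\<And>i j. i \<le> j \<Longrightarrow> j < n \<Longrightarrow> (\<integral>A. (A $$ (i, j))\<^sup>2 \<partial>M) \<le> \<alpha>"
    and mean: "\<And>i j. i \<le> j \<Longrightarrow> j < n \<Longrightarrow> (\<integral>A. A $$ (i, j) \<partial>M) = \<mu> i j"
    and sym: "\<And>i j. \<mu> i j = \<mu> j i"
    and n: "1 \<le> n" and \<alpha>: "0 \<le> \<alpha>" "\<alpha> \<le> 1"
    and c: "0 < c" "c \<le> 1" "c * (1 + ln n) \<le> n * \<alpha>"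
  obtains G where "G \<in> sets M" "1 - 1 / n \<le> measure M G"
    "\<And>A x. A \<in> G \<Longrightarrow> bform n (\<lambda>i j. A $$ (i, j)) x x
       \<le> 2 * norm_const c * sqrt (n * \<alpha>) * (\<Sum>i<n. (x i)\<^sup>2) + bform n \<mu> x x"
proof -
  interpret prob_space M by (rule random_symmetric_matD(1)[OF R])
  note indep = random_symmetric_matD(2)[OF R]
  define X where "X p A = (A $$ p - \<mu> (fst p) (snd p)) / 2" for p and A :: "real mat"
  have indX: "indep_vars (\<lambda>_. borel) X (upper n)"
    unfolding X_def[abs_def]
    by (rule indep_vars_compose2[OF indep, where Y = "\<lambda>p x. (x - \<mu> (fst p) (snd p)) / 2"]) measurable
  have stats: "(AE A in M. \<bar>X p A\<bar> \<le> 1) \<and> expectation (X p) = 0 \<and> expectation (\<lambda>A. (X p A)\<^sup>2) \<le> \<alpha>"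
    if "p \<in> upper n" for p
  proof -
    obtain i j where p: "p = (i, j)" by (cases p)
    then have ij: "i \<le> j" "j < n" using that by (auto simp: upper_def)
    let ?f = "\<lambda>A. A $$ (i, j) :: real"
    have f: "random_variable borel ?f" using random_symmetric_mat_entry[OF R] ij by simp
    have int: "integrable M ?f"
      by (rule integrable_const_bound[of _ 1]) (use bnd[OF ij] f in auto)
    have int2: "integrable M (\<lambda>A. (?f A)\<^sup>2)"
    proof (rule integrable_const_bound[of _ 1])
      show "AE A in M. norm ((?f A)\<^sup>2) \<le> 1"
        using bnd[OF ij] by eventually_elim (simp add: abs_square_le_1)
    qed (use f in measurable)
    have m: "expectation ?f = \<mu> i j" by (rule mean[OF ij])
    have "\<bar>\<mu> i j\<bar> \<le> expectation (\<lambda>A. \<bar>?f A\<bar>)" unfolding m[symmetric] by simp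
    also have "\<dots> \<le> expectation (\<lambda>_. 1)"
      using bnd[OF ij] int by (intro integral_mono_AE) auto
    finally have \<mu>1: "\<bar>\<mu> i j\<bar> \<le> 1" by (simp add: prob_space)
    have "AE A in M. \<bar>X p A\<bar> \<le> 1"
      using bnd[OF ij] by eventually_elim (use \<mu>1 in \<open>simp add: X_def p abs_le_iff\<close>)
    moreover have "expectation (X p) = 0"
      unfolding X_def p using int m by (simp add: prob_space)
    moreover have "expectation (\<lambda>A. (X p A)\<^sup>2) \<le> \<alpha>"
    proof -
      have "expectation (\<lambda>A. (X p A)\<^sup>2) = variance ?f / 4"
        by (simp add: X_def p power_divide m)
      also have "\<dots> = (expectation (\<lambda>A. (?f A)\<^sup>2) - (\<mu> i j)\<^sup>2) / 4"
        using variance_eq[OF int int2] m by simp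
      also have "\<dots> \<le> \<alpha> / 4" using sq[OF ij] by (intro divide_right_mono) (auto intro: order.trans[rotated])
      finally show ?thesis using \<alpha> by simp
    qed
    ultimately show ?thesis by blast
  qed
  obtain G where G: "G \<in> events" "1 - 1 / n \<le> prob G"
    "\<And>A x. A \<in> G \<Longrightarrow> bform n (symm X A) x x \<le> norm_const c * sqrt (n * \<alpha>) * (\<Sum>i<n. (x i)\<^sup>2)"
    using sparse_norm_bound[of X n \<alpha> c, OF indX _ _ _ n \<alpha> c] stats by blast
  have "bform n (\<lambda>i j. A $$ (i, j)) x x
       \<le> 2 * norm_const c * sqrt (n * \<alpha>) * (\<Sum>i<n. (x i)\<^sup>2) + bform n \<mu> x x" if "A \<in> G" for A x
  proof -
    have AM: "A \<in> space M" using that G(1) sets.sets_into_space by blast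
    have "bform n (\<lambda>i j. A $$ (i, j)) x x = bform n (\<lambda>i j. (symm X A i j + symm X A i j) + \<mu> i j) x x"
    proof (rule bform_mat_cong)
      fix i j assume ij: "i < n" "j < n"
      show "A $$ (i, j) = (symm X A i j + symm X A i j) + \<mu> i j"
        using random_symmetric_matD(3)[OF R AM ij] sym[of i j]
        by (auto simp: symm_def X_def min_def max_def)
    qed
    also have "\<dots> = 2 * bform n (symm X A) x x + bform n \<mu> x x"
      unfolding bform_add_mat by simp
    finally show ?thesis using G(3)[OF that, of x] by simp
  qed
  then show ?thesis using that[of G] G by blast
qed

text \<open>The tilt depends on \<epsilon> alone, and sqrt (n \<alpha>) = sqrt (n I) / (r - e), so
  the cost t s is sqrt (n I) times a function of \<epsilon>. That function is unbounded as
  \<epsilon> tends to 0, which is why the constants depend on \<epsilon>.\<close>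

lemma CBM_exact_recovery:
  fixes \<sigma> :: "real Matrix.vec"
  assumes n: "2 \<le> n" and \<sigma>: "label_vec n \<sigma>" and \<epsilon>: "0 < \<epsilon>" "\<epsilon> < 1 / 2" and \<alpha>: "0 < \<alpha>" "\<alpha> \<le> 1"
    and M: "censored_block n \<sigma> \<alpha> \<epsilon> M"
    and a: "2 * ln (sqrt (1 - \<epsilon>) / sqrt \<epsilon>) * norm_const 1 / (sqrt (1 - \<epsilon>) - sqrt \<epsilon>) + 1 \<le> a"
    and x: "ln n + 2 * a * sqrt (ln n) + a\<^sup>2 \<le> n * I_CBM \<alpha> \<epsilon>"
  shows "1 - 10 * exp (- sqrt (ln n)) \<le> exact_recovery_prob n (sdp_feasible n) \<sigma> M"
proof -
  have R: "random_symmetric_mat n M" using M by (simp add: censored_block_def)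
  interpret prob_space M by (rule random_symmetric_matD(1)[OF R])
  define r e where "r = sqrt (1 - \<epsilon>)" and "e = sqrt \<epsilon>"
  have re: "0 < e" "e < r" "0 < r" "r * r = 1 - \<epsilon>" "e * e = \<epsilon>" using \<epsilon> by (auto simp: r_def e_def)
  define I where "I = I_CBM \<alpha> \<epsilon>"
  have I: "I = \<alpha> * (r - e)\<^sup>2"
    using \<alpha> by (simp add: I_def I_CBM_def real_sqrt_mult r_def e_def power_mult_distrib flip: right_diff_distrib)
  \<comment> \<open>Half the logarithm of (1 - \<epsilon>) / \<epsilon>, the minimiser of the
    exponential moment of an entry.\<close>
  define t where "t = ln (r / e)"
  have t: "0 < t" "exp t = r / e" "exp (- t) = e / r" using re by (auto simp: t_def exp_minus)
  let ?c = "\<lambda>i j. \<sigma> $ i * \<sigma> $ j"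
  have c: "?c i j = 1 \<or> ?c i j = - 1" if "i < n" "j < n" for i j
    using label_vec_cases[OF \<sigma> that(1)] label_vec_cases[OF \<sigma> that(2)] by auto
  let ?D = "\<lambda>i j v. {A\<in>space M. A $$ (i, j) = v}"
  have P: "prob (?D i j (?c i j)) = \<alpha> * (1 - \<epsilon>)" "prob (?D i j (- ?c i j)) = \<alpha> * \<epsilon>" "prob (?D i j 0) = 1 - \<alpha>"
    if ij: "i < n" "j < n" for i j
  proof -
    define i' j' where "i' = min i j" and "j' = max i j"
    have ij': "i' \<le> j'" "j' < n" using ij by (auto simp: i'_def j'_def)
    have "?D i j v = ?D i' j' v" for v
      using random_symmetric_matD(3)[OF R _ ij] by (auto simp: i'_def j'_def min_def max_def)
    moreover have "?c i j = ?c i' j'" by (auto simp: i'_def j'_def min_def max_def)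
    moreover have "prob (?D i' j' (?c i' j')) = \<alpha> * (1 - \<epsilon>) \<and> prob (?D i' j' (- ?c i' j')) = \<alpha> * \<epsilon> \<and>
        prob (?D i' j' 0) = 1 - \<alpha>"
      using M ij' by (simp add: censored_block_def)
    ultimately show "prob (?D i j (?c i j)) = \<alpha> * (1 - \<epsilon>)" "prob (?D i j (- ?c i j)) = \<alpha> * \<epsilon>"
      "prob (?D i j 0) = 1 - \<alpha>" by simp_all
  qed
  let ?V = "\<lambda>i j. {?c i j, - ?c i j, 0}"
  have sum: "(\<Sum>v\<in>?V i j. g v * prob (?D i j v)) = g (?c i j) * (\<alpha> * (1 - \<epsilon>)) + g (- ?c i j) * (\<alpha> * \<epsilon>) + g 0 * (1 - \<alpha>)"
    if ij: "i < n" "j < n" for i j g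
    using c[OF ij] P[OF ij] by auto
  have sum1: "(\<Sum>v\<in>?V i j. prob (?D i j v)) = 1" if ij: "i < n" "j < n" for i j
    using sum[OF ij, of "\<lambda>_. 1"] by (simp add: algebra_simps)
  note rv = random_symmetric_mat_entry[OF R]
  have fin: "finite (?V i j)" for i j by simp
  define \<mu> where "\<mu> i j = \<alpha> * (1 - 2 * \<epsilon>) * (\<sigma> $ i * \<sigma> $ j)" for i j
  define s where "s = 2 * norm_const 1 * sqrt (n * \<alpha>)"
  have K0: "0 \<le> norm_const 1" by (simp add: norm_const_def walk_const_def)
  have a1: "1 \<le> a" using a t(1) K0 re by (auto simp: t_def r_def e_def intro: order.trans[rotated])
  \<comment> \<open>Since I <= \<alpha>, this growth admits the sparse norm bound with c =
    1.\<close>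
  have x1: "1 + ln n \<le> n * I"
  proof -
    have "0 \<le> 2 * a * sqrt (ln n)" using a1 n by simp
    moreover have "1 \<le> a\<^sup>2" using a1 by simp
    ultimately show ?thesis using x by (simp add: I_def)
  qed
  have "I \<le> \<alpha>"
  proof -
    have "r \<le> 1" using \<epsilon> by (simp add: r_def)
    then have "(r - e)\<^sup>2 \<le> 1" using re by (simp add: abs_square_le_1)
    then show ?thesis using \<alpha> by (simp add: I mult_left_le)
  qed
  then have "n * I \<le> n * \<alpha>" by (intro mult_left_mono) auto
  then have d: "1 * (1 + ln n) \<le> n * \<alpha>" using x1 by simp
  have ent: "(AE A in M. \<bar>A $$ (i, j)\<bar> \<le> 1) \<and> expectation (\<lambda>A. (A $$ (i, j))\<^sup>2) \<le> \<alpha> \<and>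
      expectation (\<lambda>A. A $$ (i, j)) = \<mu> i j" if "i \<le> j" "j < n" for i j
  proof -
    have ij: "i < n" "j < n" using that by auto
    have "AE A in M. \<bar>A $$ (i, j)\<bar> \<le> 1"
      using AE_discrete[OF rv[OF ij] fin sum1[OF ij]] by eventually_elim (use c[OF ij] in auto)
    moreover have "expectation (\<lambda>A. (A $$ (i, j))\<^sup>2) = \<alpha>"
    proof -
      have c2: "(?c i j)\<^sup>2 = 1" "(- ?c i j)\<^sup>2 = 1" using c[OF ij] by (auto simp only: power2_minus power_one)
      have "expectation (\<lambda>A. (A $$ (i, j))\<^sup>2)
          = (?c i j)\<^sup>2 * (\<alpha> * (1 - \<epsilon>)) + (- ?c i j)\<^sup>2 * (\<alpha> * \<epsilon>) + 0\<^sup>2 * (1 - \<alpha>)"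
        by (rule trans[OF expectation_discrete[OF rv[OF ij] fin sum1[OF ij], of "\<lambda>x. x\<^sup>2"]
            sum[OF ij, of "\<lambda>x. x\<^sup>2"]]) measurable
      then show ?thesis unfolding c2 by (simp add: algebra_simps)
    qed
    moreover have "expectation (\<lambda>A. A $$ (i, j)) = \<mu> i j"
      using expectation_discrete[OF rv[OF ij] fin sum1[OF ij], of "\<lambda>x. x"] sum[OF ij, of "\<lambda>x. x"]
      by (simp add: \<mu>_def algebra_simps)
    ultimately show ?thesis by simp
  qed
  obtain G where G: "G \<in> events" "1 - 1 / n \<le> prob G"
    "\<And>A x. A \<in> G \<Longrightarrow> bform n (\<lambda>i j. A $$ (i, j)) x x \<le> s * (\<Sum>i<n. (x i)\<^sup>2) + bform n \<mu> x x"
    unfolding s_def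
    by (rule centered_norm_bound[OF R, where \<mu> = \<mu> and \<alpha> = \<alpha> and c = 1])
      (use ent n \<alpha> d in \<open>auto simp: \<mu>_def mult_ac\<close>)
  define b where "b = exp (2 * t * norm_const 1 / (r - e) * sqrt (n * I) - n * I)"
  \<comment> \<open>At this tilt both nonzero values contribute \<alpha> e r, and the exponential
    moment is exactly 1 - I.\<close>
  have m: "e / r * (\<alpha> * (1 - \<epsilon>)) + r / e * (\<alpha> * \<epsilon>) + (1 - \<alpha>) = 1 - I"
  proof -
    have 1: "e / r * (\<alpha> * (1 - \<epsilon>)) = \<alpha> * (e * r)" using re(3) by (simp flip: re(4))
    have 2: "r / e * (\<alpha> * \<epsilon>) = \<alpha> * (e * r)" using re(1) by (simp flip: re(5))
    have "(r - e)\<^sup>2 = r * r + e * e - 2 * (e * r)" by (simp add: power2_eq_square algebra_simps)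
    then have 3: "I = \<alpha> * (1 - 2 * (e * r))" unfolding I re(4,5) by simp
    show ?thesis unfolding 1 2 3 by (simp add: algebra_simps)
  qed
  have m0: "0 \<le> 1 - I" using re \<alpha> \<epsilon> by (subst m[symmetric]) auto
  have "1 - (n * b + 1 / n) \<le> exact_recovery_prob n (sdp_set n False) \<sigma> M"
  proof (rule exact_recovery_prob_ge[OF R \<sigma>, where t = t and s = s and G = G and m = "\<lambda>_ _. 1 - I"])
    fix i j assume ij: "i < n" "j < n"
    have "(\<integral>\<^sup>+A. ennreal (exp (- t * (\<sigma> $ i * \<sigma> $ j * A $$ (i, j)))) \<partial>M)
        = ennreal (exp (- t * (?c i j * ?c i j)) * (\<alpha> * (1 - \<epsilon>)) + exp (- t * (?c i j * - ?c i j)) * (\<alpha> * \<epsilon>)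
            + exp (- t * (?c i j * 0)) * (1 - \<alpha>))"
      using nn_integral_discrete[OF rv[OF ij] fin sum1[OF ij], of "\<lambda>x. exp (- t * (?c i j * x))"]
        sum[OF ij, of "\<lambda>x. exp (- t * (?c i j * x))"] by simp
    also have "?c i j * ?c i j = 1" using c[OF ij] by auto
    also have "exp (- t * (?c i j * - ?c i j)) = exp t" using c[OF ij] by auto
    also have "exp (- t * 1) * (\<alpha> * (1 - \<epsilon>)) + exp t * (\<alpha> * \<epsilon>) + exp (- t * (?c i j * 0)) * (1 - \<alpha>) = 1 - I"
      unfolding m[symmetric] using t by simp
    finally show "(\<integral>\<^sup>+A. ennreal (exp (- t * (\<sigma> $ i * \<sigma> $ j * A $$ (i, j)))) \<partial>M) \<le> ennreal (1 - I)"
      by simp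
  next
    fix i
    have "t * s = 2 * t * norm_const 1 / (r - e) * sqrt (n * I)"
      using re by (simp add: I s_def real_sqrt_mult)
    then have "exp (t * s) * (1 - I) ^ n \<le> exp (2 * t * norm_const 1 / (r - e) * sqrt (n * I)) * exp (- I) ^ n"
      using m0 exp_ge_add_one_self[of "- I"] by (intro mult_mono power_mono) auto
    also have "\<dots> = b" by (simp add: b_def exp_diff exp_minus exp_of_nat_mult power_inverse divide_inverse)
    finally show "exp (t * s) * (\<Prod>j<n. 1 - I) \<le> b" by simp
  next
    fix A x assume A: "A \<in> G" and o: "(\<Sum>i<n. \<sigma> $ i * x i) = 0"
    have "bform n \<mu> x x = 0" unfolding \<mu>_def bform_rank_one using o by simp
    then show "bform n (\<lambda>i j. A $$ (i, j)) x x \<le> s * (\<Sum>i<n. (x i)\<^sup>2)" using G(3)[OF A, of x] by simp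
  qed (use G t m0 in auto)
  moreover have "n * b + 1 / n \<le> 10 * exp (- sqrt (ln n))"
    by (rule second_order_tail_bound[OF _ _ a x])
      (use n t(1) K0 re in \<open>auto simp: b_def I_def t_def r_def e_def\<close>)
  ultimately show ?thesis by (simp add: sdp_set_def)
qed

section \<open>Stochastic block model\<close>

text \<open>With B the Hellinger affinity, I = - 2 ln B and 2 (1 - B) = (a - b)^2 + (d - c)^2. The
  lower bound, from - ln B >= 1 - B, controls the tilt times the noise level; the upper bound, from
  1 - B <= p and B >= 1 - p, turns the hypothesis on I into a lower bound for n p.\<close>

lemma
  fixes p q :: real
  assumes pq: "0 < q" "q < p" "p < 1"
  shows I_SBM_ge: "(p - q)\<^sup>2 / (4 * p) \<le> I_SBM p q"
    and I_SBM_le: "I_SBM p q \<le> 2 * p / (1 - p)"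
    and exp_I_SBM: "exp (- I_SBM p q) = (sqrt (p * q) + sqrt ((1 - p) * (1 - q)))\<^sup>2"
proof -
  define a b c d where "a = sqrt p" and "b = sqrt q" and "c = sqrt (1 - p)" and "d = sqrt (1 - q)"
  have sq: "a * a = p" "b * b = q" "c * c = 1 - p" "d * d = 1 - q"
    and pos: "0 < a" "0 < b" "0 < c" "0 < d" and le: "b \<le> a" "c \<le> d"
    using pq by (auto simp: a_def b_def c_def d_def)
  define B where "B = a * b + c * d"
  have B: "0 < B" using pos by (simp add: B_def add_pos_pos)
  have IB: "I_SBM p q = - 2 * ln B"
    by (simp add: I_SBM_def B_def a_def b_def c_def d_def real_sqrt_mult)
  show "exp (- I_SBM p q) = (sqrt (p * q) + sqrt ((1 - p) * (1 - q)))\<^sup>2"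
  proof -
    have "exp (- I_SBM p q) = exp (ln B) * exp (ln B)" unfolding IB by (simp flip: exp_add)
    also have "\<dots> = B\<^sup>2" using B by (simp add: power2_eq_square)
    finally show ?thesis by (simp add: B_def a_def b_def c_def d_def real_sqrt_mult)
  qed
  have B1: "2 * (1 - B) = (a - b)\<^sup>2 + (d - c)\<^sup>2"
  proof -
    have "(a - b)\<^sup>2 + (d - c)\<^sup>2 = a * a + b * b + c * c + d * d - 2 * B"
      by (simp add: B_def power2_eq_square algebra_simps)
    then show ?thesis unfolding sq by simp
  qed
  have lnB: "ln B \<le> B - 1" using ln_le_minus_one[OF B] .
  have "(p - q)\<^sup>2 / (4 * p) \<le> (a - b)\<^sup>2"
  proof -
    have "p - q = (a - b) * (a + b)" by (simp add: sq[symmetric] algebra_simps)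
    then have "(p - q)\<^sup>2 = (a - b)\<^sup>2 * (a + b)\<^sup>2" by (simp add: power_mult_distrib)
    also have "\<dots> \<le> (a - b)\<^sup>2 * (2 * a)\<^sup>2" using le pos by (intro mult_left_mono power_mono) auto
    also have "(2 * a)\<^sup>2 = 4 * p" using sq(1) by (simp add: power2_eq_square)
    finally show ?thesis using pq by (simp add: pos_divide_le_eq)
  qed
  also have "\<dots> \<le> 2 * (1 - B)" using B1 by simp
  also have "\<dots> \<le> I_SBM p q" using lnB IB by simp
  finally show "(p - q)\<^sup>2 / (4 * p) \<le> I_SBM p q" .
  have "(a - b)\<^sup>2 \<le> a * a" using le pos by (simp add: power2_eq_square mult_mono)
  moreover have "(d - c)\<^sup>2 \<le> p - q"
  proof -
    have "(d - c)\<^sup>2 \<le> (d - c) * (d + c)" unfolding power2_eq_square using le pos by (intro mult_left_mono) auto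
    also have "\<dots> = d * d - c * c" by (simp add: algebra_simps)
    finally show ?thesis unfolding sq by simp
  qed
  ultimately have "2 * (1 - B) \<le> a * a + (p - q)" unfolding B1 by (rule add_mono)
  also have "a * a + (p - q) \<le> 2 * p" unfolding sq using pq by simp
  finally have "1 - B \<le> p" by simp
  have "1 - p \<le> B"
  proof -
    have "c * c \<le> c * d" using le pos by (intro mult_left_mono) auto
    moreover have "0 \<le> a * b" using pos by simp
    ultimately show ?thesis unfolding B_def sq by linarith
  qed
  have "- ln B \<le> 1 / B - 1"
    using ln_le_minus_one[of "1 / B"] B by (simp add: ln_div)
  also have "\<dots> = (1 - B) / B" using B by (simp add: diff_divide_distrib)
  also have "\<dots> \<le> p / (1 - p)" using \<open>1 - B \<le> p\<close> \<open>1 - p \<le> B\<close> pq by (intro frac_le) auto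
  finally show "I_SBM p q \<le> 2 * p / (1 - p)" using IB by simp
qed

lemma prob_SBM_entry:
  assumes "prob_space M" "f \<in> borel_measurable M"
    and d: "distr M borel f = distr (measure_pmf (bernoulli_pmf p)) borel of_bool" and p: "0 \<le> p" "p \<le> 1"
  shows "measure M {\<omega>\<in>space M. f \<omega> = (1::real)} = p" "measure M {\<omega>\<in>space M. f \<omega> = 0} = 1 - p"
proof -
  have eq: "measure M {\<omega>\<in>space M. f \<omega> = v} = measure (bernoulli_pmf p) {b. of_bool b = v}" for v
  proof -
    have "measure M {\<omega>\<in>space M. f \<omega> = v} = measure (distr M borel f) {v}"
      using assms(2) by (subst measure_distr) (auto intro!: arg_cong[of _ _ "measure M"])
    also have "\<dots> = measure (bernoulli_pmf p) {b. of_bool b = v}"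
      unfolding d by (subst measure_distr) (auto intro!: arg_cong[of _ _ "measure (bernoulli_pmf p)"])
    finally show ?thesis .
  qed
  have "{b. of_bool b = (1::real)} = {True}" "{b. of_bool b = (0::real)} = {False}" by auto
  then show "measure M {\<omega>\<in>space M. f \<omega> = 1} = p" "measure M {\<omega>\<in>space M. f \<omega> = 0} = 1 - p"
    using p by (simp_all add: eq measure_pmf_single)
qed

text \<open>The mean combines the all-ones matrix and the rank-one matrix of \<sigma>; the balance
  constraint of the program makes the first vanish as a form. Entries within and across communities
  have different exponential moments, and balance again pairs them up in every row.\<close>

lemma SBM_exact_recovery:
  fixes \<sigma> :: "real Matrix.vec"
  assumes c01: "0 < c0" "0 < c1" "c1 < 1"
    and n: "2 \<le> n" and \<sigma>: "label_vec n \<sigma>" and pq: "0 < c0 * p" "c0 * p \<le> q" "q < p" "p \<le> 1 - c1"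
    and M: "symmetric_SBM n \<sigma> p q M"
    and a: "norm_const c1 * (1 / c0 + 1 / c1) * sqrt 8 + 1 \<le> a"
    and x: "ln n + 2 * a * sqrt (ln n) + a\<^sup>2 \<le> n / 2 * I_SBM p q"
  shows "1 - 10 * exp (- sqrt (ln n)) \<le> exact_recovery_prob n (sdp_feasible_SBM n) \<sigma> M"
proof -
  have R: "random_symmetric_mat n M" and bal: "(\<Sum>i<n. \<sigma> $ i) = 0" using M by (auto simp: symmetric_SBM_def)
  interpret prob_space M by (rule random_symmetric_matD(1)[OF R])
  have "0 < q" using pq(1,2) by (rule less_le_trans)
  then have pos: "0 < q" "0 < p" "p < 1" "q < 1" using c01 pq by auto
  define I where "I = I_SBM p q"
  define X where "X = n / 2 * I"
  let ?c = "\<lambda>i j. \<sigma> $ i * \<sigma> $ j"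
  have c: "?c i j = 1 \<or> ?c i j = - 1" if "i < n" "j < n" for i j
    using label_vec_cases[OF \<sigma> that(1)] label_vec_cases[OF \<sigma> that(2)] by auto
  define P where "P i j = (if ?c i j = 1 then p else q)" for i j
  have P01: "0 \<le> P i j" "P i j \<le> 1" "P i j \<le> p" for i j using pos pq by (auto simp: P_def)
  let ?D = "\<lambda>i j v. {A\<in>space M. A $$ (i, j) = v}"
  note rv = random_symmetric_mat_entry[OF R]
  have D: "prob (?D i j 1) = P i j" "prob (?D i j 0) = 1 - P i j" if ij: "i < n" "j < n" for i j
  proof -
    define i' j' where "i' = min i j" and "j' = max i j"
    have ij': "i' \<le> j'" "j' < n" "i' < n" using ij by (auto simp: i'_def j'_def)
    have "?D i j v = ?D i' j' v" for v
      using random_symmetric_matD(3)[OF R _ ij] by (auto simp: i'_def j'_def min_def max_def)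
    moreover have "P i j = P i' j'" by (auto simp: i'_def j'_def min_def max_def P_def mult.commute)
    moreover have "distr M borel (\<lambda>A. A $$ (i', j')) = distr (measure_pmf (bernoulli_pmf (P i' j'))) borel of_bool"
      using M ij' c[OF ij'(3,2)] by (auto simp: symmetric_SBM_def P_def)
    ultimately show "prob (?D i j 1) = P i j" "prob (?D i j 0) = 1 - P i j"
      using prob_SBM_entry[OF prob_space_axioms rv[OF ij'(3,2)] _ P01(1,2)] by simp_all
  qed
  have sum: "(\<Sum>v\<in>{1, 0}. g v * prob (?D i j v)) = g 1 * P i j + g 0 * (1 - P i j)"
    if ij: "i < n" "j < n" for i j g
    using D[OF ij] by simp
  have sum1: "(\<Sum>v\<in>{1, 0}. prob (?D i j v)) = 1" if ij: "i < n" "j < n" for i j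
    using sum[OF ij, of "\<lambda>_. 1"] by simp
  have fin: "finite {1, 0 :: real}" by simp
  \<comment> \<open>The factor \<open>1 * 1\<close> fits the all-ones part to the pattern of
    \<open>bform_rank_one\<close>.\<close>
  define \<mu> where "\<mu> i j = (p + q) / 2 * (1 * 1) + (p - q) / 2 * (\<sigma> $ i * \<sigma> $ j)" for i j
  have P\<mu>: "P i j = \<mu> i j" if "i < n" "j < n" for i j
    using c[OF that] by (elim disjE; simp only: P_def \<mu>_def; simp add: field_simps)
  define s where "s = 2 * norm_const c1 * sqrt (n * p)"
  have K0: "0 \<le> norm_const c1" by (simp add: norm_const_def walk_const_def c01 less_imp_le)
  have KK: "0 \<le> norm_const c1 * (1 / c0 + 1 / c1) * sqrt 8" using K0 c01 by simp
  have a1: "1 \<le> a" using a KK by linarith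
  have x1: "1 + ln n \<le> X"
  proof -
    have "0 \<le> 2 * a * sqrt (ln n)" using a1 n by simp
    moreover have "1 \<le> a\<^sup>2" using a1 by simp
    ultimately show ?thesis using x by (simp add: I_def X_def)
  qed
  \<comment> \<open>From c1 I <= 2 p; the sparse norm bound is then applied with c = c1.\<close>
  have d: "c1 * (1 + ln n) \<le> n * p"
  proof -
    have "I \<le> 2 * p / (1 - p)" unfolding I_def by (intro I_SBM_le) (use pos pq in auto)
    also have "\<dots> \<le> 2 * p / c1" using pos pq c01 by (intro divide_left_mono) auto
    finally have "c1 * I \<le> 2 * p" using c01 by (simp add: field_simps)
    then have "n / 2 * (c1 * I) \<le> n / 2 * (2 * p)" by (intro mult_left_mono) auto
    then have "c1 * X \<le> n * p" by (simp add: X_def mult_ac)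
    moreover have "c1 * (1 + ln n) \<le> c1 * X" using x1 c01 by (intro mult_left_mono) auto
    ultimately show ?thesis by linarith
  qed
  have ent: "(AE A in M. \<bar>A $$ (i, j)\<bar> \<le> 1) \<and> expectation (\<lambda>A. (A $$ (i, j))\<^sup>2) \<le> p \<and>
      expectation (\<lambda>A. A $$ (i, j)) = \<mu> i j" if "i \<le> j" "j < n" for i j
  proof -
    have ij: "i < n" "j < n" using that by auto
    have "AE A in M. \<bar>A $$ (i, j)\<bar> \<le> 1"
      using AE_discrete[OF rv[OF ij] fin sum1[OF ij]] by eventually_elim auto
    moreover have "expectation (\<lambda>A. (A $$ (i, j))\<^sup>2) = 1\<^sup>2 * P i j + 0\<^sup>2 * (1 - P i j)"
      by (rule trans[OF expectation_discrete[OF rv[OF ij] fin sum1[OF ij], of "\<lambda>x. x\<^sup>2"]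
            sum[OF ij, of "\<lambda>x. x\<^sup>2"]]) measurable
    moreover have "expectation (\<lambda>A. A $$ (i, j)) = 1 * P i j + 0 * (1 - P i j)"
      by (rule trans[OF expectation_discrete[OF rv[OF ij] fin sum1[OF ij], of "\<lambda>x. x"]
            sum[OF ij, of "\<lambda>x. x"]]) measurable
    ultimately show ?thesis using P01(3)[of i j] P\<mu>[OF ij] by simp
  qed
  obtain G where G: "G \<in> events" "1 - 1 / n \<le> prob G"
    "\<And>A x. A \<in> G \<Longrightarrow> bform n (\<lambda>i j. A $$ (i, j)) x x \<le> s * (\<Sum>i<n. (x i)\<^sup>2) + bform n \<mu> x x"
    unfolding s_def
    by (rule centered_norm_bound[OF R, where \<mu> = \<mu> and \<alpha> = p and c = c1])
      (use ent n pos c01 d in \<open>auto simp: \<mu>_def mult_ac\<close>)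
  \<comment> \<open>The root of the odds ratio; its logarithm is the tilt that minimises the product
    of the two exponential moments.\<close>
  define T where "T = (sqrt p * sqrt (1 - q)) / (sqrt q * sqrt (1 - p))"
  define t where "t = ln T"
  have T1: "1 \<le> T"
  proof -
    have "sqrt q * sqrt (1 - p) \<le> sqrt p * sqrt (1 - q)" using pos pq by (intro mult_mono) auto
    then show ?thesis using pos by (simp add: T_def)
  qed
  have t: "0 \<le> t" "exp t = T" "exp (- t) = 1 / T" using T1 by (auto simp: t_def exp_minus inverse_eq_divide)
  define u w where "u = 1 - p + p / T" and "w = 1 - q + q * T"
  have uw0: "0 \<le> u" "0 \<le> w" using pos T1 by (auto simp: u_def w_def)
  \<comment> \<open>Separately, u and w carry the reciprocal factors c / d and d / c; these cancel
    in the product.\<close>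
  have uw: "u * w = exp (- I)"
  proof -
    define a b c d where "a = sqrt p" and "b = sqrt q" and "c = sqrt (1 - p)" and "d = sqrt (1 - q)"
    have sq: "a * a = p" "b * b = q" "c * c = 1 - p" "d * d = 1 - q"
      and abcd: "a \<noteq> 0" "b \<noteq> 0" "c \<noteq> 0" "d \<noteq> 0"
      using pos by (auto simp: a_def b_def c_def d_def)
    have T: "T = (a * d) / (b * c)" by (simp add: T_def a_def b_def c_def d_def)
    have "u = (c / d) * (a * b + c * d)"
      using abcd unfolding u_def T sq(3)[symmetric] unfolding sq(1)[symmetric] by (simp add: field_simps)
    moreover have "w = (d / c) * (a * b + c * d)"
      using abcd unfolding w_def T sq(4)[symmetric] unfolding sq(2)[symmetric] by (simp add: field_simps)
    ultimately have "u * w = (a * b + c * d)\<^sup>2" using abcd by (simp add: power2_eq_square)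
    also have "\<dots> = exp (- I)"
      unfolding I_def by (subst exp_I_SBM) (use pos pq in \<open>auto simp: a_def b_def c_def d_def real_sqrt_mult\<close>)
    finally show ?thesis .
  qed
  \<comment> \<open>The log odds ratio is split and ln y <= y - 1 applied twice; q >= c0 p and 1 - p
    >= c1 >= c1 p bring both terms to multiples of (p - q) / p.\<close>
  have t_le: "t \<le> (1 / c0 + 1 / c1) * ((p - q) / p) / 2"
  proof -
    have "t = (ln (p / q) + ln ((1 - q) / (1 - p))) / 2"
      using pos by (simp add: t_def T_def ln_div ln_mult ln_sqrt field_simps)
    also have "\<dots> \<le> ((p / q - 1) + ((1 - q) / (1 - p) - 1)) / 2"
      using pos by (intro divide_right_mono add_mono ln_le_minus_one) auto
    also have "\<dots> = ((p - q) / q + (p - q) / (1 - p)) / 2"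
      using pos by (simp add: field_simps)
    also have "\<dots> \<le> ((p - q) / (c0 * p) + (p - q) / (c1 * p)) / 2"
    proof (intro divide_right_mono add_mono divide_left_mono)
      have "c1 * p \<le> c1" using pos c01 by (intro mult_left_le) auto
      then show "c1 * p \<le> 1 - p" using pq by linarith
    qed (use pos pq c01 in auto)
    also have "\<dots> = (1 / c0 + 1 / c1) * ((p - q) / p) / 2" using c01 pos by (simp add: field_simps)
    finally show ?thesis .
  qed
  \<comment> \<open>The 8 comes from (p - q)^2 / (4 p) <= I together with X = n I / 2.\<close>
  have ts: "t * s \<le> norm_const c1 * (1 / c0 + 1 / c1) * sqrt 8 * sqrt X"
  proof -
    have "(p - q) / p * sqrt (n * p) \<le> sqrt (8 * X)"
    proof (rule real_le_rsqrt)
      have "((p - q) / p * sqrt (n * p))\<^sup>2 = 4 * n * ((p - q)\<^sup>2 / (4 * p))"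
        using pos by (simp add: power_mult_distrib power_divide) (simp add: power2_eq_square)
      also have "\<dots> \<le> 4 * n * I"
        unfolding I_def by (intro mult_left_mono I_SBM_ge) (use pos pq in auto)
      also have "4 * n * I = 8 * X" by (simp add: X_def)
      finally show "((p - q) / p * sqrt (n * p))\<^sup>2 \<le> 8 * X" .
    qed
    have "t * s \<le> ((1 / c0 + 1 / c1) * ((p - q) / p) / 2) * s"
      using K0 pos by (intro mult_right_mono t_le) (simp add: s_def)
    also have "\<dots> = norm_const c1 * (1 / c0 + 1 / c1) * ((p - q) / p * sqrt (n * p))"
      by (simp add: s_def)
    also have "\<dots> \<le> norm_const c1 * (1 / c0 + 1 / c1) * sqrt (8 * X)"
      using K0 c01 \<open>(p - q) / p * sqrt (n * p) \<le> sqrt (8 * X)\<close> by (intro mult_left_mono) auto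
    finally show ?thesis by (simp add: real_sqrt_mult mult_ac)
  qed
  define b where "b = exp (norm_const c1 * (1 / c0 + 1 / c1) * sqrt 8 * sqrt X - X)"
  have "1 - (n * b + 1 / n) \<le> exact_recovery_prob n (sdp_set n True) \<sigma> M"
  proof (rule exact_recovery_prob_ge[OF R \<sigma> bal, where t = t and s = s and G = G and
        m = "\<lambda>i j. if ?c i j = 1 then u else w"])
    fix i j assume ij: "i < n" "j < n"
    have "(\<integral>\<^sup>+A. ennreal (exp (- t * (?c i j * A $$ (i, j)))) \<partial>M)
        = ennreal (exp (- t * (?c i j * 1)) * P i j + exp (- t * (?c i j * 0)) * (1 - P i j))"
      by (rule trans[OF nn_integral_discrete[OF rv[OF ij] fin sum1[OF ij], of "\<lambda>x. exp (- t * (?c i j * x))"]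
          arg_cong[OF sum[OF ij, of "\<lambda>x. exp (- t * (?c i j * x))"], of ennreal]]) simp_all
    also have "exp (- t * (?c i j * 1)) * P i j + exp (- t * (?c i j * 0)) * (1 - P i j)
        = (if ?c i j = 1 then u else w)"
      using c[OF ij] t by (auto simp: P_def u_def w_def)
    finally show "(\<integral>\<^sup>+A. ennreal (exp (- t * (\<sigma> $ i * \<sigma> $ j * A $$ (i, j)))) \<partial>M)
        \<le> ennreal (if \<sigma> $ i * \<sigma> $ j = 1 then u else w)" by simp
  next
    fix i assume i: "i < n"
    \<comment> \<open>Numbers of columns inside the community of i, with i itself included, and
      outside it; balance makes them equal.\<close>
    define h where "h = card {j\<in>{..<n}. ?c i j = 1}"
    define h' where "h' = card {j\<in>{..<n}. ?c i j \<noteq> 1}"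
    have split: "(\<Sum>j<n. f (?c i j = 1)) = h * f True + h' * f False" for f :: "bool \<Rightarrow> real"
    proof -
      have "(\<Sum>j<n. f (?c i j = 1)) = (\<Sum>j<n. if ?c i j = 1 then f True else f False)"
        by (intro sum.cong) auto
      then show ?thesis by (simp add: sum.If_cases h_def h'_def Int_def Compl_eq)
    qed
    have "(\<Sum>j<n. ?c i j) = (\<Sum>j<n. if ?c i j = 1 then 1 else - 1)"
      using c[OF i] by (intro sum.cong) auto
    moreover have "(\<Sum>j<n. ?c i j) = 0" using bal by (simp flip: sum_distrib_left)
    ultimately have "real h = h'" using split[of "\<lambda>b. if b then 1 else - 1"] by simp
    moreover have "real n = h + h'" using split[of "\<lambda>_. 1"] by simp
    ultimately have h: "h' = h" "real n = 2 * h" by auto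
    have "(\<Prod>j<n. if ?c i j = 1 then u else w) = u ^ h * w ^ h'"
      by (simp add: prod.If_cases h_def h'_def Int_def Compl_eq)
    also have "\<dots> = (u * w) ^ h" by (simp add: h power_mult_distrib)
    also have "\<dots> = exp (- X)" unfolding uw X_def by (simp add: h(2) flip: exp_of_nat_mult)
    finally have "exp (t * s) * (\<Prod>j<n. if ?c i j = 1 then u else w) = exp (t * s - X)"
      by (simp add: exp_diff exp_minus divide_inverse)
    then show "exp (t * s) * (\<Prod>j<n. if \<sigma> $ i * \<sigma> $ j = 1 then u else w) \<le> b"
      using ts by (simp add: b_def)
  next
    fix A x assume A: "A \<in> G" and o: "(\<Sum>i<n. \<sigma> $ i * x i) = 0" and "True \<Longrightarrow> (\<Sum>i<n. x i) = 0"
    then have "bform n \<mu> x x = 0"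
      unfolding \<mu>_def bform_add_mat bform_rank_one by simp
    then show "bform n (\<lambda>i j. A $$ (i, j)) x x \<le> s * (\<Sum>i<n. (x i)\<^sup>2)" using G(3)[OF A, of x] by simp
  qed (use G t uw0 in auto)
  moreover have "n * b + 1 / n \<le> 10 * exp (- sqrt (ln n))"
    by (rule second_order_tail_bound[OF _ KK a x]) (use n in \<open>auto simp: b_def X_def I_def\<close>)
  ultimately show ?thesis by (simp add: sdp_set_def)
qed

theorem mainTheorem7:
  fixes c\<^sub>0 c\<^sub>1 :: real
  assumes "0 < c\<^sub>0" "c\<^sub>0 < 1" "0 < c\<^sub>1" "c\<^sub>1 < 1"
  shows
    "(\<exists>C\<^sub>1>0. \<exists>C\<^sub>2>0.
        (\<forall>n \<sigma> \<tau> M.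
           2 \<le> n \<and> label_vec n \<sigma> \<and> 0 < \<tau> \<and> Z2_sync n \<sigma> \<tau> M \<and>
           real n * I_Z2 \<tau> / ln (real n) \<ge> 1 + C\<^sub>1 / sqrt (ln (real n)) + C\<^sub>2 / ln (real n)
           \<longrightarrow> exact_recovery_prob n (sdp_feasible n) \<sigma> M \<ge> 1 - 10 * exp (- sqrt (ln (real n)))) \<and>
        (\<forall>n \<sigma> p q M.
           2 \<le> n \<and> label_vec n \<sigma> \<and> 0 < c\<^sub>0 * p \<and> c\<^sub>0 * p \<le> q \<and> q < p \<and> p \<le> 1 - c\<^sub>1 \<and>
           symmetric_SBM n \<sigma> p q M \<and>
           real n / 2 * I_SBM p q / ln (real n) \<ge> 1 + C\<^sub>1 / sqrt (ln (real n)) + C\<^sub>2 / ln (real n)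
           \<longrightarrow> exact_recovery_prob n (sdp_feasible_SBM n) \<sigma> M \<ge> 1 - 10 * exp (- sqrt (ln (real n))))) \<and>
     (\<forall>\<epsilon>. 0 < \<epsilon> \<and> \<epsilon> < 1 / 2 \<longrightarrow>
        (\<exists>C\<^sub>1>0. \<exists>C\<^sub>2>0. \<forall>n \<sigma> \<alpha> M.
           2 \<le> n \<and> label_vec n \<sigma> \<and> 0 < \<alpha> \<and> \<alpha> \<le> 1 \<and> censored_block n \<sigma> \<alpha> \<epsilon> M \<and>
           real n * I_CBM \<alpha> \<epsilon> / ln (real n) \<ge> 1 + C\<^sub>1 / sqrt (ln (real n)) + C\<^sub>2 / ln (real n)
           \<longrightarrow> exact_recovery_prob n (sdp_feasible n) \<sigma> M \<ge> 1 - 10 * exp (- sqrt (ln (real n)))))"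
proof (intro conjI allI impI)
  (* with C1 = 2 a and C2 = a^2 the hypothesis says that nbar I is at least (sqrt (ln n) + a)^2 *)
  define a where "a = max (29 * sqrt 2) (norm_const c\<^sub>1 * (1 / c\<^sub>0 + 1 / c\<^sub>1) * sqrt 8) + 1"
  have a: "29 * sqrt 2 + 1 \<le> a" "norm_const c\<^sub>1 * (1 / c\<^sub>0 + 1 / c\<^sub>1) * sqrt 8 + 1 \<le> a"
    by (auto simp: a_def)
  have a0: "0 < a" using a(1) real_sqrt_ge_zero[of 2] by linarith
  show "\<exists>C\<^sub>1>0. \<exists>C\<^sub>2>0.
        (\<forall>n \<sigma> \<tau> M.
           2 \<le> n \<and> label_vec n \<sigma> \<and> 0 < \<tau> \<and> Z2_sync n \<sigma> \<tau> M \<and>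
           real n * I_Z2 \<tau> / ln (real n) \<ge> 1 + C\<^sub>1 / sqrt (ln (real n)) + C\<^sub>2 / ln (real n)
           \<longrightarrow> exact_recovery_prob n (sdp_feasible n) \<sigma> M \<ge> 1 - 10 * exp (- sqrt (ln (real n)))) \<and>
        (\<forall>n \<sigma> p q M.
           2 \<le> n \<and> label_vec n \<sigma> \<and> 0 < c\<^sub>0 * p \<and> c\<^sub>0 * p \<le> q \<and> q < p \<and> p \<le> 1 - c\<^sub>1 \<and>
           symmetric_SBM n \<sigma> p q M \<and>
           real n / 2 * I_SBM p q / ln (real n) \<ge> 1 + C\<^sub>1 / sqrt (ln (real n)) + C\<^sub>2 / ln (real n)
           \<longrightarrow> exact_recovery_prob n (sdp_feasible_SBM n) \<sigma> M \<ge> 1 - 10 * exp (- sqrt (ln (real n))))"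
  proof (rule exI[of _ "2 * a"], rule conjI, use a0 in simp, rule exI[of _ "a\<^sup>2"], rule conjI,
      use a0 in simp, (intro conjI allI impI; elim conjE))
    fix n \<sigma> \<tau> M
    assume "2 \<le> n" "label_vec n \<sigma>" "0 < \<tau>" "Z2_sync n \<sigma> \<tau> M"
      and "real n * I_Z2 \<tau> / ln (real n) \<ge> 1 + 2 * a / sqrt (ln (real n)) + a\<^sup>2 / ln (real n)"
    then show "exact_recovery_prob n (sdp_feasible n) \<sigma> M \<ge> 1 - 10 * exp (- sqrt (ln (real n)))"
      using a(1) by (intro Z2_exact_recovery scaled_threshold)
  next
    fix n \<sigma> p q M
    assume "2 \<le> n" "label_vec n \<sigma>" "0 < c\<^sub>0 * p" "c\<^sub>0 * p \<le> q" "q < p" "p \<le> 1 - c\<^sub>1"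
      "symmetric_SBM n \<sigma> p q M"
      and "real n / 2 * I_SBM p q / ln (real n) \<ge> 1 + 2 * a / sqrt (ln (real n)) + a\<^sup>2 / ln (real n)"
    then show "exact_recovery_prob n (sdp_feasible_SBM n) \<sigma> M \<ge> 1 - 10 * exp (- sqrt (ln (real n)))"
      using a(2) assms by (intro SBM_exact_recovery[OF assms(1,3,4)] scaled_threshold)
  qed
next
  fix \<epsilon> :: real
  assume \<epsilon>: "0 < \<epsilon> \<and> \<epsilon> < 1 / 2"
  \<comment> \<open>A function of \<epsilon> alone, so that \<alpha> may vary with n; the maximum
    with 0 makes both constants positive.\<close>
  define a where "a = max 0 (2 * ln (sqrt (1 - \<epsilon>) / sqrt \<epsilon>) * norm_const 1 / (sqrt (1 - \<epsilon>) - sqrt \<epsilon>)) + 1"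
  have a: "2 * ln (sqrt (1 - \<epsilon>) / sqrt \<epsilon>) * norm_const 1 / (sqrt (1 - \<epsilon>) - sqrt \<epsilon>) + 1 \<le> a" "0 < a"
    by (auto simp: a_def)
  show "\<exists>C\<^sub>1>0. \<exists>C\<^sub>2>0. \<forall>n \<sigma> \<alpha> M.
           2 \<le> n \<and> label_vec n \<sigma> \<and> 0 < \<alpha> \<and> \<alpha> \<le> 1 \<and> censored_block n \<sigma> \<alpha> \<epsilon> M \<and>
           real n * I_CBM \<alpha> \<epsilon> / ln (real n) \<ge> 1 + C\<^sub>1 / sqrt (ln (real n)) + C\<^sub>2 / ln (real n)
           \<longrightarrow> exact_recovery_prob n (sdp_feasible n) \<sigma> M \<ge> 1 - 10 * exp (- sqrt (ln (real n)))"
  proof (rule exI[of _ "2 * a"], rule conjI, use a in simp, rule exI[of _ "a\<^sup>2"], rule conjI,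
      use a in simp, (intro allI impI; elim conjE))
    fix n \<sigma> \<alpha> M
    assume "2 \<le> n" "label_vec n \<sigma>" "0 < \<alpha>" "\<alpha> \<le> 1" "censored_block n \<sigma> \<alpha> \<epsilon> M"
      and "real n * I_CBM \<alpha> \<epsilon> / ln (real n) \<ge> 1 + 2 * a / sqrt (ln (real n)) + a\<^sup>2 / ln (real n)"
    then show "exact_recovery_prob n (sdp_feasible n) \<sigma> M \<ge> 1 - 10 * exp (- sqrt (ln (real n)))"
      using a(1) \<epsilon> by (intro CBM_exact_recovery scaled_threshold) auto
  qed
qed

end
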